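(* Let $L$ consist of a single ternary relation symbol $R$, and let $\mathcal{K}_0$, $\mu$, $\mathcal{K}_\mu$ be as in the context. Suppose the following assumption holds: (i) if $A\leq B_1,B_2\in\mathcal{K}_\mu$ and the free amalgam of $B_1$ and $B_2$ over $A$ is not in $\mathcal{K}_\mu$, then either there exist $a,a'\in A$ and $b_i\in B_i\setminus A$ with $\{a,a',b_i\}\in R^{B_i}$ (for $i=1,2$), or there exist $Y\subseteq A$ with $\delta(Y)\geq 3$ and minimally simply algebraic extensions $Y\leq Z_i\subseteq B_i$ ($i=1,2$) which are isomorphic over $Y$ with $Z_i\setminus Y\subseteq B_i\setminus A$; and (ii) $(\mathcal{K}_\mu,\leq)$ is an amalgamation class. Suppose also that $\mu(Y,Z)\geq 3$ for all minimally simply algebraic extensions $Y\leq Z$ in $\mathcal{K}_0$ with $\delta(Y)\geq 3$. Let $\mathcal{N}_\mu$ be the generic structure of $(\mathcal{K}_\mu,\leq)$ and $\mathcal{M}_0(L)$ the generic structure of $(\mathcal{C}_0(L),\leq)$. Let $X\leq\mathcal{N}_\mu$ with $d(X)=3$. Then the localization $G_X(\mathcal{N}_\mu)$ is isomorphic to $G(\mathcal{M}_0(L))$.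
   Context: In an $L$-structure $A$, $R^A$ is a set of 3-element subsets of $A$; substructures are induced. For finite $A$, $\delta(A)=|A|-|R^A|$. $\mathcal{C}_0(L)$: finite $L$-structures all of whose subsets have $\delta\geq0$. For $A\subseteq B\in\mathcal{C}_0(L)$, $A\leq B$ means $\delta(A)\leq\delta(B')$ whenever $A\subseteq B'\subseteq B$. $\bar{\mathcal{C}}_0(L)$: $L$-structures all of whose finite substructures lie in $\mathcal{C}_0(L)$; there $A\leq B$ means $\delta(C)\geq\delta(C\cap A)$ for all finite $C\subseteq B$. For finite $A\subseteq B\in\bar{\mathcal{C}}_0(L)$, $d(A)=d_B(A)=\min\{\delta(A'):A\subseteq A'\subseteq B\text{ finite}\}$; ${\rm cl}_B(A)=\{c:d_B(A\cup\{c\})=d_B(A)\}$, extended to infinite sets by unions over finite subsets. $(B,{\rm cl}_B)$ is a pregeometry with geometry $G(B)$ (points ${\rm cl}_B(x)\setminus{\rm cl}_B(\emptyset)$ for $x\notin{\rm cl}_B(\emptyset)$, induced closure); for $Y\subseteq B$, $G_Y(B)$ is the geometry of the localized pregeometry with closure $Z\mapsto{\rm cl}_B(Y\cup Z)$. Free amalgam over a common substructure: disjoint union with union of relations. For $Y\leq Z$, $Y\neq Z$: algebraic if $\delta(Y)=\delta(Z)$; simply algebraic if also $\delta(Z')>\delta(Y)$ for $Y\subsetneq Z'\subsetneq Z$; minimally simply algebraic (msa) if also $Y'\subseteq Y'\cup(Z\setminus Y)$ is not simply algebraic for all $Y'\subsetneq Y$. $\mu$ is a function from isomorphism types of msa extensions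 in $\mathcal{C}_0(L)$ to non-negative integers; $\mathcal{C}_\mu(L)$ is the class of $A\in\mathcal{C}_0(L)$ not containing, for any msa $Y\leq Z$, a copy of $Y$ together with $\mu(Y,Z)+1$ copies of $Z$ over it whose parts outside $Y$ are pairwise disjoint. $\mathcal{K}_0=\{A\in\mathcal{C}_0(L): B\leq A\text{ for all }B\subseteq A\text{ with }|B|\leq 3\}$ and $\mathcal{K}_\mu=\mathcal{K}_0\cap\mathcal{C}_\mu(L)$. Amalgamation class and generic structure: $(\mathcal{A},\leq)$ with $\mathcal{A}\subseteq\mathcal{C}_0(L)$ closed under self-sufficient substructures and with amalgamation (if $A\leq B_1,B_2\in\mathcal{A}$ there are $C\in\mathcal{A}$ and embeddings $f_i:B_i\to C$, $f_i(B_i)\leq C$, agreeing on $A$); its generic structure is the unique countable $\mathcal{M}\in\bar{\mathcal{C}}_0(L)$ that is the union of a chain $A_0\leq A_1\leq\cdots$ in $\mathcal{A}$ such that for finite $A\leq\mathcal{M}$ and $A\leq B\in\mathcal{A}$ there is an embedding of $B$ into $\mathcal{M}$ over $A$ with self-sufficient image. $(\mathcal{C}_0(L),\leq)$ is an amalgamation class.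
   Formalization: The formal statement additionally assumes that R is nonempty in N_μ; without it the claim fails: if μ=0 on the extension {a,b}≤{a,b,c} with {a,b,c} in R, then N_μ is a pure set and its localization is a trivial geometry. *)

theory Defs
  imports Main "HOL-Library.Countable_Set"
begin

section \<open>Structures, predimension and self-sufficiency\<close>

datatype 'a lstruct = LStruct (pts: "'a set") (rel: "'a set set")

definition is_lstruct :: "'a lstruct \<Rightarrow> bool" where
  "is_lstruct A \<longleftrightarrow> (\<forall>r\<in>rel A. r \<subseteq> pts A \<and> card r = 3)"

definition induced :: "'a lstruct \<Rightarrow> 'a set \<Rightarrow> 'a lstruct" where
  "induced B S = LStruct S {r \<in> rel B. r \<subseteq> S}"

definition embedding :: "('a \<Rightarrow> 'b) \<Rightarrow> 'a lstruct \<Rightarrow> 'b lstruct \<Rightarrow> bool" where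
  "embedding f A B \<longleftrightarrow> inj_on f (pts A) \<and> f ` pts A \<subseteq> pts B \<and>
     (\<forall>r. r \<subseteq> pts A \<longrightarrow> (f ` r \<in> rel B \<longleftrightarrow> r \<in> rel A))"

definition isomorphism :: "('a \<Rightarrow> 'b) \<Rightarrow> 'a lstruct \<Rightarrow> 'b lstruct \<Rightarrow> bool" where
  "isomorphism f A B \<longleftrightarrow> embedding f A B \<and> f ` pts A = pts B"

text \<open>The predimension of the substructure of \<open>B\<close> induced on the finite set \<open>S \<subseteq> pts B\<close>.\<close>

definition delta :: "'a lstruct \<Rightarrow> 'a set \<Rightarrow> int" where
  "delta B S = int (card S) - int (card {r \<in> rel B. r \<subseteq> S})"

definition C0 :: "'a lstruct set" where
  "C0 = {A. is_lstruct A \<and> finite (pts A) \<and> (\<forall>S\<subseteq>pts A. delta A S \<ge> 0)}"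

definition C0bar :: "'a lstruct set" where
  "C0bar = {A. is_lstruct A \<and> (\<forall>S\<subseteq>pts A. finite S \<longrightarrow> induced A S \<in> C0)}"

text \<open>\<open>selfsuff A B\<close> is \<open>A \<le> B\<close>, in the form that is meaningful for arbitrary structures; for finite
  \<open>B\<close> it is the condition that no superset of \<open>A\<close> has smaller predimension, see
  \<open>selfsuff_finite_iff\<close> below.\<close>

definition selfsuff :: "'a set \<Rightarrow> 'a lstruct \<Rightarrow> bool" where
  "selfsuff A B \<longleftrightarrow> A \<subseteq> pts B \<and>
     (\<forall>C\<subseteq>pts B. finite C \<longrightarrow> delta B C \<ge> delta B (C \<inter> A))"

lemma delta_submodular:
  assumes "finite A" "finite C"
  shows "delta B (C \<union> A) + delta B (C \<inter> A) \<le> delta B C + delta B A"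
proof -
  let ?R = "\<lambda>S. {r \<in> rel B. r \<subseteq> S}"
  have fin: "finite (?R S)" if "finite S" for S
    by (rule finite_subset[of _ "Pow S"]) (use that in auto)
  have "card (?R C) + card (?R A) = card (?R C \<union> ?R A) + card (?R C \<inter> ?R A)"
    by (rule card_Un_Int) (use fin assms in auto)
  moreover have "?R C \<inter> ?R A = ?R (C \<inter> A)" by auto
  moreover have "card (?R C \<union> ?R A) \<le> card (?R (C \<union> A))"
    by (rule card_mono) (use fin assms in auto)
  moreover have "card C + card A = card (C \<union> A) + card (C \<inter> A)"
    by (rule card_Un_Int) (use assms in auto)
  ultimately show ?thesis unfolding delta_def by simp
qed

lemma selfsuff_finite_iff:
  assumes "finite (pts B)"
  shows "selfsuff A B \<longleftrightarrow>
    A \<subseteq> pts B \<and> (\<forall>B'. A \<subseteq> B' \<and> B' \<subseteq> pts B \<longrightarrow> delta B A \<le> delta B B')"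
proof (intro iffI conjI allI impI)
  fix B' assume "selfsuff A B" and B': "A \<subseteq> B' \<and> B' \<subseteq> pts B"
  then have "delta B B' \<ge> delta B (B' \<inter> A)"
    unfolding selfsuff_def using assms finite_subset by blast
  moreover have "B' \<inter> A = A" using B' by blast
  ultimately show "delta B A \<le> delta B B'" by simp
next
  assume asm: "A \<subseteq> pts B \<and> (\<forall>B'. A \<subseteq> B' \<and> B' \<subseteq> pts B \<longrightarrow> delta B A \<le> delta B B')"
  have "delta B (C \<inter> A) \<le> delta B C" if "C \<subseteq> pts B" for C
  proof -
    have "finite A" "finite C" using asm that assms finite_subset by blast+
    moreover have "delta B A \<le> delta B (C \<union> A)" using asm that by simp
    ultimately show ?thesis using delta_submodular[of A C B] by simp
  qed
  then show "selfsuff A B" unfolding selfsuff_def using asm by simp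
qed (simp add: selfsuff_def)

section \<open>Dimension, closure and geometries\<close>

definition dim :: "'a lstruct \<Rightarrow> 'a set \<Rightarrow> int" where
  "dim B A = (LEAST k. \<exists>A'. A \<subseteq> A' \<and> A' \<subseteq> pts B \<and> finite A' \<and> k = delta B A')"

text \<open>The closure of a finite set \<open>A\<close> is \<open>fin_cl B A\<close>; the union over finite subsets in \<open>cl\<close> is
  consistent with this, see \<open>cl_finite\<close> below.\<close>

definition fin_cl :: "'a lstruct \<Rightarrow> 'a set \<Rightarrow> 'a set" where
  "fin_cl B A = {c \<in> pts B. dim B (A \<union> {c}) = dim B A}"

definition cl :: "'a lstruct \<Rightarrow> 'a set \<Rightarrow> 'a set" where
  "cl B X = (\<Union>A\<in>{A. finite A \<and> A \<subseteq> X}. fin_cl B A)"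

lemma dim_attained:
  assumes "B \<in> C0bar" "finite A" "A \<subseteq> pts B"
  obtains A' where "A \<subseteq> A'" "A' \<subseteq> pts B" "finite A'" "dim B A = delta B A'"
    "\<And>A''. A \<subseteq> A'' \<Longrightarrow> A'' \<subseteq> pts B \<Longrightarrow> finite A'' \<Longrightarrow> dim B A \<le> delta B A''"
proof -
  let ?P = "\<lambda>A'. A \<subseteq> A' \<and> A' \<subseteq> pts B \<and> finite A'"
  have nonneg: "0 \<le> delta B S" if "S \<subseteq> pts B" "finite S" for S
  proof -
    have "induced B S \<in> C0" using assms(1) that unfolding C0bar_def by blast
    then have "0 \<le> delta (induced B S) S" unfolding C0_def induced_def by auto
    moreover have "{r \<in> rel (induced B S). r \<subseteq> S} = {r \<in> rel B. r \<subseteq> S}"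
      unfolding induced_def by auto
    ultimately show ?thesis unfolding delta_def by simp
  qed
  obtain A' where A': "?P A'" "\<And>y. ?P y \<Longrightarrow> nat (delta B A') \<le> nat (delta B y)"
    using ex_has_least_nat[of ?P A "\<lambda>S. nat (delta B S)"] assms by blast
  have min: "delta B A' \<le> delta B y" if "?P y" for y
    using A'(2)[OF that] nonneg[of y] nonneg[of A'] that A'(1) by simp
  have "dim B A = delta B A'"
    unfolding dim_def by (rule Least_equality) (use A'(1) min in auto)
  then show ?thesis using that[of A'] A'(1) min by auto
qed

lemma cl_finite:
  assumes B: "B \<in> C0bar" and X: "finite X" "X \<subseteq> pts B"
  shows "cl B X = fin_cl B X"
proof
  show "fin_cl B X \<subseteq> cl B X" unfolding cl_def using X by blast
  show "cl B X \<subseteq> fin_cl B X"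
  proof
    fix c assume "c \<in> cl B X"
    then obtain A where A: "finite A" "A \<subseteq> X" and c: "c \<in> pts B" "dim B (A \<union> {c}) = dim B A"
      unfolding cl_def fin_cl_def by blast
    have Ap: "A \<subseteq> pts B" using A X by blast
    have A1: "dim B A \<le> delta B A''" if "A \<subseteq> A''" "A'' \<subseteq> pts B" "finite A''" for A''
      by (rule dim_attained[OF B A(1) Ap]) (use that in blast)
    obtain A2 where A2: "A \<union> {c} \<subseteq> A2" "A2 \<subseteq> pts B" "finite A2" "dim B (A \<union> {c}) = delta B A2"
      by (rule dim_attained[OF B, of "A \<union> {c}"]) (use A Ap c(1) in auto)
    obtain X1 where X1: "X \<subseteq> X1" "X1 \<subseteq> pts B" "finite X1" "dim B X = delta B X1"
      "\<And>A''. X \<subseteq> A'' \<Longrightarrow> A'' \<subseteq> pts B \<Longrightarrow> finite A'' \<Longrightarrow> dim B X \<le> delta B A''"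
      by (rule dim_attained[OF B X]) blast
    obtain X2 where X2: "X \<union> {c} \<subseteq> X2" "X2 \<subseteq> pts B" "finite X2" "dim B (X \<union> {c}) = delta B X2"
      "\<And>A''. X \<union> {c} \<subseteq> A'' \<Longrightarrow> A'' \<subseteq> pts B \<Longrightarrow> finite A'' \<Longrightarrow> dim B (X \<union> {c}) \<le> delta B A''"
      by (rule dim_attained[OF B, of "X \<union> {c}"]) (use X c(1) in auto)
    have "dim B A \<le> delta B (X1 \<inter> A2)"
      by (rule A1) (use A A2 X1 in auto)
    moreover have "dim B (X \<union> {c}) \<le> delta B (X1 \<union> A2)"
      by (rule X2(5)) (use A2 X1 in auto)
    moreover have "dim B X \<le> delta B X2"
      by (rule X1(5)) (use X2 in auto)
    ultimately have "dim B (X \<union> {c}) = dim B X"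
      using delta_submodular[OF A2(3) X1(3), of B] A2(4) X1(4) X2(4) c(2) by linarith
    then show "c \<in> fin_cl B X" unfolding fin_cl_def using c(1) by simp
  qed
qed

text \<open>A geometry is its set of points together with its closure operator; the operator matters only
  on sets of points. The points of the geometry of a pregeometry are subsets of its carrier.\<close>

type_synonym 'p geometry = "'p set \<times> ('p set \<Rightarrow> 'p set)"

definition geom_points :: "'a set \<Rightarrow> ('a set \<Rightarrow> 'a set) \<Rightarrow> 'a set set" where
  "geom_points S c = {c {x} - c {} | x. x \<in> S \<and> x \<notin> c {}}"

definition geometry_of :: "'a set \<Rightarrow> ('a set \<Rightarrow> 'a set) \<Rightarrow> 'a set geometry" where
  "geometry_of S c =
     (geom_points S c, \<lambda>P. {q \<in> geom_points S c. q \<subseteq> c (\<Union>P)})"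

definition Geom :: "'a lstruct \<Rightarrow> 'a set geometry" where
  "Geom B = geometry_of (pts B) (cl B)"

definition Geom_loc :: "'a set \<Rightarrow> 'a lstruct \<Rightarrow> 'a set geometry" where
  "Geom_loc Y B = geometry_of (pts B) (\<lambda>Z. cl B (Y \<union> Z))"

definition geometry_isomorphic :: "'p geometry \<Rightarrow> 'q geometry \<Rightarrow> bool" where
  "geometry_isomorphic G H \<longleftrightarrow>
     (\<exists>f. bij_betw f (fst G) (fst H) \<and> (\<forall>P\<subseteq>fst G. f ` snd G P = snd H (f ` P)))"

section \<open>Algebraic extensions and the classes\<close>

definition algebraic_ext :: "'a set \<Rightarrow> 'a lstruct \<Rightarrow> bool" where
  "algebraic_ext Y Z \<longleftrightarrow>
     Z \<in> C0 \<and> selfsuff Y Z \<and> Y \<noteq> pts Z \<and> delta Z Y = delta Z (pts Z)"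

definition simply_algebraic :: "'a set \<Rightarrow> 'a lstruct \<Rightarrow> bool" where
  "simply_algebraic Y Z \<longleftrightarrow> algebraic_ext Y Z \<and>
     (\<forall>Z'. Y \<subset> Z' \<and> Z' \<subset> pts Z \<longrightarrow> delta Z Z' > delta Z Y)"

definition msa :: "'a set \<Rightarrow> 'a lstruct \<Rightarrow> bool" where
  "msa Y Z \<longleftrightarrow> simply_algebraic Y Z \<and>
     (\<forall>Y'. Y' \<subset> Y \<longrightarrow> \<not> simply_algebraic Y' (induced Z (Y' \<union> (pts Z - Y))))"

text \<open>Every finite structure has a copy on a set of natural numbers, so a function on isomorphism
  types of msa extensions is an isomorphism-invariant function on the msa extensions living
  on natural numbers.\<close>

definition iso_invariant :: "(nat set \<Rightarrow> nat lstruct \<Rightarrow> nat) \<Rightarrow> bool" where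
  "iso_invariant \<mu> \<longleftrightarrow> (\<forall>Y Z Y' Z' f. msa Y Z \<and> msa Y' Z' \<and> isomorphism f Z Z' \<and> f ` Y = Y'
      \<longrightarrow> \<mu> Y Z = \<mu> Y' Z')"

definition Cmu :: "(nat set \<Rightarrow> nat lstruct \<Rightarrow> nat) \<Rightarrow> 'a lstruct set" where
  "Cmu \<mu> = {A \<in> C0. \<not> (\<exists>Y Z. \<exists>f :: nat \<Rightarrow> nat \<Rightarrow> 'a. msa Y Z \<and>
      (\<forall>i<\<mu> Y Z + 1. embedding (f i) Z A) \<and>
      (\<forall>i<\<mu> Y Z + 1. \<forall>j<\<mu> Y Z + 1. i \<noteq> j \<longrightarrow>
         (\<forall>y\<in>Y. f i y = f j y) \<and> f i ` (pts Z - Y) \<inter> f j ` (pts Z - Y) = {}))}"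

definition K0 :: "'a lstruct set" where
  "K0 = {A \<in> C0. \<forall>B\<subseteq>pts A. card B \<le> 3 \<longrightarrow> selfsuff B A}"

definition Kmu :: "(nat set \<Rightarrow> nat lstruct \<Rightarrow> nat) \<Rightarrow> 'a lstruct set" where
  "Kmu \<mu> = K0 \<inter> Cmu \<mu>"

section \<open>Amalgamation and generic structures\<close>

text \<open>To be applied to structures meeting exactly in a common substructure.\<close>

definition free_amalgam :: "'a lstruct \<Rightarrow> 'a lstruct \<Rightarrow> 'a lstruct" where
  "free_amalgam B1 B2 = LStruct (pts B1 \<union> pts B2) (rel B1 \<union> rel B2)"

definition amalgamation_class :: "nat lstruct set \<Rightarrow> bool" where
  "amalgamation_class \<A> \<longleftrightarrow> \<A> \<subseteq> C0 \<and>
     (\<forall>B\<in>\<A>. \<forall>A. selfsuff A B \<longrightarrow> induced B A \<in> \<A>) \<and>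
     (\<forall>B1\<in>\<A>. \<forall>B2\<in>\<A>. \<forall>A. selfsuff A B1 \<and> selfsuff A B2 \<and> induced B1 A = induced B2 A \<longrightarrow>
        (\<exists>C\<in>\<A>. \<exists>f1 f2. embedding f1 B1 C \<and> embedding f2 B2 C \<and>
           selfsuff (f1 ` pts B1) C \<and> selfsuff (f2 ` pts B2) C \<and> (\<forall>a\<in>A. f1 a = f2 a)))"

text \<open>The class is given by its members on natural numbers, whereas \<open>M\<close> may live on any type. Hence
  membership of the \<open>A i\<close> is up to isomorphism, and a self-sufficient substructure of \<open>M\<close> with an
  extension in the class is given as the image of a self-sufficient embedding \<open>e\<close>.\<close>

definition is_generic :: "nat lstruct set \<Rightarrow> 'a lstruct \<Rightarrow> bool" where
  "is_generic \<A> M \<longleftrightarrow> countable (pts M) \<and> M \<in> C0bar \<and>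
     (\<exists>A :: nat \<Rightarrow> 'a set.
        (\<forall>i. \<exists>B\<in>\<A>. \<exists>g. isomorphism g B (induced M (A i))) \<and>
        (\<forall>i. selfsuff (A i) (induced M (A (Suc i)))) \<and>
        (\<Union>i. A i) = pts M) \<and>
     (\<forall>B\<in>\<A>. \<forall>A e. selfsuff A B \<and> embedding e (induced B A) M \<and> selfsuff (e ` A) M \<longrightarrow>
        (\<exists>f. embedding f B M \<and> (\<forall>a\<in>A. f a = e a) \<and> selfsuff (f ` pts B) M))"

end

theory Submission
  imports Defs "HOL-Library.Nat_Bijection"
begin

text \<open>
  The isomorphism is built by back-and-forth from finite partial injections of \<open>N\<close> into \<open>M\<close> with
  self-sufficient domain and range, whose domain contains \<open>X\<close> and which turn dimension over \<open>X\<close> in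
  \<open>N\<close> into dimension in \<open>M\<close>. The dimension function of an extension of a structure \<open>A\<close> depends only
  on the dimension function of \<open>A\<close> and on the relations that are not inside \<open>A\<close>, so to enlarge the
  domain one simply transfers these relations to \<open>M\<close>.

  To enlarge the range, the relations \<open>r\<close> transferred to \<open>N\<close> would in general violate \<open>Kmu \<mu>\<close>. Each
  incidence \<open>p \<in> r\<close> is therefore replaced by a long cycle of new points whose consecutive points are
  related through one label: once \<open>p\<close> itself, otherwise one of three unrelated points of \<open>X\<close>. Over
  \<open>X\<close> all points of the cycle are interalgebraic with \<open>p\<close>, and \<open>r\<close> is replaced by a triangle
  joining its three cycles, which does not change the dimension over \<open>X\<close>. Cycle points lie in at
  most three relations, so they cannot belong to the base of four disjoint copies of a minimally
  simply algebraic extension, and such a copy contains a cycle entirely or not at all. The cycle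
  lengths grow so fast that two disjoint copies of the same size contain no cycle, whence all copies
  lie in \<open>A\<close>.
\<close>

section \<open>Predimension\<close>

lemma is_lstructD:
  assumes "is_lstruct B" "r \<in> rel B"
  shows "r \<subseteq> pts B" "card r = 3" "finite r"
proof -
  show "r \<subseteq> pts B" "card r = 3" using assms by (auto simp: is_lstruct_def)
  then show "finite r" by (metis card.infinite zero_neq_numeral)
qed

lemma delta_eq: "delta B W = int (card W) - int (card (rel B \<inter> Pow W))"
proof -
  have "{r \<in> rel B. r \<subseteq> W} = rel B \<inter> Pow W" by auto
  then show ?thesis by (simp add: delta_def)
qed

lemma delta_le_card: "delta B W \<le> int (card W)"
  by (simp add: delta_eq)

lemma delta_cong: "rel A \<inter> Pow W = rel B \<inter> Pow W \<Longrightarrow> delta A W = delta B W"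
  by (simp add: delta_eq)

lemma pts_induced [simp]: "pts (induced B S) = S"
  by (simp add: induced_def)

lemma rel_induced [simp]: "rel (induced B S) = rel B \<inter> Pow S"
  by (auto simp: induced_def)

lemma delta_induced: "W \<subseteq> S \<Longrightarrow> delta (induced B S) W = delta B W"
  by (rule delta_cong) auto

lemma is_lstruct_induced: "is_lstruct B \<Longrightarrow> is_lstruct (induced B S)"
  by (auto simp: is_lstruct_def)

lemma delta_Int_Diff:
  assumes "finite W"
  shows "delta B W = delta B (W \<inter> A) + int (card (W - A)) - int (card ((rel B - Pow A) \<inter> Pow W))"
proof -
  have "rel B \<inter> Pow W = rel B \<inter> Pow (W \<inter> A) \<union> (rel B - Pow A) \<inter> Pow W" by blast
  moreover have "card (rel B \<inter> Pow (W \<inter> A) \<union> (rel B - Pow A) \<inter> Pow W)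
      = card (rel B \<inter> Pow (W \<inter> A)) + card ((rel B - Pow A) \<inter> Pow W)"
    by (rule card_Un_disjoint) (use assms in auto)
  moreover have "card W = card (W \<inter> A) + card (W - A)"
    using assms by (rule card_Int_Diff)
  ultimately show ?thesis by (simp add: delta_eq)
qed

lemma delta_relative_antimono:
  assumes fin: "finite W" "finite V" and V: "W \<inter> A \<subseteq> V" "V \<subseteq> A"
    and rel: "rel B - Pow A = rel B' - Pow A"
  shows "delta B' (V \<union> (W - A)) - delta B' V \<le> delta B W - delta B (W \<inter> A)"
proof -
  let ?W = "V \<union> (W - A)"
  have "card ((rel B - Pow A) \<inter> Pow W) \<le> card ((rel B' - Pow A) \<inter> Pow ?W)"
    unfolding rel by (rule card_mono) (use fin V in auto)
  moreover have "?W \<inter> A = V" "?W - A = W - A" using V by auto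
  ultimately show ?thesis
    using delta_Int_Diff[of W B A] delta_Int_Diff[of ?W B' A] fin by simp
qed

definition degree :: "'a lstruct \<Rightarrow> 'a set \<Rightarrow> 'a \<Rightarrow> nat" where
  "degree B W x = card {r \<in> rel B. x \<in> r \<and> r \<subseteq> W}"

lemma delta_insert:
  assumes "finite W" "x \<notin> W"
  shows "delta B (insert x W) = delta B W + 1 - int (degree B (insert x W) x)"
proof -
  have "insert x W \<inter> W = W" "insert x W - W = {x}"
    "(rel B - Pow W) \<inter> Pow (insert x W) = {r \<in> rel B. x \<in> r \<and> r \<subseteq> insert x W}"
    using assms(2) by auto
  then show ?thesis
    using delta_Int_Diff[of "insert x W" B W] assms(1) by (simp add: degree_def)
qed

lemma delta_card_le_2:
  assumes "is_lstruct B" "finite W" "card W \<le> 2"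
  shows "delta B W = int (card W)"
proof -
  have "\<not> r \<subseteq> W" if "r \<in> rel B" for r
    using is_lstructD(2)[OF assms(1) that] card_mono[OF assms(2), of r] assms(3) by auto
  then have "rel B \<inter> Pow W = {}" by blast
  then show ?thesis by (simp only: delta_eq) simp
qed

lemma delta_card_3:
  assumes "is_lstruct B" "card W = 3"
  shows "delta B W = (if W \<in> rel B then 2 else 3)"
proof -
  have "finite W" using assms(2) by (metis card.infinite zero_neq_numeral)
  then have "r = W" if "r \<in> rel B" "r \<subseteq> W" for r
    using card_subset_eq[of W r] is_lstructD(2)[OF assms(1)] that assms(2) by simp
  then have "rel B \<inter> Pow W = (if W \<in> rel B then {W} else {})" by auto
  then show ?thesis using assms(2) by (simp only: delta_eq) simp
qed

lemma le_choose_3: "4 \<le> n \<Longrightarrow> n \<le> n choose 3"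
proof (induction n rule: dec_induct)
  case base
  show ?case by (simp add: numeral_eq_Suc)
next
  case (step n)
  then have "1 \<le> n choose 2" by (simp add: Suc_le_eq)
  then show ?case using step.IH by (simp add: numeral_3_eq_3 numeral_2_eq_2)
qed

lemma ex_unrelated_triple:
  assumes "is_lstruct B" "finite W" "4 \<le> card W" "0 < delta B W"
  shows "\<exists>T\<subseteq>W. card T = 3 \<and> T \<notin> rel B"
proof (rule ccontr)
  assume "\<not> ?thesis"
  then have "{T. T \<subseteq> W \<and> card T = 3} \<subseteq> rel B \<inter> Pow W" by blast
  then have "card {T. T \<subseteq> W \<and> card T = 3} \<le> card (rel B \<inter> Pow W)"
    using assms(2) by (intro card_mono) auto
  then have "card W \<le> card (rel B \<inter> Pow W)"
    using n_subsets[OF assms(2), of 3] le_choose_3[OF assms(3)] by simp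
  then show False using assms(4) by (simp add: delta_eq)
qed

lemma ex_unrelated_triple_of_delta:
  assumes "is_lstruct B" "finite W" "3 \<le> delta B W"
  shows "\<exists>T\<subseteq>W. card T = 3 \<and> T \<notin> rel B"
proof (cases "4 \<le> card W")
  case False
  then have card: "card W = 3" using assms(3) delta_le_card[of B W] by simp
  then have "W \<notin> rel B" using delta_card_3[OF assms(1) card] assms(3) by auto
  then show ?thesis using card by blast
next
  case True
  then show ?thesis using ex_unrelated_triple[OF assms(1,2)] assms(3) by simp
qed

section \<open>Embeddings\<close>

lemma embeddingD:
  assumes "embedding f A B"
  shows "inj_on f (pts A)" "f ` pts A \<subseteq> pts B" "\<And>r. r \<subseteq> pts A \<Longrightarrow> f ` r \<in> rel B \<longleftrightarrow> r \<in> rel A"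
  using assms by (auto simp: embedding_def)

lemma delta_embedding:
  assumes "embedding f A B" "W \<subseteq> pts A"
  shows "delta B (f ` W) = delta A W"
proof -
  note f = embeddingD[OF assms(1)]
  have "rel B \<inter> Pow (f ` W) = (`) f ` (rel A \<inter> Pow W)"
  proof (intro subset_antisym subsetI)
    fix r assume r: "r \<in> rel B \<inter> Pow (f ` W)"
    then obtain r' where "r' \<subseteq> W" "r = f ` r'" by (auto simp: subset_image_iff)
    then show "r \<in> (`) f ` (rel A \<inter> Pow W)" using f(3)[of r'] assms(2) r by auto
  next
    fix r assume "r \<in> (`) f ` (rel A \<inter> Pow W)"
    then obtain r' where "r' \<in> rel A" "r' \<subseteq> W" "r = f ` r'" by blast
    then show "r \<in> rel B \<inter> Pow (f ` W)" using f(3)[of r'] assms(2) by auto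
  qed
  moreover have "inj_on ((`) f) (rel A \<inter> Pow W)"
    by (rule inj_on_subset[OF inj_on_image_Pow[OF f(1)]]) (use assms(2) in auto)
  moreover have "card (f ` W) = card W"
    by (rule card_image) (rule inj_on_subset[OF f(1) assms(2)])
  ultimately show ?thesis by (simp add: delta_eq card_image)
qed

lemma embedding_comp:
  assumes f: "embedding f A B" and g: "embedding g B C"
  shows "embedding (g \<circ> f) A C"
  unfolding embedding_def
proof (intro conjI allI impI)
  show "inj_on (g \<circ> f) (pts A)"
    using embeddingD(1,2)[OF f] embeddingD(1)[OF g] by (blast intro: comp_inj_on inj_on_subset)
  show "(g \<circ> f) ` pts A \<subseteq> pts C"
    using embeddingD(2)[OF f] embeddingD(2)[OF g] by auto
  fix r assume r: "r \<subseteq> pts A"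
  then have "f ` r \<subseteq> pts B" using embeddingD(2)[OF f] by blast
  then show "(g \<circ> f) ` r \<in> rel C \<longleftrightarrow> r \<in> rel A"
    using embeddingD(3)[OF f r] embeddingD(3)[OF g] by (simp only: image_comp[symmetric])
qed

lemma embedding_inv_into:
  assumes "isomorphism f A B"
  shows "embedding (inv_into (pts A) f) B A"
proof -
  let ?g = "inv_into (pts A) f"
  have f: "embedding f A B" and im: "f ` pts A = pts B" using assms by (auto simp: isomorphism_def)
  have into: "?g ` r \<subseteq> pts A" if "r \<subseteq> pts B" for r
    using that im by (blast intro: inv_into_into)
  have "?g ` r \<in> rel A \<longleftrightarrow> r \<in> rel B" if "r \<subseteq> pts B" for r
    using embeddingD(3)[OF f into[OF that]] image_inv_into_cancel[OF im that] by simp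
  then show ?thesis
    unfolding embedding_def using into inj_on_inv_into[of "pts B" f "pts A"] im by simp
qed

lemma embedding_induced: "S \<subseteq> T \<Longrightarrow> embedding id (induced B S) (induced B T)"
  by (auto simp: embedding_def)

lemma embedding_induced_whole: "S \<subseteq> pts B \<Longrightarrow> embedding id (induced B S) B"
  by (auto simp: embedding_def)

lemma embedding_into_induced:
  assumes "embedding f A B" "f ` pts A \<subseteq> S"
  shows "embedding f A (induced B S)"
  unfolding embedding_def
proof (intro conjI allI impI)
  show "inj_on f (pts A)" "f ` pts A \<subseteq> pts (induced B S)"
    using embeddingD(1)[OF assms(1)] assms(2) by simp_all
  fix r assume r: "r \<subseteq> pts A"
  then have "f ` r \<subseteq> S" using assms(2) by blast
  then show "f ` r \<in> rel (induced B S) \<longleftrightarrow> r \<in> rel A" using embeddingD(3)[OF assms(1) r] by simp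
qed

lemma is_lstruct_embedding:
  assumes "embedding f A B" "is_lstruct B" "\<And>r. r \<in> rel A \<Longrightarrow> r \<subseteq> pts A"
  shows "is_lstruct A"
  unfolding is_lstruct_def
proof (intro ballI conjI assms(3))
  fix r assume r: "r \<in> rel A"
  then have "f ` r \<in> rel B" using embeddingD(3)[OF assms(1)] assms(3) by blast
  moreover have "card (f ` r) = card r"
    by (rule card_image) (rule inj_on_subset[OF embeddingD(1)[OF assms(1)] assms(3)[OF r]])
  ultimately show "card r = 3" using is_lstructD(2)[OF assms(2)] by simp
qed

lemma embedding_card_le_3:
  assumes "is_lstruct A" "is_lstruct B" "finite (pts A)" "card (pts A) \<le> 3"
    and h: "inj_on h (pts A)" "h ` pts A \<subseteq> pts B"
    and rel: "h ` pts A \<in> rel B \<longleftrightarrow> pts A \<in> rel A"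
  shows "embedding h A B"
  unfolding embedding_def
proof (intro conjI allI impI h)
  fix r assume r: "r \<subseteq> pts A"
  have "card (h ` r) = card r" by (rule card_image) (rule inj_on_subset[OF h(1) r])
  then have "card r = 3" if "h ` r \<in> rel B \<or> r \<in> rel A"
    using that is_lstructD(2) assms(1,2) by metis
  then have "r = pts A" if "h ` r \<in> rel B \<or> r \<in> rel A"
    using that card_seteq[OF assms(3) r] assms(4) by simp
  then show "h ` r \<in> rel B \<longleftrightarrow> r \<in> rel A" using rel by blast
qed

definition pullback :: "('a \<Rightarrow> 'b) \<Rightarrow> 'a set \<Rightarrow> 'b lstruct \<Rightarrow> 'a lstruct" where
  "pullback f C B = LStruct C {r. r \<subseteq> C \<and> f ` r \<in> rel B}"

lemma pts_pullback [simp]: "pts (pullback f C B) = C"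
  by (simp add: pullback_def)

lemma embedding_pullback:
  "inj_on f C \<Longrightarrow> f ` C \<subseteq> pts B \<Longrightarrow> embedding f (pullback f C B) B"
  by (auto simp: embedding_def pullback_def)

lemma induced_pullback:
  assumes "A \<subseteq> C" "\<And>k. k \<in> A \<Longrightarrow> f k = g k"
  shows "induced (pullback f C B) A = pullback g A B"
proof -
  have "f ` r = g ` r" if "r \<subseteq> A" for r
    using that assms(2) by (intro image_cong) auto
  then show ?thesis using assms(1) by (auto simp: pullback_def induced_def)
qed

lemma is_lstruct_pullback:
  assumes "is_lstruct B" "inj_on f C" "f ` C \<subseteq> pts B"
  shows "is_lstruct (pullback f C B)"
  by (rule is_lstruct_embedding[OF embedding_pullback[OF assms(2,3)] assms(1)])
    (simp add: pullback_def)

section \<open>Self-sufficiency and dimension\<close>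

lemma C0bar_iff:
  "B \<in> C0bar \<longleftrightarrow> is_lstruct B \<and> (\<forall>W\<subseteq>pts B. finite W \<longrightarrow> 0 \<le> delta B W)"
proof
  assume B: "B \<in> C0bar"
  have "0 \<le> delta B W" if W: "W \<subseteq> pts B" "finite W" for W
  proof -
    have "induced B W \<in> C0" using B W by (simp add: C0bar_def)
    then show ?thesis by (auto simp: C0_def delta_induced)
  qed
  then show "is_lstruct B \<and> (\<forall>W\<subseteq>pts B. finite W \<longrightarrow> 0 \<le> delta B W)"
    using B by (simp add: C0bar_def)
next
  assume "is_lstruct B \<and> (\<forall>W\<subseteq>pts B. finite W \<longrightarrow> 0 \<le> delta B W)"
  moreover have "0 \<le> delta (induced B S) W"
    if "\<forall>W\<subseteq>pts B. finite W \<longrightarrow> 0 \<le> delta B W" "S \<subseteq> pts B" "finite S" "W \<subseteq> S" for S W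
    using that delta_induced[of W S B] finite_subset[of W S] by auto
  ultimately show "B \<in> C0bar" by (simp add: C0bar_def C0_def is_lstruct_induced)
qed

lemma C0barD:
  assumes "B \<in> C0bar"
  shows "is_lstruct B" "\<And>W. W \<subseteq> pts B \<Longrightarrow> finite W \<Longrightarrow> 0 \<le> delta B W"
  using assms by (simp_all add: C0bar_iff)

lemma C0_iff: "B \<in> C0 \<longleftrightarrow> B \<in> C0bar \<and> finite (pts B)"
  by (auto simp: C0_def C0bar_iff intro: finite_subset)

lemma C0D:
  assumes "B \<in> C0"
  shows "is_lstruct B" "finite (pts B)" "\<And>W. W \<subseteq> pts B \<Longrightarrow> 0 \<le> delta B W"
  using assms by (auto simp: C0_def)

lemma C0bar_embedding:
  assumes "embedding f A B" "B \<in> C0bar" "is_lstruct A"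
  shows "A \<in> C0bar"
proof -
  have "0 \<le> delta A W" if W: "W \<subseteq> pts A" "finite W" for W
  proof -
    have "f ` W \<subseteq> pts B" using W embeddingD(2)[OF assms(1)] by blast
    then show ?thesis
      using delta_embedding[OF assms(1) W(1)] C0barD(2)[OF assms(2), of "f ` W"] W(2) by simp
  qed
  then show ?thesis using assms(3) by (simp add: C0bar_iff)
qed

lemma C0bar_pullback:
  assumes "B \<in> C0bar" "inj_on f C" "f ` C \<subseteq> pts B"
  shows "pullback f C B \<in> C0bar"
  by (rule C0bar_embedding[OF embedding_pullback[OF assms(2,3)] assms(1)])
    (rule is_lstruct_pullback[OF C0barD(1)[OF assms(1)] assms(2,3)])

lemma C0bar_induced:
  assumes "B \<in> C0bar" "S \<subseteq> pts B"
  shows "induced B S \<in> C0bar"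
  by (rule C0bar_embedding[OF embedding_induced_whole[OF assms(2)] assms(1)])
    (rule is_lstruct_induced[OF C0barD(1)[OF assms(1)]])

lemma C0_induced: "B \<in> C0 \<Longrightarrow> S \<subseteq> pts B \<Longrightarrow> induced B S \<in> C0"
  using C0bar_induced finite_subset by (auto simp: C0_iff)

lemma selfsuff_subset: "selfsuff A B \<Longrightarrow> A \<subseteq> pts B"
  by (simp add: selfsuff_def)

lemma selfsuffD: "selfsuff A B \<Longrightarrow> W \<subseteq> pts B \<Longrightarrow> finite W \<Longrightarrow> delta B (W \<inter> A) \<le> delta B W"
  by (simp add: selfsuff_def)

lemma selfsuff_delta_mono:
  assumes "selfsuff A B" "A \<subseteq> W" "W \<subseteq> pts B" "finite W"
  shows "delta B A \<le> delta B W"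
  using selfsuffD[OF assms(1,3,4)] Int_absorb1[OF assms(2)] by simp

lemma selfsuff_cong:
  assumes "pts B = pts B'" "rel B - Pow A = rel B' - Pow A" "selfsuff A B"
  shows "selfsuff A B'"
  unfolding selfsuff_def
proof (intro conjI allI impI)
  show "A \<subseteq> pts B'" using selfsuff_subset[OF assms(3)] assms(1) by simp
  fix C assume C: "C \<subseteq> pts B'" "finite C"
  then have "delta B (C \<inter> A) \<le> delta B C" using selfsuffD[OF assms(3)] assms(1) by simp
  then show "delta B' (C \<inter> A) \<le> delta B' C"
    using delta_Int_Diff[OF C(2), of B A] delta_Int_Diff[OF C(2), of B' A] assms(2) by simp
qed

lemma selfsuff_embedding:
  assumes "embedding f A B" "S \<subseteq> pts A" "selfsuff (f ` S) B"
  shows "selfsuff S A"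
  unfolding selfsuff_def
proof (intro conjI allI impI assms(2))
  fix W assume W: "W \<subseteq> pts A" "finite W"
  have "f ` W \<subseteq> pts B" using W(1) embeddingD(2)[OF assms(1)] by blast
  then have "delta B (f ` W \<inter> f ` S) \<le> delta B (f ` W)"
    using selfsuffD[OF assms(3)] W(2) by simp
  moreover have "f ` W \<inter> f ` S = f ` (W \<inter> S)"
    using inj_on_image_Int[OF embeddingD(1)[OF assms(1)] W(1) assms(2)] by simp
  moreover have "W \<inter> S \<subseteq> pts A" using W(1) by blast
  ultimately show "delta A (W \<inter> S) \<le> delta A W"
    using delta_embedding[OF assms(1)] W(1) by simp
qed

lemma C0bar_of_selfsuff:
  assumes "is_lstruct B" "selfsuff A B" "induced B A \<in> C0bar"
  shows "B \<in> C0bar"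
proof -
  have "0 \<le> delta B W" if W: "W \<subseteq> pts B" "finite W" for W
  proof -
    have "0 \<le> delta B (W \<inter> A)"
      using C0barD(2)[OF assms(3), of "W \<inter> A"] W(2) delta_induced[of "W \<inter> A" A B] by simp
    then show ?thesis using selfsuffD[OF assms(2) W] by simp
  qed
  then show ?thesis using assms(1) by (simp add: C0bar_iff)
qed

lemma dim_le:
  assumes "B \<in> C0bar" "A \<subseteq> W" "W \<subseteq> pts B" "finite W"
  shows "dim B A \<le> delta B W"
proof -
  have "finite A" "A \<subseteq> pts B" using assms finite_subset by blast+
  from dim_attained[OF assms(1) this] show ?thesis using assms(2-4) by metis
qed

lemma dim_mono:
  assumes B: "B \<in> C0bar" and "Q \<subseteq> R" "R \<subseteq> pts B" "finite R"
  shows "dim B Q \<le> dim B R"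
proof -
  obtain W where W: "R \<subseteq> W" "W \<subseteq> pts B" "finite W" "dim B R = delta B W"
    using dim_attained[OF B assms(4,3)] by metis
  then show ?thesis using dim_le[OF B subset_trans[OF assms(2) W(1)] W(2,3)] by simp
qed

lemma dim_nonneg:
  assumes "B \<in> C0bar" "finite Q" "Q \<subseteq> pts B"
  shows "0 \<le> dim B Q"
  using dim_attained[OF assms] C0barD(2)[OF assms(1)] by metis

lemma dim_selfsuff:
  assumes "B \<in> C0bar" "finite A" "selfsuff A B"
  shows "dim B A = delta B A"
proof -
  note A = selfsuff_subset[OF assms(3)]
  obtain W where "A \<subseteq> W" "W \<subseteq> pts B" "finite W" "dim B A = delta B W"
    using dim_attained[OF assms(1,2) A] by metis
  then have "delta B A \<le> dim B A" using selfsuff_delta_mono[OF assms(3)] by metis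
  then show ?thesis using dim_le[OF assms(1) subset_refl A assms(2)] by simp
qed

lemma selfsuff_of_delta_le_dim:
  assumes "B \<in> C0bar" "A \<subseteq> W" "W \<subseteq> pts B" "finite W" "delta B W \<le> dim B A"
  shows "selfsuff W B"
  unfolding selfsuff_def
proof (intro conjI allI impI assms(3))
  fix C assume C: "C \<subseteq> pts B" "finite C"
  have "dim B A \<le> delta B (C \<union> W)" by (rule dim_le[OF assms(1)]) (use assms C in auto)
  then show "delta B (C \<inter> W) \<le> delta B C"
    using delta_submodular[OF assms(4) C(2), of B] assms(5) by linarith
qed

lemma ex_finite_selfsuff:
  assumes "B \<in> C0bar" "finite A" "A \<subseteq> pts B"
  shows "\<exists>W. A \<subseteq> W \<and> finite W \<and> selfsuff W B"
proof -
  obtain W where "A \<subseteq> W" "W \<subseteq> pts B" "finite W" "dim B A = delta B W"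
    using dim_attained[OF assms] by metis
  then show ?thesis using selfsuff_of_delta_le_dim[OF assms(1)] by auto
qed

lemma dim_embedding:
  assumes f: "embedding f A B" "selfsuff (f ` pts A) B" and B: "B \<in> C0bar" and A: "is_lstruct A"
    and Q: "finite Q" "Q \<subseteq> pts A"
  shows "dim B (f ` Q) = dim A Q"
proof (rule antisym)
  note A_C0bar = C0bar_embedding[OF f(1) B A]
  obtain W where W: "Q \<subseteq> W" "W \<subseteq> pts A" "finite W" "dim A Q = delta A W"
    using dim_attained[OF A_C0bar Q] by metis
  have "dim B (f ` Q) \<le> delta B (f ` W)"
    by (rule dim_le[OF B]) (use W embeddingD(2)[OF f(1)] in auto)
  then show "dim B (f ` Q) \<le> dim A Q" using delta_embedding[OF f(1) W(2)] W(4) by simp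
  have "finite (f ` Q)" "f ` Q \<subseteq> pts B" using Q embeddingD(2)[OF f(1)] by auto
  then obtain W where W: "f ` Q \<subseteq> W" "W \<subseteq> pts B" "finite W" "dim B (f ` Q) = delta B W"
    using dim_attained[OF B] by metis
  let ?V = "{x \<in> pts A. f x \<in> W}"
  have V: "f ` ?V = W \<inter> f ` pts A" by auto
  have "finite (f ` ?V)" using W(3) unfolding V by simp
  then have "finite ?V"
    by (rule finite_imageD) (rule inj_on_subset[OF embeddingD(1)[OF f(1)]], simp)
  then have "dim A Q \<le> delta A ?V" by (intro dim_le[OF A_C0bar]) (use W(1) Q(2) in auto)
  also have "\<dots> = delta B (f ` ?V)" by (rule delta_embedding[OF f(1), symmetric]) simp
  also have "\<dots> \<le> delta B W" unfolding V by (rule selfsuffD[OF f(2) W(2,3)])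
  finally show "dim A Q \<le> dim B (f ` Q)" using W(4) by simp
qed

section \<open>The classes \<open>K0\<close> and \<open>Kmu\<close>\<close>

lemma delta_ge_min_card_2:
  assumes "is_lstruct A" "finite W" "4 \<le> card W \<Longrightarrow> 3 \<le> delta A W"
  shows "int (min (card W) 2) \<le> delta A W"
proof -
  consider "card W \<le> 2" | "card W = 3" | "4 \<le> card W" by linarith
  then show ?thesis
    using delta_card_le_2[OF assms(1,2)] delta_card_3[OF assms(1), of W] assms(3) by cases auto
qed

lemma delta_ge_3_of_unrelated_triple:
  assumes "A \<in> K0" "T \<subseteq> W" "W \<subseteq> pts A" "card T = 3" "T \<notin> rel A"
  shows "3 \<le> delta A W"
proof -
  have A: "is_lstruct A" "selfsuff T A" "finite W"
    using assms finite_subset[OF assms(3)] by (auto simp: K0_def C0_def)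
  then have "delta A T \<le> delta A W" using selfsuff_delta_mono assms(2,3) by blast
  then show ?thesis using delta_card_3[OF A(1) assms(4)] assms(5) by simp
qed

lemma delta_ge_3_of_K0:
  assumes "A \<in> K0" "W \<subseteq> pts A" "4 \<le> card W"
  shows "3 \<le> delta A W"
proof -
  have lstruct: "is_lstruct A" and fin: "finite W"
    using assms finite_subset[OF assms(2)] by (auto simp: K0_def C0_def)
  have "2 \<le> card W" using assms(3) by linarith
  then obtain S where S: "S \<subseteq> W" "card S = 2" "finite S" by (rule obtain_subset_with_card_n)
  then have "selfsuff S A" using assms(1,2) by (auto simp: K0_def)
  then have "0 < delta A W"
    using selfsuff_delta_mono[OF _ S(1) assms(2) fin] delta_card_le_2[OF lstruct S(3)] S(2) by simp
  then obtain T where "T \<subseteq> W" "card T = 3" "T \<notin> rel A"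
    using ex_unrelated_triple[OF lstruct fin assms(3)] by blast
  then show ?thesis using delta_ge_3_of_unrelated_triple[OF assms(1) _ assms(2)] by blast
qed

lemma selfsuff_of_card_le_3:
  assumes lstruct: "is_lstruct A" and fin: "finite (pts A)"
    and big: "\<And>W. W \<subseteq> pts A \<Longrightarrow> 4 \<le> card W \<Longrightarrow> 3 \<le> delta A W"
    and S: "S \<subseteq> pts A" "card S \<le> 3"
  shows "selfsuff S A"
  unfolding selfsuff_finite_iff[OF fin]
proof (intro conjI allI impI S(1))
  fix W assume "S \<subseteq> W \<and> W \<subseteq> pts A"
  then have W: "S \<subseteq> W" "W \<subseteq> pts A" "finite W" "finite S" using fin by (auto intro: finite_subset)
  consider "4 \<le> card W" | "S = W" | "card W \<le> 3" "S \<noteq> W" by linarith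
  then show "delta A S \<le> delta A W"
  proof cases
    case 1
    then show ?thesis using big[OF W(2)] delta_le_card[of A S] S(2) by simp
  next
    case 3
    then have "card S < card W" using W psubset_card_mono[of W S] by blast
    then have "delta A S = int (card S)" "card S \<le> min (card W) 2"
      using delta_card_le_2[OF lstruct W(4)] 3 by simp_all
    then show ?thesis using delta_ge_min_card_2[OF lstruct W(3) big[OF W(2)]] by linarith
  qed simp
qed

lemma K0_iff:
  "A \<in> K0 \<longleftrightarrow> is_lstruct A \<and> finite (pts A) \<and> (\<forall>W\<subseteq>pts A. 4 \<le> card W \<longrightarrow> 3 \<le> delta A W)"
proof
  assume "A \<in> K0"
  then show "is_lstruct A \<and> finite (pts A) \<and> (\<forall>W\<subseteq>pts A. 4 \<le> card W \<longrightarrow> 3 \<le> delta A W)"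
    using delta_ge_3_of_K0 by (auto simp: K0_def C0_def)
next
  assume asm: "is_lstruct A \<and> finite (pts A) \<and> (\<forall>W\<subseteq>pts A. 4 \<le> card W \<longrightarrow> 3 \<le> delta A W)"
  have "0 \<le> delta A W" if W: "W \<subseteq> pts A" for W
  proof -
    have "finite W" using asm W finite_subset by blast
    then have "int (min (card W) 2) \<le> delta A W" using delta_ge_min_card_2[of A W] asm W by simp
    then show ?thesis by linarith
  qed
  then show "A \<in> K0" using asm selfsuff_of_card_le_3[of A] by (simp add: K0_def C0_def)
qed

lemma K0_delta_ge_min_card_2:
  "A \<in> K0 \<Longrightarrow> W \<subseteq> pts A \<Longrightarrow> int (min (card W) 2) \<le> delta A W"
  by (rule delta_ge_min_card_2) (auto simp: K0_iff intro: finite_subset)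

lemma delta_ge_3_of_low_degree_point:
  assumes D: "is_lstruct D" and W: "finite W" "4 \<le> card W" and v: "v \<in> W" "degree D W v \<le> 1"
    and linear: "\<And>r s. r \<in> rel D \<Longrightarrow> v \<in> r \<Longrightarrow> s \<in> rel D \<Longrightarrow> r \<noteq> s \<Longrightarrow> card (r \<inter> s) \<le> 1"
    and rest: "4 \<le> card (W - {v}) \<Longrightarrow> 3 \<le> delta D (W - {v})"
  shows "3 \<le> delta D W"
proof -
  let ?V = "W - {v}"
  have delta_W: "delta D W = delta D ?V + 1 - int (degree D W v)"
    using delta_insert[of ?V v D] W(1) insert_Diff[OF v(1)] by simp
  consider "4 \<le> card ?V" | "card ?V = 3" "?V \<notin> rel D" | "card ?V = 3" "?V \<in> rel D"
    using W(2) card.remove[OF W(1) v(1)] by linarith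
  then show ?thesis
  proof cases
    case 1
    then show ?thesis using rest delta_W v(2) by linarith
  next
    case 2
    then have "delta D ?V = 3" using delta_card_3[OF D] by simp
    then show ?thesis using delta_W v(2) by linarith
  next
    case 3
    have False if r: "r \<in> rel D" "v \<in> r" "r \<subseteq> W" for r
    proof -
      have "r \<inter> ?V = r - {v}" using r by blast
      moreover have "card (r - {v}) = 2" using is_lstructD(2,3)[OF D r(1)] r(2) by simp
      moreover have "card (r \<inter> ?V) \<le> 1" using linear[OF r(1,2) 3(2)] r(2) by blast
      ultimately show False by simp
    qed
    then have "{r \<in> rel D. v \<in> r \<and> r \<subseteq> W} = {}" by blast
    then have "degree D W v = 0" by (simp only: degree_def card.empty)
    moreover have "delta D ?V = 2" using delta_card_3[OF D 3(1)] 3(2) by simp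
    ultimately show ?thesis using delta_W by simp
  qed
qed

lemma K0_of_min_degree:
  assumes D: "is_lstruct D" "finite (pts D)"
    and linear: "\<And>r s. r \<in> rel D \<Longrightarrow> r \<inter> U \<noteq> {} \<Longrightarrow> s \<in> rel D \<Longrightarrow> r \<noteq> s \<Longrightarrow> card (r \<inter> s) \<le> 1"
    and dense: "\<And>W. W \<subseteq> pts D \<Longrightarrow> 4 \<le> card W \<Longrightarrow>
      (\<And>v. v \<in> W \<Longrightarrow> v \<in> U \<Longrightarrow> 2 \<le> degree D W v) \<Longrightarrow> 3 \<le> delta D W"
  shows "D \<in> K0"
proof -
  have "3 \<le> delta D W" if "W \<subseteq> pts D" "4 \<le> card W" for W
    using that
  proof (induction W rule: measure_induct_rule[of card])
    case (less W)
    have fin: "finite W" using less.prems(1) D(2) by (rule finite_subset)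
    show ?case
    proof (cases "\<exists>v\<in>W \<inter> U. degree D W v \<le> 1")
      case True
      then obtain v where v: "v \<in> W" "v \<in> U" "degree D W v \<le> 1" by blast
      have "card (W - {v}) < card W" using fin v(1) by (rule card_Diff1_less)
      then have "3 \<le> delta D (W - {v})" if "4 \<le> card (W - {v})"
        using less.IH that less.prems(1) by blast
      moreover have "card (r \<inter> s) \<le> 1" if "r \<in> rel D" "v \<in> r" "s \<in> rel D" "r \<noteq> s" for r s
        using linear[OF that(1) _ that(3,4)] that(2) v(2) by blast
      ultimately show ?thesis
        using delta_ge_3_of_low_degree_point[OF D(1) fin less.prems(2) v(1,3)] by blast
    next
      case False
      then have "\<not> degree D W v \<le> 1" if "v \<in> W" "v \<in> U" for v using that by blast
      then show ?thesis by (intro dense[OF less.prems]) (simp add: not_le numeral_2_eq_2 Suc_le_eq)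
    qed
  qed
  then show ?thesis using D by (simp add: K0_iff)
qed

lemma K0_linear:
  assumes "A \<in> K0" "r \<in> rel A" "s \<in> rel A" "r \<noteq> s"
  shows "card (r \<inter> s) \<le> 1"
proof (rule ccontr)
  assume neg: "\<not> ?thesis"
  have lstruct: "is_lstruct A" using assms(1) by (simp add: K0_iff)
  note r = is_lstructD[OF lstruct assms(2)] and s = is_lstructD[OF lstruct assms(3)]
  have "\<not> s \<subseteq> r" using card_subset_eq[OF r(3), of s] r(2) s(2) assms(4) by auto
  then have "card r < card (r \<union> s)" using r(3) s(3) by (intro psubset_card_mono) auto
  then have card: "card (r \<union> s) = 4" using card_Un_Int[OF r(3) s(3)] r(2) s(2) neg by linarith
  have "card {r, s} \<le> card (rel A \<inter> Pow (r \<union> s))"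
    by (rule card_mono) (use r(3) s(3) assms in auto)
  then have "delta A (r \<union> s) \<le> 2" using card assms(4) by (simp add: delta_eq)
  moreover have "3 \<le> delta A (r \<union> s)" using assms(1) card r(1) s(1) by (simp add: K0_iff)
  ultimately show False by simp
qed

lemma K0_embedding:
  assumes "embedding f A B" "B \<in> K0" "is_lstruct A"
  shows "A \<in> K0"
proof -
  note f = embeddingD[OF assms(1)]
  have "finite (pts A)" using f(1,2) assms(2) by (auto simp: K0_iff dest: inj_on_finite)
  moreover have "3 \<le> delta A W" if W: "W \<subseteq> pts A" "4 \<le> card W" for W
  proof -
    have "card (f ` W) = card W" by (rule card_image) (rule inj_on_subset[OF f(1) W(1)])
    moreover have "f ` W \<subseteq> pts B" using f(2) W by blast
    ultimately show ?thesis
      using delta_ge_3_of_K0[OF assms(2), of "f ` W"] delta_embedding[OF assms(1) W(1)] W(2) by simp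
  qed
  ultimately show ?thesis using assms(3) by (simp add: K0_iff)
qed

definition disjoint_copies ::
  "nat \<Rightarrow> (nat \<Rightarrow> 'a \<Rightarrow> 'b) \<Rightarrow> 'a set \<Rightarrow> 'a lstruct \<Rightarrow> 'b lstruct \<Rightarrow> bool" where
  "disjoint_copies n f Y Z B \<longleftrightarrow> (\<forall>i<n. embedding (f i) Z B) \<and>
     (\<forall>i<n. \<forall>j<n. i \<noteq> j \<longrightarrow> (\<forall>y\<in>Y. f i y = f j y) \<and> f i ` (pts Z - Y) \<inter> f j ` (pts Z - Y) = {})"

lemma Cmu_iff:
  "A \<in> Cmu \<mu> \<longleftrightarrow> A \<in> C0 \<and> (\<forall>Y Z f. msa Y Z \<longrightarrow> \<not> disjoint_copies (\<mu> Y Z + 1) f Y Z A)"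
  unfolding Cmu_def disjoint_copies_def mem_Collect_eq by blast

lemma disjoint_copies_embedding: "disjoint_copies n f Y Z B \<Longrightarrow> i < n \<Longrightarrow> embedding (f i) Z B"
  by (simp add: disjoint_copies_def)

lemma disjoint_copies_base: "disjoint_copies n f Y Z B \<Longrightarrow> i < n \<Longrightarrow> j < n \<Longrightarrow> y \<in> Y \<Longrightarrow> f i y = f j y"
  unfolding disjoint_copies_def by (cases "i = j") blast+

lemma disjoint_copies_meet:
  assumes copies: "disjoint_copies n f Y Z B" and ij: "i < n" "j < n" "i \<noteq> j"
    and z: "z \<in> pts Z" "z' \<in> pts Z" "f i z = f j z'"
  shows "z \<in> Y \<and> z' = z"
proof -
  have inj: "inj_on (f k) (pts Z)" if "k < n" for k
    using embeddingD(1)[OF disjoint_copies_embedding[OF copies that]] .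
  have "f i ` (pts Z - Y) \<inter> f j ` (pts Z - Y) = {}"
    using copies ij by (simp add: disjoint_copies_def)
  then consider "z \<in> Y" | "z' \<in> Y" using z by blast
  then show ?thesis
  proof cases
    case 1
    then have "f j z = f j z'" using disjoint_copies_base[OF copies ij(1,2)] z(3) by simp
    then show ?thesis using inj[OF ij(2)] z 1 by (auto dest: inj_onD)
  next
    case 2
    then have "f i z = f i z'" using disjoint_copies_base[OF copies ij(1,2)] z(3) by simp
    then show ?thesis using inj[OF ij(1)] z 2 by (auto dest: inj_onD)
  qed
qed

lemma disjoint_copies_comp:
  assumes copies: "disjoint_copies n f Y Z A" and g: "embedding g A B"
  shows "disjoint_copies n (\<lambda>i. g \<circ> f i) Y Z B"
  unfolding disjoint_copies_def
proof (intro conjI allI impI)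
  show "embedding (g \<circ> f i) Z B" if "i < n" for i
    by (rule embedding_comp[OF disjoint_copies_embedding[OF copies that] g])
  fix i j assume ij: "i < n" "j < n" "i \<noteq> j"
  show "\<forall>y\<in>Y. (g \<circ> f i) y = (g \<circ> f j) y"
    using disjoint_copies_base[OF copies ij(1,2)] by simp
  have sub: "f k ` (pts Z - Y) \<subseteq> pts A" if "k < n" for k
    using embeddingD(2)[OF disjoint_copies_embedding[OF copies that]] by blast
  have "f i ` (pts Z - Y) \<inter> f j ` (pts Z - Y) = {}"
    using copies ij by (simp add: disjoint_copies_def)
  then have "g ` f i ` (pts Z - Y) \<inter> g ` f j ` (pts Z - Y) = {}"
    using inj_on_image_Int[OF embeddingD(1)[OF g] sub[OF ij(1)] sub[OF ij(2)]] by simp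
  then show "(g \<circ> f i) ` (pts Z - Y) \<inter> (g \<circ> f j) ` (pts Z - Y) = {}"
    by (simp only: image_comp)
qed

lemma disjoint_copies_induced:
  assumes "disjoint_copies n f Y Z B" "\<And>i. i < n \<Longrightarrow> f i ` pts Z \<subseteq> S"
  shows "disjoint_copies n f Y Z (induced B S)"
proof -
  have "\<forall>i<n. embedding (f i) Z (induced B S)"
    using embedding_into_induced[OF disjoint_copies_embedding[OF assms(1)] assms(2)] by blast
  then show ?thesis using assms(1) unfolding disjoint_copies_def by (elim conjE) (intro conjI)
qed

lemma Kmu_embedding:
  assumes "embedding f A B" "B \<in> Kmu \<mu>" "is_lstruct A"
  shows "A \<in> Kmu \<mu>"
proof -
  have K: "A \<in> K0" using K0_embedding[OF assms(1) _ assms(3)] assms(2) by (simp add: Kmu_def)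
  have "B \<in> Cmu \<mu>" using assms(2) by (simp add: Kmu_def)
  then have "\<not> disjoint_copies (\<mu> Y Z + 1) g Y Z A" if "msa Y Z" for Y Z g
    using disjoint_copies_comp[OF _ assms(1), of "\<mu> Y Z + 1" g Y Z] that unfolding Cmu_iff by blast
  then show ?thesis using K by (simp add: Kmu_def Cmu_iff K0_def)
qed

section \<open>Minimally simply algebraic extensions\<close>

lemma simply_algebraic_iff:
  assumes "Z \<in> C0"
  shows "simply_algebraic Y Z \<longleftrightarrow> Y \<subset> pts Z \<and> delta Z (pts Z) = delta Z Y \<and>
    (\<forall>Z'. Y \<subset> Z' \<and> Z' \<subset> pts Z \<longrightarrow> delta Z Y < delta Z Z')"
proof -
  have fin: "finite (pts Z)" using assms by (simp add: C0_iff)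
  have "delta Z Y \<le> delta Z W" if "Y \<subset> pts Z" "delta Z (pts Z) = delta Z Y"
     "\<forall>Z'. Y \<subset> Z' \<and> Z' \<subset> pts Z \<longrightarrow> delta Z Y < delta Z Z'" "Y \<subseteq> W" "W \<subseteq> pts Z" for W
    using that by (metis order_le_less order_less_imp_le psubsetI)
  then show ?thesis
    using assms by (auto simp: simply_algebraic_def algebraic_ext_def selfsuff_finite_iff[OF fin])
qed

lemma msaD:
  assumes "msa Y Z"
  shows "Z \<in> C0" "Y \<subset> pts Z" "delta Z (pts Z) = delta Z Y"
    "\<And>Z'. Y \<subset> Z' \<Longrightarrow> Z' \<subset> pts Z \<Longrightarrow> delta Z Y < delta Z Z'"
    "\<And>Y'. Y' \<subset> Y \<Longrightarrow> \<not> simply_algebraic Y' (induced Z (Y' \<union> (pts Z - Y)))"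
proof -
  show "Z \<in> C0" using assms by (simp add: msa_def simply_algebraic_def algebraic_ext_def)
  then show "Y \<subset> pts Z" "delta Z (pts Z) = delta Z Y"
    "\<And>Z'. Y \<subset> Z' \<Longrightarrow> Z' \<subset> pts Z \<Longrightarrow> delta Z Y < delta Z Z'"
    using assms by (simp_all add: msa_def simply_algebraic_iff)
  show "\<And>Y'. Y' \<subset> Y \<Longrightarrow> \<not> simply_algebraic Y' (induced Z (Y' \<union> (pts Z - Y)))"
    using assms by (simp add: msa_def)
qed

lemma simply_algebraic_remove_unrelated:
  assumes simply_alg: "simply_algebraic Y Z" and y: "y \<in> Y" "\<And>r. r \<in> rel Z \<Longrightarrow> y \<in> r \<Longrightarrow> r \<subseteq> Y"
  shows "simply_algebraic (Y - {y}) (induced Z (pts Z - {y}))"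
proof -
  let ?Y = "Y - {y}" and ?Z = "induced Z (pts Z - {y})"
  have Z: "Z \<in> C0" using simply_alg by (simp add: simply_algebraic_def algebraic_ext_def)
  note props = simply_alg[unfolded simply_algebraic_iff[OF Z]]
  have relative: "delta ?Z W - delta ?Z ?Y = delta Z (insert y W) - delta Z Y"
    if W: "?Y \<subseteq> W" "W \<subseteq> pts Z - {y}" for W
  proof -
    have "finite W" using W C0D(2)[OF Z] finite_subset by blast
    moreover have "W \<inter> Y = ?Y" "insert y W \<inter> Y = Y" "W - Y = insert y W - Y"
      "(rel Z - Pow Y) \<inter> Pow W = (rel Z - Pow Y) \<inter> Pow (insert y W)"
      using W y by auto
    moreover have "?Y \<subseteq> pts Z - {y}" using props by blast
    ultimately show ?thesis
      using delta_Int_Diff[of W Z Y] delta_Int_Diff[of "insert y W" Z Y] W(2)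
      by (simp add: delta_induced)
  qed
  have "insert y (pts Z - {y}) = pts Z" using y(1) props by blast
  then have "delta ?Z (pts ?Z) = delta ?Z ?Y" using relative[of "pts Z - {y}"] props by auto
  moreover have "delta ?Z ?Y < delta ?Z Z'" if Z': "?Y \<subset> Z'" "Z' \<subset> pts ?Z" for Z'
  proof -
    have "Y \<subset> insert y Z'" "insert y Z' \<subset> pts Z" using Z' y(1) props by auto
    then have "delta Z Y < delta Z (insert y Z')" using props by blast
    then show ?thesis using relative[of Z'] Z' by auto
  qed
  moreover have "?Y \<subset> pts ?Z" using y(1) props by auto
  ultimately show ?thesis by (simp add: simply_algebraic_iff[OF C0_induced[OF Z]])
qed

lemma msa_base_point_related:
  assumes "msa Y Z" "y \<in> Y"
  shows "\<exists>r\<in>rel Z. y \<in> r \<and> \<not> r \<subseteq> Y"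
proof (rule ccontr)
  assume "\<not> ?thesis"
  then have "simply_algebraic (Y - {y}) (induced Z (pts Z - {y}))"
    using simply_algebraic_remove_unrelated[of Y Z y] assms by (auto simp: msa_def)
  moreover have "pts Z - {y} = (Y - {y}) \<union> (pts Z - Y)" using assms(2) msaD(2)[OF assms(1)] by auto
  ultimately show False using msaD(5)[OF assms(1), of "Y - {y}"] assms(2) by auto
qed

lemma simply_algebraic_relation:
  assumes Z: "Z \<in> C0" and r: "r \<in> rel Z" "z \<in> r"
  shows "simply_algebraic (r - {z}) (induced Z r)"
proof -
  note lstruct = C0D(1)[OF Z] and props = is_lstructD[OF C0D(1)[OF Z] r(1)]
  have card: "card (r - {z}) = 2" using props(2,3) r(2) by simp
  have "delta Z r = 2" using delta_card_3[OF lstruct props(2)] r(1) by simp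
  moreover have "delta Z (r - {z}) = 2"
    using delta_card_le_2[OF lstruct _ card[THEN eq_imp_le]] card props(3) by simp
  moreover have "r - {z} \<subset> r" using r(2) by blast
  moreover have "\<not> (r - {z} \<subset> Z' \<and> Z' \<subset> r)" for Z' using r(2) by auto
  ultimately show ?thesis
    using C0_induced[OF Z props(1)] by (auto simp: simply_algebraic_iff delta_induced)
qed

lemma msa_new_point_degree:
  assumes msa: "msa Y Z" "3 \<le> delta Z Y" and z: "z \<in> pts Z - Y"
  shows "2 \<le> degree Z (pts Z) z"
proof (rule ccontr)
  assume neg: "\<not> ?thesis"
  note Z = msaD[OF msa(1)]
  note lstruct = C0D(1)[OF Z(1)] and fin = C0D(2)[OF Z(1)]
  let ?W = "pts Z - {z}"
  have delta_W: "delta Z (pts Z) = delta Z ?W + 1 - int (degree Z (pts Z) z)"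
    using delta_insert[of ?W z Z] fin insert_Diff[of z "pts Z"] z by simp
  have "Y \<subseteq> ?W" "?W \<subset> pts Z" using Z(2) z by auto
  then have W: "?W = Y" using Z(4)[of ?W] delta_W Z(3) neg by fastforce
  then have "card {r \<in> rel Z. z \<in> r \<and> r \<subseteq> pts Z} = 1" using delta_W Z(3) by (simp add: degree_def)
  then obtain r where "{r \<in> rel Z. z \<in> r \<and> r \<subseteq> pts Z} = {r}" by (auto simp: card_1_singleton_iff)
  then have r: "r \<in> rel Z" "z \<in> r" by auto
  note props = is_lstructD[OF lstruct r(1)]
  have "card (r - {z}) = 2" using props r(2) by simp
  then have "r - {z} \<noteq> Y" using msa(2) delta_le_card[of Z "r - {z}"] by auto
  then have "r - {z} \<subset> Y" using props(1) W by auto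
  moreover have "(r - {z}) \<union> (pts Z - Y) = r" using W r(2) z by auto
  ultimately show False
    using Z(5)[of "r - {z}"] simply_algebraic_relation[OF Z(1) r] by simp
qed

lemma msa_K0_delta_le_2:
  assumes "msa Y Z" "Z \<in> K0" "delta Z Y \<le> 2"
  shows "card (pts Z) = 3" "pts Z \<in> rel Z" "card Y = 2"
proof -
  note Z = msaD[OF assms(1)]
  have lstruct: "is_lstruct Z" and fin: "finite (pts Z)" using assms(2) by (auto simp: K0_iff)
  have finY: "finite Y" and less: "card Y < card (pts Z)"
    using Z(2) fin finite_subset psubset_card_mono by blast+
  have card_le_3: "card (pts Z) \<le> 3"
    using delta_ge_3_of_K0[OF assms(2) subset_refl] assms(3) Z(3) by linarith
  have delta_Y: "delta Z Y = int (card Y)" using delta_card_le_2[OF lstruct finY] card_le_3 less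
    by simp
  show card: "card (pts Z) = 3"
    using card_le_3 delta_Y less Z(3) delta_card_le_2[OF lstruct fin]
    by (cases "card (pts Z) \<le> 2") auto
  then show "pts Z \<in> rel Z" "card Y = 2"
    using delta_card_3[OF lstruct card] delta_Y Z(3) assms(3) by (auto split: if_splits)
qed

lemma degree_embedding_le:
  assumes f: "embedding f A B" and W: "W \<subseteq> pts A" "finite W"
  shows "degree A W x \<le> degree B (f ` W) (f x)"
  unfolding degree_def
proof (rule card_inj_on_le[of "(`) f"])
  show "inj_on ((`) f) {r \<in> rel A. x \<in> r \<and> r \<subseteq> W}"
    by (rule inj_on_subset[OF inj_on_image_Pow[OF embeddingD(1)[OF f]]]) (use W(1) in auto)
  show "(`) f ` {r \<in> rel A. x \<in> r \<and> r \<subseteq> W} \<subseteq> {r \<in> rel B. f x \<in> r \<and> r \<subseteq> f ` W}"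
    using embeddingD(3)[OF f] W(1) by auto
  show "finite {r \<in> rel B. f x \<in> r \<and> r \<subseteq> f ` W}"
    by (rule finite_subset[of _ "Pow (f ` W)"]) (use W(2) in auto)
qed

lemma disjoint_copies_le_base_degree:
  assumes msa: "msa Y Z" and copies: "disjoint_copies n f Y Z B" and fin: "finite (pts B)"
    and y: "y \<in> Y" and i: "i < n"
  shows "n \<le> degree B (pts B) (f i y)"
proof -
  have sub: "r \<subseteq> pts Z" if "r \<in> rel Z" for r
    using is_lstructD(1)[OF C0D(1)[OF msaD(1)[OF msa]] that] .
  obtain r z where r: "r \<in> rel Z" "y \<in> r" and z: "z \<in> r" "z \<notin> Y"
    using msa_base_point_related[OF msa y] by blast
  have "inj_on (\<lambda>j. f j ` r) {..<n}"
  proof (rule inj_onI, rule ccontr)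
    fix j k assume jk: "j \<in> {..<n}" "k \<in> {..<n}" "f j ` r = f k ` r" "j \<noteq> k"
    then obtain w where "w \<in> r" "f j z = f k w" using z(1) by blast
    then show False
      using disjoint_copies_meet[OF copies, of j k z w] jk sub[OF r(1)] z by auto
  qed
  moreover have "(\<lambda>j. f j ` r) ` {..<n} \<subseteq> {r \<in> rel B. f i y \<in> r \<and> r \<subseteq> pts B}"
  proof clarify
    fix j assume j: "j < n"
    note f = embeddingD[OF disjoint_copies_embedding[OF copies j]]
    have "f i y = f j y" by (rule disjoint_copies_base[OF copies i j y])
    then show "f j ` r \<in> rel B \<and> f i y \<in> f j ` r \<and> f j ` r \<subseteq> pts B"
      using f(2) f(3)[OF sub[OF r(1)]] r sub[OF r(1)] by auto
  qed
  moreover have "finite {r \<in> rel B. f i y \<in> r \<and> r \<subseteq> pts B}"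
    by (rule finite_subset[of _ "Pow (pts B)"]) (use fin in auto)
  ultimately have "card {..<n} \<le> degree B (pts B) (f i y)"
    unfolding degree_def by (rule card_inj_on_le)
  then show ?thesis by simp
qed

lemma K0_disjoint_copies_le_1:
  assumes B: "B \<in> K0" and msa: "msa Y Z" "Z \<in> K0" "delta Z Y \<le> 2"
    and copies: "disjoint_copies n f Y Z B"
  shows "n \<le> 1"
proof (rule ccontr)
  assume "\<not> ?thesis"
  then have n: "0 < n" "1 < n" by auto
  note line = msa_K0_delta_le_2[OF msa] and YZ = msaD(2)[OF msa(1)]
  note emb_0 = embeddingD[OF disjoint_copies_embedding[OF copies n(1)]]
    and emb_1 = embeddingD[OF disjoint_copies_embedding[OF copies n(2)]]
  let ?r = "f 0 ` pts Z" and ?s = "f 1 ` pts Z"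
  obtain z where z: "z \<in> pts Z" "z \<notin> Y" using YZ by blast
  have "f 0 z \<notin> ?s" using disjoint_copies_meet[OF copies n] z by auto
  then have "?r \<noteq> ?s" using z(1) by blast
  then have "card (?r \<inter> ?s) \<le> 1" using K0_linear[OF B] emb_0(3) emb_1(3) line(2) by simp
  moreover have "f 0 ` Y = f 1 ` Y"
    by (rule image_cong[OF refl]) (rule disjoint_copies_base[OF copies n])
  then have "f 0 ` Y \<subseteq> ?r \<inter> ?s" using YZ by blast
  moreover have "finite (?r \<inter> ?s)" using msa(2) by (simp add: K0_iff)
  ultimately have "card (f 0 ` Y) \<le> 1" by (metis card_mono le_trans)
  moreover have "card (f 0 ` Y) = card Y"
    using inj_on_subset[OF emb_0(1)] YZ by (intro card_image) blast
  ultimately show False using line(3) by simp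
qed

lemma multiplicity_ge_1_of_relation:
  assumes B: "B \<in> Cmu \<mu>" "r \<in> rel B" and msa: "msa Y Z" "Z \<in> K0" "delta Z Y \<le> 2"
  shows "1 \<le> \<mu> Y Z"
proof (rule ccontr)
  assume "\<not> ?thesis"
  then have zero: "\<mu> Y Z = 0" by simp
  note line = msa_K0_delta_le_2[OF msa]
  have lstruct_B: "is_lstruct B" and lstruct_Z: "is_lstruct Z" and fin: "finite (pts Z)"
    using B(1) msa(2) by (auto simp: Cmu_iff C0D K0_iff)
  obtain h where h: "bij_betw h (pts Z) r"
    using finite_same_card_bij[OF fin] is_lstructD[OF lstruct_B B(2)] line(1) by metis
  have "embedding h Z B"
    by (rule embedding_card_le_3[OF lstruct_Z lstruct_B fin])
      (use h line B(2) is_lstructD(1)[OF lstruct_B B(2)] in \<open>auto simp: bij_betw_def\<close>)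
  then have "disjoint_copies (\<mu> Y Z + 1) (\<lambda>_. h) Y Z B"
    using zero by (simp add: disjoint_copies_def)
  then show False using B(1) msa(1) by (simp add: Cmu_iff)
qed

lemma Kmu_of_K0:
  assumes B: "B \<in> K0"
    and line: "\<And>Y Z. msa Y Z \<Longrightarrow> Z \<in> K0 \<Longrightarrow> delta Z Y \<le> 2 \<Longrightarrow> 1 \<le> \<mu> Y Z"
    and copies: "\<And>Y Z f. msa Y Z \<Longrightarrow> Z \<in> K0 \<Longrightarrow> 3 \<le> delta Z Y \<Longrightarrow>
      \<not> disjoint_copies (\<mu> Y Z + 1) f Y Z B"
  shows "B \<in> Kmu \<mu>"
proof -
  have "\<not> disjoint_copies (\<mu> Y Z + 1) f Y Z B" if msa: "msa Y Z" for Y Z f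
  proof
    assume f: "disjoint_copies (\<mu> Y Z + 1) f Y Z B"
    have "embedding (f 0) Z B" using disjoint_copies_embedding[OF f] by simp
    then have Z: "Z \<in> K0" using K0_embedding B C0D(1)[OF msaD(1)[OF msa]] by blast
    show False
    proof (cases "delta Z Y \<le> 2")
      case True
      then show False using K0_disjoint_copies_le_1[OF B msa Z True f] line[OF msa Z] by simp
    next
      case False
      then show False using copies[OF msa Z] f by simp
    qed
  qed
  then show ?thesis using B by (simp add: Kmu_def Cmu_iff K0_def)
qed

section \<open>Adjoining cycles\<close>

text \<open>Cycle \<open>i\<close> consists of the new points \<open>u i k\<close> for \<open>k < len i\<close>; consecutive points are related
  through the label \<open>lab i k\<close>, which is \<open>base i\<close> once and otherwise runs through \<open>X\<close>. As a cycle has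
  as many edges as points, its points are interalgebraic with its base over \<open>X\<close>.\<close>

locale cycles =
  fixes H X :: "'a set" and m :: nat and base :: "nat \<Rightarrow> 'a"
    and u :: "nat \<Rightarrow> nat \<Rightarrow> 'a" and len :: "nat \<Rightarrow> nat" and lab :: "nat \<Rightarrow> nat \<Rightarrow> 'a"
  assumes finite_H: "finite H" and X_subset_H: "X \<subseteq> H"
    and base_in_H: "\<And>i. i < m \<Longrightarrow> base i \<in> H"
    and u_eq_iff [simp]: "\<And>i k j l. u i k = u j l \<longleftrightarrow> i = j \<and> k = l"
    and u_notin_H: "\<And>i k. u i k \<notin> H"
    and len_ge_3: "\<And>i. 3 \<le> len i"
    and lab_0: "\<And>i. lab i 0 = base i"
    and lab_image: "\<And>i. lab i ` {0<..<len i} = X"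
    and lab_Suc_neq: "\<And>i k. Suc k < len i \<Longrightarrow> lab i k \<noteq> lab i (Suc k)"
    and lab_last_neq: "\<And>i k. Suc k = len i \<Longrightarrow> lab i k \<noteq> base i"
begin

definition succ :: "nat \<Rightarrow> nat \<Rightarrow> nat" where
  "succ i k = (if Suc k = len i then 0 else Suc k)"

definition pred :: "nat \<Rightarrow> nat \<Rightarrow> nat" where
  "pred i k = (if k = 0 then len i - 1 else k - 1)"

definition edge :: "nat \<Rightarrow> nat \<Rightarrow> 'a set" where
  "edge i k = {u i k, lab i k, u i (succ i k)}"

definition edges :: "'a set set" where
  "edges = (\<Union>i<m. edge i ` {..<len i})"

definition cycle :: "nat \<Rightarrow> 'a set" where
  "cycle i = u i ` {..<len i}"

definition new_points :: "'a set" where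
  "new_points = (\<Union>i<m. cycle i)"

definition anchor :: "'a set \<Rightarrow> 'a set" where
  "anchor W = W \<inter> H \<union> base ` {i. i < m \<and> cycle i \<inter> W \<noteq> {}}"

definition cycle_hull :: "'a set \<Rightarrow> 'a set" where
  "cycle_hull P = P \<union> (\<Union>i\<in>{i. i < m \<and> base i \<in> P}. cycle i)"

lemma len_pos: "0 < len i"
  using len_ge_3[of i] by linarith

lemma succ_less: "k < len i \<Longrightarrow> succ i k < len i"
  using len_pos[of i] by (auto simp: succ_def)

lemma succ_neq: "succ i k \<noteq> k"
  using len_ge_3[of i] by (auto simp: succ_def)

lemma pred_less: "k < len i \<Longrightarrow> pred i k < len i"
  by (auto simp: pred_def)

lemma eq_succ_iff: "k < len i \<Longrightarrow> l < len i \<Longrightarrow> k = succ i l \<longleftrightarrow> l = pred i k"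
  by (auto simp: succ_def pred_def)

lemma succ_neq_pred: "k < len i \<Longrightarrow> succ i k \<noteq> pred i k"
  using len_ge_3[of i] by (auto simp: succ_def pred_def)

lemma lab_succ_neq: "k < len i \<Longrightarrow> lab i k \<noteq> lab i (succ i k)"
  using lab_Suc_neq[of k i] lab_last_neq[of k i] lab_0[of i] by (auto simp: succ_def)

lemma lab_in_X: "0 < k \<Longrightarrow> k < len i \<Longrightarrow> lab i k \<in> X"
  using lab_image[of i] by auto

lemma lab_in_H: "i < m \<Longrightarrow> k < len i \<Longrightarrow> lab i k \<in> H"
  using lab_in_X[of k i] X_subset_H base_in_H[of i] lab_0[of i] by (cases "k = 0") auto

lemma u_neq_lab: "i < m \<Longrightarrow> k < len i \<Longrightarrow> u j l \<noteq> lab i k"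
  using lab_in_H u_notin_H by metis

lemma u_in_edge_iff:
  "i < m \<Longrightarrow> k < len i \<Longrightarrow> u j l \<in> edge i k \<longleftrightarrow> j = i \<and> (l = k \<or> l = succ i k)"
  using u_neq_lab by (auto simp: edge_def)

lemma edge_eq_iff:
  assumes "i < m" "k < len i" "j < m" "l < len j"
  shows "edge i k = edge j l \<longleftrightarrow> i = j \<and> k = l"
proof
  assume eq: "edge i k = edge j l"
  have "u i k \<in> edge i k" "u i (succ i k) \<in> edge i k" by (simp_all add: edge_def)
  then have ij: "i = j" and "k = l \<or> k = succ i l \<and> succ i k = l"
    unfolding eq using u_in_edge_iff[OF assms(3,4)] succ_neq[of i k] by auto
  then show "i = j \<and> k = l"
    using eq_succ_iff[of k i l] succ_neq_pred[of k i] assms(2,4) by auto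
qed simp

lemma card_edge: "i < m \<Longrightarrow> k < len i \<Longrightarrow> card (edge i k) = 3"
  using succ_neq[of i k] u_neq_lab[of i k] by (auto simp: edge_def card_insert_if dest: sym)

lemma edge_subset: "i < m \<Longrightarrow> k < len i \<Longrightarrow> edge i k \<subseteq> H \<union> cycle i"
  using lab_in_H succ_less by (auto simp: edge_def cycle_def)

lemma edges_props:
  assumes "r \<in> edges"
  shows "r \<subseteq> H \<union> new_points" "card r = 3" "\<not> r \<subseteq> H"
proof -
  obtain i k where ik: "i < m" "k < len i" "r = edge i k" using assms by (auto simp: edges_def)
  show "r \<subseteq> H \<union> new_points" using edge_subset[OF ik(1,2)] ik by (auto simp: new_points_def)
  show "card r = 3" using card_edge ik by simp
  show "\<not> r \<subseteq> H" using u_notin_H unfolding ik(3) edge_def by blast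
qed

lemma new_points_disjoint: "H \<inter> new_points = {}"
  using u_notin_H by (auto simp: new_points_def cycle_def)

lemma card_cycle: "card (cycle i) = len i"
  unfolding cycle_def by (simp add: card_image inj_on_def)

lemma finite_cycle: "finite (cycle i)"
  by (simp add: cycle_def)

lemma cycle_disjoint: "i \<noteq> j \<Longrightarrow> cycle i \<inter> cycle j = {}"
  by (auto simp: cycle_def)

lemma finite_new_points: "finite new_points"
  by (simp add: new_points_def finite_cycle)

lemma finite_extended_points: "W \<subseteq> H \<union> new_points \<Longrightarrow> finite W"
  using finite_H finite_new_points finite_subset by blast

lemma anchor_subset: "anchor W \<subseteq> H"
  using base_in_H by (auto simp: anchor_def)

lemma finite_anchor: "finite (anchor W)"
  using anchor_subset finite_H by (rule finite_subset)

lemma anchor_mono: "V \<subseteq> W \<Longrightarrow> anchor V \<subseteq> anchor W"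
  unfolding anchor_def by blast

lemma cycle_hull_subset: "P \<subseteq> H \<Longrightarrow> cycle_hull P \<subseteq> H \<union> new_points"
  by (auto simp: cycle_hull_def new_points_def)

lemma subset_cycle_hull_anchor:
  assumes "W \<subseteq> H \<union> new_points" "anchor W \<subseteq> P"
  shows "W \<subseteq> cycle_hull P"
proof
  fix x assume x: "x \<in> W"
  show "x \<in> cycle_hull P"
  proof (cases "x \<in> H")
    case True
    then show ?thesis using x assms(2) by (auto simp: anchor_def cycle_hull_def)
  next
    case False
    then obtain i where i: "i < m" "x \<in> cycle i" using x assms(1) by (auto simp: new_points_def)
    then have "base i \<in> P" using x assms(2) by (auto simp: anchor_def)
    then show ?thesis using i by (auto simp: cycle_hull_def)
  qed
qed

lemma ex_broken_edge:
  assumes "cycle i \<inter> W \<noteq> {}" "base i \<notin> W"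
  shows "\<exists>k<len i. u i k \<in> W \<and> \<not> edge i k \<subseteq> W"
proof (rule ccontr)
  assume closed: "\<not> ?thesis"
  let ?V = "{k. k < len i \<and> u i k \<in> W}"
  have "Max ?V \<in> ?V" using assms(1) by (intro Max_in) (auto simp: cycle_def)
  then have last: "Max ?V < len i" "u i (Max ?V) \<in> W" by auto
  then have successor: "u i (succ i (Max ?V)) \<in> W" using closed by (auto simp: edge_def)
  then have "succ i (Max ?V) \<le> Max ?V" using succ_less[OF last(1)] by (intro Max_ge) auto
  then have "succ i (Max ?V) = 0" by (auto simp: succ_def split: if_splits)
  then have "edge i 0 \<subseteq> W" using closed successor len_pos[of i] by auto
  then show False using assms(2) by (simp add: edge_def lab_0)
qed

lemma card_edges_of_cycle_le:
  assumes "i < m"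
  shows "card (edge i ` {..<len i} \<inter> Pow W) + (if cycle i \<inter> W \<noteq> {} \<and> base i \<notin> W then 1 else 0)
    \<le> card (cycle i \<inter> W)"
proof -
  let ?V = "{k. k < len i \<and> u i k \<in> W}" and ?N = "{k. k < len i \<and> edge i k \<subseteq> W}"
  have NV: "?N \<subseteq> ?V" by (auto simp: edge_def)
  have "cycle i \<inter> W = u i ` ?V" by (auto simp: cycle_def)
  then have "card (cycle i \<inter> W) = card ?V" by (simp add: card_image inj_on_def)
  moreover have "edge i ` {..<len i} \<inter> Pow W = edge i ` ?N" by auto
  then have "card (edge i ` {..<len i} \<inter> Pow W) \<le> card ?N" by (simp add: card_image_le)
  moreover have "card ?N + (if cycle i \<inter> W \<noteq> {} \<and> base i \<notin> W then 1 else 0) \<le> card ?V"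
  proof (cases "cycle i \<inter> W \<noteq> {} \<and> base i \<notin> W")
    case True
    then have "?N \<subset> ?V" using ex_broken_edge[of i W] NV by blast
    then have "card ?N < card ?V" by (intro psubset_card_mono) auto
    then show ?thesis using True by simp
  next
    case False
    then show ?thesis using card_mono[OF _ NV] by auto
  qed
  ultimately show ?thesis by linarith
qed

lemma card_eq_sum_cycles:
  assumes "W \<subseteq> H \<union> new_points"
  shows "card W = card (W \<inter> H) + (\<Sum>i<m. card (cycle i \<inter> W))"
proof -
  have "card (\<Union>i<m. cycle i \<inter> W) = (\<Sum>i<m. card (cycle i \<inter> W))"
    by (rule card_UN_disjoint) (use cycle_disjoint finite_cycle in auto)
  moreover have "card (W \<inter> H \<union> (\<Union>i<m. cycle i \<inter> W)) = card (W \<inter> H) + card (\<Union>i<m. cycle i \<inter> W)"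
    by (rule card_Un_disjoint)
      (use finite_H finite_cycle new_points_disjoint in \<open>auto simp: new_points_def\<close>)
  moreover have "W = W \<inter> H \<union> (\<Union>i<m. cycle i \<inter> W)" using assms by (auto simp: new_points_def)
  ultimately show ?thesis by simp
qed

lemma card_anchor_le:
  "card (anchor W) \<le> card (W \<inter> H) + (\<Sum>i<m. if cycle i \<inter> W \<noteq> {} \<and> base i \<notin> W then 1 else 0)"
proof -
  let ?J = "{i. i < m \<and> cycle i \<inter> W \<noteq> {} \<and> base i \<notin> W}"
  have "anchor W \<subseteq> W \<inter> H \<union> base ` ?J" using base_in_H by (auto simp: anchor_def)
  then have "card (anchor W) \<le> card (W \<inter> H \<union> base ` ?J)"
    by (rule card_mono[rotated]) (use finite_H in auto)
  also have "\<dots> \<le> card (W \<inter> H) + card (base ` ?J)" by (rule card_Un_le)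
  also have "card (base ` ?J) \<le> card ?J" by (rule card_image_le) simp
  also have "card ?J = (\<Sum>i<m. if cycle i \<inter> W \<noteq> {} \<and> base i \<notin> W then 1 else 0)"
    by (simp add: sum.If_cases Int_def)
  finally show ?thesis by simp
qed

lemma card_anchor_edges_le:
  assumes "W \<subseteq> H \<union> new_points"
  shows "card (anchor W) + card (edges \<inter> Pow W) \<le> card W"
proof -
  let ?broken = "\<lambda>i. if cycle i \<inter> W \<noteq> {} \<and> base i \<notin> W then 1 else 0 :: nat"
  have "edges \<inter> Pow W = (\<Union>i<m. edge i ` {..<len i} \<inter> Pow W)" by (auto simp: edges_def)
  then have "card (edges \<inter> Pow W) \<le> (\<Sum>i<m. card (edge i ` {..<len i} \<inter> Pow W))"
    using card_UN_le[of "{..<m}" "\<lambda>i. edge i ` {..<len i} \<inter> Pow W"] by simp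
  moreover have "(\<Sum>i<m. card (edge i ` {..<len i} \<inter> Pow W)) + (\<Sum>i<m. ?broken i)
      \<le> (\<Sum>i<m. card (cycle i \<inter> W))"
    unfolding sum.distrib[symmetric] by (intro sum_mono card_edges_of_cycle_le) simp
  ultimately show ?thesis using card_anchor_le[of W] card_eq_sum_cycles[OF assms] by linarith
qed

lemma card_cycle_hull_le:
  assumes P: "X \<subseteq> P" "P \<subseteq> H"
  shows "card (cycle_hull P) \<le> card P + card (edges \<inter> Pow (cycle_hull P))"
proof -
  let ?K = "SIGMA i:{i. i < m \<and> base i \<in> P}. {..<len i}"
  have finite_hull: "finite (cycle_hull P)"
    using finite_extended_points[OF cycle_hull_subset[OF P(2)]] .
  have "lab i k \<in> P" if "k < len i" "base i \<in> P" for i k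
    using lab_in_X[of k i] lab_0[of i] that P(1) by (cases "k = 0") auto
  then have "case_prod edge ` ?K \<subseteq> edges \<inter> Pow (cycle_hull P)"
    using succ_less by (fastforce simp: edges_def edge_def cycle_hull_def cycle_def)
  moreover have "inj_on (case_prod edge) ?K" by (auto simp: inj_on_def edge_eq_iff)
  ultimately have "card ?K \<le> card (edges \<inter> Pow (cycle_hull P))"
    by (intro card_inj_on_le) (use finite_hull in auto)
  moreover have "cycle_hull P = P \<union> case_prod u ` ?K" by (auto simp: cycle_hull_def cycle_def)
  then have "card (cycle_hull P) \<le> card P + card ?K"
    using card_Un_le[of P "case_prod u ` ?K"] card_image_le[of ?K "case_prod u"] by simp
  ultimately show ?thesis by linarith
qed

lemma delta_anchor_le:
  assumes W: "W \<subseteq> H \<union> new_points"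
    and rel: "card ((rel D - edges) \<inter> Pow W) \<le> card (rel B \<inter> Pow (anchor W))"
  shows "delta B (anchor W) \<le> delta D W"
proof -
  have "card (rel D \<inter> Pow W) \<le> card ((rel D - edges) \<inter> Pow W \<union> edges \<inter> Pow W)"
    by (rule card_mono) (use finite_extended_points[OF W] in auto)
  also have "\<dots> \<le> card ((rel D - edges) \<inter> Pow W) + card (edges \<inter> Pow W)" by (rule card_Un_le)
  finally show ?thesis using card_anchor_edges_le[OF W] rel by (simp add: delta_eq)
qed

lemma delta_cycle_hull_le:
  assumes P: "X \<subseteq> P" "P \<subseteq> H" and D: "edges \<subseteq> rel D"
    and rel: "card (rel B \<inter> Pow P) \<le> card ((rel D - edges) \<inter> Pow (cycle_hull P))"
  shows "delta D (cycle_hull P) \<le> delta B P"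
proof -
  have fin: "finite (cycle_hull P)" using finite_extended_points[OF cycle_hull_subset[OF P(2)]] .
  have "rel D \<inter> Pow (cycle_hull P)
      = (rel D - edges) \<inter> Pow (cycle_hull P) \<union> edges \<inter> Pow (cycle_hull P)"
    using D by blast
  then have "card (rel D \<inter> Pow (cycle_hull P))
      = card ((rel D - edges) \<inter> Pow (cycle_hull P)) + card (edges \<inter> Pow (cycle_hull P))"
    by (simp add: card_Un_disjoint fin Int_commute Diff_Int_distrib2 disjoint_iff)
  then show ?thesis using card_cycle_hull_le[OF P] rel by (simp add: delta_eq)
qed

lemma dim_eq_dim_anchor:
  assumes B: "B \<in> C0bar" "pts B = H" and D: "D \<in> C0bar" "pts D = H \<union> new_points" "edges \<subseteq> rel D"
    and anchor: "\<And>W. W \<subseteq> H \<union> new_points \<Longrightarrow>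
      card ((rel D - edges) \<inter> Pow W) \<le> card (rel B \<inter> Pow (anchor W))"
    and hull: "\<And>P. P \<subseteq> H \<Longrightarrow> card (rel B \<inter> Pow P) \<le> card ((rel D - edges) \<inter> Pow (cycle_hull P))"
    and Q: "X \<subseteq> Q" "Q \<subseteq> H \<union> new_points"
  shows "dim D Q = dim B (anchor Q)"
proof (rule antisym)
  obtain P where P: "anchor Q \<subseteq> P" "P \<subseteq> H" "dim B (anchor Q) = delta B P"
    using dim_attained[OF B(1) finite_anchor, of Q] anchor_subset[of Q] B(2) by metis
  have "X \<subseteq> P" using P(1) Q(1) X_subset_H by (auto simp: anchor_def)
  have "dim D Q \<le> delta D (cycle_hull P)"
    using cycle_hull_subset[OF P(2)] D(2) subset_cycle_hull_anchor[OF Q(2) P(1)]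
    by (intro dim_le[OF D(1)] finite_extended_points) auto
  also have "\<dots> \<le> delta B P" by (rule delta_cycle_hull_le[OF \<open>X \<subseteq> P\<close> P(2) D(3) hull[OF P(2)]])
  finally show "dim D Q \<le> dim B (anchor Q)" using P(3) by simp
  obtain W where W: "Q \<subseteq> W" "W \<subseteq> H \<union> new_points" "dim D Q = delta D W"
    using dim_attained[OF D(1) finite_extended_points[OF Q(2)]] Q(2) D(2) by metis
  have "dim B (anchor Q) \<le> delta B (anchor W)"
    by (rule dim_le[OF B(1) anchor_mono[OF W(1)]]) (use anchor_subset B(2) finite_anchor in auto)
  also have "\<dots> \<le> delta D W" by (rule delta_anchor_le[OF W(2) anchor[OF W(2)]])
  finally show "dim B (anchor Q) \<le> dim D Q" using W(3) by simp
qed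

end

section \<open>Replacing relations by triangles of cycles\<close>

text \<open>Cycle \<open>i\<close> stands for the incidence \<open>base i \<in> host i\<close>, where \<open>host i\<close> runs through the
  relations of \<open>B\<close> that are not inside \<open>A\<close>.\<close>

locale cycle_replacement = cycles "pts B" X m base u len lab
  for B :: "'a lstruct" and X and m :: nat and base :: "nat \<Rightarrow> 'a"
    and u :: "nat \<Rightarrow> nat \<Rightarrow> 'a" and len :: "nat \<Rightarrow> nat" and lab :: "nat \<Rightarrow> nat \<Rightarrow> 'a" +
  fixes A :: "'a set" and host :: "nat \<Rightarrow> 'a set"
  assumes is_lstruct_B: "is_lstruct B" and A_subset: "A \<subseteq> pts B" and X_subset_A: "X \<subseteq> A"
    and incidences: "bij_betw (\<lambda>i. (base i, host i)) {..<m} {(p, r). r \<in> rel B - Pow A \<and> p \<in> r}"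
    and len_growth: "\<And>i. card (pts B) + (\<Sum>j<i. len j) < len i"
begin

definition triangle :: "'a set \<Rightarrow> 'a set" where
  "triangle r = (\<lambda>i. u i 0) ` {i. i < m \<and> host i = r}"

definition replacement :: "'a set \<Rightarrow> 'a set" where
  "replacement r = (if r \<subseteq> A then r else triangle r)"

definition extended :: "'a lstruct" where
  "extended = LStruct (pts B \<union> new_points) (rel B \<union> edges)"

definition replaced :: "'a lstruct" where
  "replaced = LStruct (pts B \<union> new_points) (replacement ` rel B \<union> edges)"

lemma ex_incidence:
  assumes "r \<in> rel B" "\<not> r \<subseteq> A" "p \<in> r"
  shows "\<exists>i<m. base i = p \<and> host i = r"
proof -
  have "(p, r) \<in> (\<lambda>i. (base i, host i)) ` {..<m}"
    using incidences assms by (simp add: bij_betw_def)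
  then show ?thesis by auto
qed

lemma base_in_host: "i < m \<Longrightarrow> base i \<in> host i"
  using bij_betw_apply[OF incidences, of i] by simp

lemma u_in_triangle_iff: "u i k \<in> triangle r \<longleftrightarrow> i < m \<and> k = 0 \<and> host i = r"
  by (auto simp: triangle_def)

lemma triangle_subset: "triangle r \<subseteq> new_points"
  using len_pos by (auto simp: triangle_def new_points_def cycle_def)

lemma card_triangle:
  assumes "r \<in> rel B" "\<not> r \<subseteq> A"
  shows "card (triangle r) = 3"
proof -
  let ?J = "{i. i < m \<and> host i = r}"
  have "inj_on base ?J"
    using incidences unfolding bij_betw_def inj_on_def by fastforce
  moreover have "base ` ?J = r" using base_in_host ex_incidence[OF assms] by fastforce
  ultimately have "card ?J = card r" using card_image by fastforce
  moreover have "card (triangle r) = card ?J"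
    unfolding triangle_def by (rule card_image) (simp add: inj_on_def)
  ultimately show ?thesis using is_lstructD(2)[OF is_lstruct_B assms(1)] by simp
qed

lemma relation_nonempty: "r \<in> rel B \<Longrightarrow> r \<noteq> {}"
  using is_lstructD(2)[OF is_lstruct_B] by fastforce

lemma triangle_eqD:
  assumes "r \<in> rel B" "\<not> r \<subseteq> A" "triangle r = triangle s"
  shows "r = s"
proof -
  obtain p where "p \<in> r" using relation_nonempty[OF assms(1)] by blast
  then obtain i where "i < m" "host i = r" using ex_incidence[OF assms(1,2)] by blast
  then have "u i 0 \<in> triangle s" unfolding assms(3)[symmetric] by (simp add: u_in_triangle_iff)
  then show ?thesis using \<open>host i = r\<close> by (simp add: u_in_triangle_iff)
qed

lemma replacement_cases:
  assumes "r \<in> rel B"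
  obtains "r \<subseteq> A" "replacement r = r" | "\<not> r \<subseteq> A" "replacement r = triangle r"
  using that by (cases "r \<subseteq> A") (simp_all add: replacement_def)

lemma replacement_props:
  assumes r: "r \<in> rel B"
  shows "replacement r \<subseteq> pts B \<union> new_points" "card (replacement r) = 3" "replacement r \<notin> edges"
    "replacement r \<subseteq> pts B \<longleftrightarrow> r \<subseteq> A"
proof -
  note props = is_lstructD[OF is_lstruct_B r]
  have "triangle r \<notin> edges"
  proof
    assume "triangle r \<in> edges"
    then obtain i k where "triangle r = edge i k" by (auto simp: edges_def)
    then have "u i k \<in> triangle r" "u i (succ i k) \<in> triangle r" by (auto simp: edge_def)
    then show False using succ_neq[of i k] by (simp add: u_in_triangle_iff)
  qed
  moreover have "\<not> triangle r \<subseteq> pts B" if "\<not> r \<subseteq> A"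
  proof
    assume "triangle r \<subseteq> pts B"
    then have "triangle r = {}" using triangle_subset[of r] new_points_disjoint by blast
    then show False using card_triangle[OF r that] by simp
  qed
  ultimately show "replacement r \<subseteq> pts B \<union> new_points" "card (replacement r) = 3"
      "replacement r \<notin> edges" "replacement r \<subseteq> pts B \<longleftrightarrow> r \<subseteq> A"
    using props(1,2) card_triangle[OF r] triangle_subset[of r] edges_props(3)[of r]
    by (auto simp: replacement_def)
qed

lemma inj_on_replacement: "inj_on replacement (rel B)"
proof (rule inj_onI)
  fix r s assume r: "r \<in> rel B" and s: "s \<in> rel B" and eq: "replacement r = replacement s"
  then have "r \<subseteq> A \<longleftrightarrow> s \<subseteq> A" using replacement_props(4)[OF r] replacement_props(4)[OF s] by simp
  then show "r = s"
    using eq triangle_eqD[OF r] by (auto simp: replacement_def split: if_splits)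
qed

lemma replacement_subset_anchor:
  assumes r: "r \<in> rel B" and W: "replacement r \<subseteq> W"
  shows "r \<subseteq> anchor W"
proof (rule replacement_cases[OF r])
  assume "r \<subseteq> A" "replacement r = r"
  then show ?thesis using W A_subset by (auto simp: anchor_def)
next
  assume not_in_A: "\<not> r \<subseteq> A" and is_triangle: "replacement r = triangle r"
  show ?thesis
  proof
    fix p assume "p \<in> r"
    then obtain i where i: "i < m" "base i = p" "host i = r" using ex_incidence[OF r not_in_A]
      by blast
    then have "u i 0 \<in> W" using W by (auto simp: is_triangle u_in_triangle_iff)
    then have "cycle i \<inter> W \<noteq> {}" using len_pos[of i] by (auto simp: cycle_def)
    then show "p \<in> anchor W" using i by (auto simp: anchor_def)
  qed
qed

lemma replacement_subset_cycle_hull: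
  assumes r: "r \<in> rel B" and P: "r \<subseteq> P"
  shows "replacement r \<subseteq> cycle_hull P"
proof (rule replacement_cases[OF r])
  assume "replacement r = triangle r"
  moreover have "u i 0 \<in> cycle_hull P" if "i < m" "host i = r" for i
  proof -
    have "base i \<in> P" "u i 0 \<in> cycle i"
      using base_in_host[of i] len_pos that P by (auto simp: cycle_def)
    then show ?thesis using that(1) by (auto simp: cycle_hull_def)
  qed
  ultimately show ?thesis by (auto simp: triangle_def)
qed (use P in \<open>auto simp: cycle_hull_def\<close>)

lemma rel_B_edges_disjoint: "rel B \<inter> edges = {}"
  using is_lstructD(1)[OF is_lstruct_B] edges_props(3) by blast

lemma pts_replaced [simp]: "pts replaced = pts B \<union> new_points"
  by (simp add: replaced_def)

lemma pts_extended [simp]: "pts extended = pts B \<union> new_points"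
  by (simp add: extended_def)

lemma rel_extended_minus_edges: "rel extended - edges = rel B"
  using rel_B_edges_disjoint by (auto simp: extended_def)

lemma rel_replaced_minus_edges: "rel replaced - edges = replacement ` rel B"
  using replacement_props(3) by (auto simp: replaced_def)

lemma is_lstruct_extended: "is_lstruct extended"
  using is_lstructD(1,2)[OF is_lstruct_B] edges_props(1,2)
  by (auto simp: is_lstruct_def extended_def)

lemma is_lstruct_replaced: "is_lstruct replaced"
  unfolding is_lstruct_def pts_replaced
proof
  fix r assume "r \<in> rel replaced"
  then consider "r \<in> edges" | s where "s \<in> rel B" "r = replacement s" by (auto simp: replaced_def)
  then show "r \<subseteq> pts B \<union> new_points \<and> card r = 3"
    by cases (simp_all add: replacement_props(1,2) edges_props(1,2))
qed

lemma induced_extended: "induced extended (pts B) = B"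
proof (rule lstruct.expand, intro conjI)
  have "rel B \<subseteq> Pow (pts B)" "edges \<inter> Pow (pts B) = {}"
    using is_lstructD(1)[OF is_lstruct_B] edges_props(3) by auto
  then show "rel (induced extended (pts B)) = rel B" by (auto simp: extended_def)
qed simp

lemma rel_replaced_old: "rel replaced \<inter> Pow (pts B) = rel B \<inter> Pow A"
proof (intro subset_antisym subsetI)
  fix r assume r: "r \<in> rel replaced \<inter> Pow (pts B)"
  then have "r \<in> rel replaced - edges" using edges_props(3) by blast
  then obtain s where s: "s \<in> rel B" "r = replacement s" "r \<subseteq> pts B"
    using r unfolding rel_replaced_minus_edges by blast
  then have "s \<subseteq> A" using replacement_props(4) by blast
  then show "r \<in> rel B \<inter> Pow A" using s by (simp add: replacement_def)
next
  fix r assume r: "r \<in> rel B \<inter> Pow A"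
  then have "replacement r = r" "replacement r \<in> replacement ` rel B"
    by (simp_all add: replacement_def)
  then show "r \<in> rel replaced \<inter> Pow (pts B)" using r A_subset by (auto simp: replaced_def)
qed

lemma induced_replaced: "induced replaced A = induced B A"
proof (rule lstruct.expand, intro conjI)
  have "rel replaced \<inter> Pow A = rel B \<inter> Pow A" using rel_replaced_old A_subset by blast
  then show "rel (induced replaced A) = rel (induced B A)" by simp
qed simp

lemma delta_replaced_old: "W \<subseteq> pts B \<Longrightarrow> delta replaced W = delta B (W \<inter> A) + int (card (W - A))"
proof -
  assume W: "W \<subseteq> pts B"
  then have fin: "finite W" using finite_H finite_subset by blast
  have "rel replaced \<inter> Pow W = rel B \<inter> Pow (W \<inter> A)" using rel_replaced_old W by blast
  then show ?thesis using card_Int_Diff[OF fin, of A] by (simp add: delta_eq)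
qed

lemma card_replaced_anchor:
  "card ((rel replaced - edges) \<inter> Pow W) \<le> card (rel B \<inter> Pow (anchor W))"
proof (rule surj_card_le)
  show "finite (rel B \<inter> Pow (anchor W))" using finite_anchor by simp
  show "(rel replaced - edges) \<inter> Pow W \<subseteq> replacement ` (rel B \<inter> Pow (anchor W))"
    unfolding rel_replaced_minus_edges using replacement_subset_anchor by auto
qed

lemma card_replaced_cycle_hull:
  assumes "P \<subseteq> pts B"
  shows "card (rel B \<inter> Pow P) \<le> card ((rel replaced - edges) \<inter> Pow (cycle_hull P))"
proof (rule card_inj_on_le)
  show "inj_on replacement (rel B \<inter> Pow P)" using inj_on_replacement by (rule inj_on_subset) simp
  show "replacement ` (rel B \<inter> Pow P) \<subseteq> (rel replaced - edges) \<inter> Pow (cycle_hull P)"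
    unfolding rel_replaced_minus_edges using replacement_subset_cycle_hull by auto
  show "finite ((rel replaced - edges) \<inter> Pow (cycle_hull P))"
    using finite_extended_points[OF cycle_hull_subset[OF assms]] by simp
qed

lemma card_extended_anchor:
  "card ((rel extended - edges) \<inter> Pow W) \<le> card (rel B \<inter> Pow (anchor W))"
  unfolding rel_extended_minus_edges
  by (rule card_mono) (use finite_anchor is_lstructD(1)[OF is_lstruct_B] in \<open>auto simp: anchor_def\<close>)

lemma card_extended_cycle_hull:
  assumes "P \<subseteq> pts B"
  shows "card (rel B \<inter> Pow P) \<le> card ((rel extended - edges) \<inter> Pow (cycle_hull P))"
  unfolding rel_extended_minus_edges
  by (rule card_mono)
    (use finite_extended_points[OF cycle_hull_subset[OF assms]] in \<open>auto simp: cycle_hull_def\<close>)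

lemmas delta_anchor_le_replaced = delta_anchor_le[OF _ card_replaced_anchor]
    and delta_anchor_le_extended = delta_anchor_le[OF _ card_extended_anchor]

lemma selfsuff_extended: "selfsuff (pts B) extended"
proof -
  have fin: "finite (pts extended)" using finite_extended_points by simp
  have "delta extended (pts B) \<le> delta extended W" if W: "pts B \<subseteq> W" "W \<subseteq> pts extended" for W
  proof -
    have "anchor W = pts B" using W(1) anchor_subset[of W] by (auto simp: anchor_def)
    moreover have "delta extended (pts B) = delta B (pts B)"
      using delta_induced[of "pts B" "pts B" extended] by (simp add: induced_extended)
    ultimately show ?thesis using delta_anchor_le_extended[of W] W(2) by simp
  qed
  then show ?thesis by (simp add: selfsuff_finite_iff[OF fin])
qed

lemma selfsuff_replaced:
  assumes "selfsuff A B"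
  shows "selfsuff A replaced"
proof -
  have fin: "finite (pts replaced)" using finite_extended_points by simp
  have "delta replaced A \<le> delta replaced W" if W: "A \<subseteq> W" "W \<subseteq> pts replaced" for W
  proof -
    have "A \<subseteq> anchor W" using W(1) A_subset by (auto simp: anchor_def)
    then have "delta B A \<le> delta B (anchor W)"
      using selfsuff_delta_mono[OF assms] anchor_subset finite_anchor by blast
    then show ?thesis
      using delta_replaced_old[OF A_subset] delta_anchor_le_replaced[of W] W(2) by simp
  qed
  then show ?thesis using A_subset by (auto simp: selfsuff_finite_iff[OF fin])
qed

lemma dim_replaced_eq_extended:
  assumes B: "B \<in> C0bar" and Q: "X \<subseteq> Q" "Q \<subseteq> pts B \<union> new_points"
  shows "dim replaced Q = dim extended Q"
proof -
  have nonneg: "0 \<le> delta B (anchor W)" for W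
    using C0barD(2)[OF B anchor_subset finite_anchor] .
  have "replaced \<in> C0bar" "extended \<in> C0bar"
    unfolding C0bar_iff pts_replaced pts_extended
    using is_lstruct_replaced is_lstruct_extended
      order_trans[OF nonneg delta_anchor_le_replaced]
      order_trans[OF nonneg delta_anchor_le_extended] by simp_all
  then show ?thesis
    using dim_eq_dim_anchor[OF B refl _ _ _ card_replaced_anchor card_replaced_cycle_hull Q]
      dim_eq_dim_anchor[OF B refl _ _ _ card_extended_anchor card_extended_cycle_hull Q]
    by (simp add: replaced_def extended_def)
qed

lemma relations_at_cycle_point:
  assumes "i < m" "k < len i"
  shows "{r \<in> rel replaced. u i k \<in> r}
    \<subseteq> {edge i k, edge i (pred i k)} \<union> (if k = 0 then {triangle (host i)} else {})"
proof
  fix r assume "r \<in> {r \<in> rel replaced. u i k \<in> r}"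
  then have r: "r \<in> rel replaced" "u i k \<in> r" by auto
  show "r \<in> {edge i k, edge i (pred i k)} \<union> (if k = 0 then {triangle (host i)} else {})"
  proof (cases "r \<in> edges")
    case True
    then obtain j l where jl: "j < m" "l < len j" "r = edge j l" by (auto simp: edges_def)
    then have "i = j" "k = l \<or> k = succ i l" using r(2) u_in_edge_iff by auto
    then show ?thesis using jl eq_succ_iff assms(2) by auto
  next
    case False
    then obtain s where s: "s \<in> rel B" "r = replacement s" using r(1) by (auto simp: replaced_def)
    moreover have "u i k \<notin> s" using is_lstructD(1)[OF is_lstruct_B s(1)] u_notin_H by blast
    ultimately have "r = triangle s" using r(2) by (auto simp: replacement_def split: if_splits)
    then show ?thesis using r(2) by (simp add: u_in_triangle_iff)
  qed
qed

lemma degree_cycle_point_le: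
  assumes "i < m" "k < len i"
  shows "degree replaced W (u i k) \<le> 3"
proof -
  have "card {r \<in> rel replaced. u i k \<in> r \<and> r \<subseteq> W}
    \<le> card {edge i k, edge i (pred i k), triangle (host i)}"
    by (rule card_mono) (use relations_at_cycle_point[OF assms] in \<open>auto split: if_splits\<close>)
  also have "\<dots> \<le> 3" by (rule card_insert_le_m1) (auto simp: card_insert_if)
  finally show ?thesis by (simp add: degree_def)
qed

lemma Int_relations_at_cycle_point:
  assumes ik: "i < m" "k < len i"
    and r: "r \<in> rel replaced" "u i k \<in> r" and s: "s \<in> rel replaced" "u i k \<in> s" and neq: "r \<noteq> s"
  shows "r \<inter> s = {u i k}"
proof -
  let ?l = "pred i k"
  have pred_l_less: "?l < len i" by (rule pred_less[OF ik(2)])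
  have succ_l: "succ i ?l = k" using eq_succ_iff[OF ik(2) pred_l_less] by simp
  have in_edges: "u i k \<in> edge i k" "u i k \<in> edge i ?l" using succ_l by (simp_all add: edge_def)
  have edges: "edge i k \<inter> edge i ?l = {u i k}"
    using lab_succ_neq[OF pred_l_less] succ_neq_pred[OF ik(2)] succ_neq[of i k] succ_neq[of i ?l]
      u_neq_lab[OF ik] u_neq_lab[OF ik(1) pred_l_less]
    unfolding edge_def succ_l by fastforce
  have triangle: "edge i j \<inter> triangle (host i) = {u i k}"
    if "k = 0" "j < len i" "u i k \<in> edge i j" for j
    using that ik u_in_edge_iff[OF ik(1) that(2)] by (auto simp: triangle_def)
  have "t = edge i k \<or> t = edge i ?l \<or> k = 0 \<and> t = triangle (host i)"
    if "t \<in> rel replaced" "u i k \<in> t" for t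
    using relations_at_cycle_point[OF ik] that by (auto split: if_splits)
  then show ?thesis
    using r s neq edges triangle[OF _ ik(2) in_edges(1)] triangle[OF _ pred_l_less in_edges(2)]
    by (metis Int_commute)
qed

lemma card_Int_relations_le_1:
  assumes r: "r \<in> rel replaced" "r \<inter> new_points \<noteq> {}" and s: "s \<in> rel replaced" and neq: "r \<noteq> s"
  shows "card (r \<inter> s) \<le> 1"
proof -
  have new: "r \<inter> s = {x}" if x: "x \<in> r \<inter> s" "x \<in> new_points" for x
  proof -
    obtain i k where ik: "i < m" "k < len i" "x = u i k"
      using x(2) by (auto simp: new_points_def cycle_def)
    then show ?thesis using Int_relations_at_cycle_point[OF ik(1,2) r(1) _ s _ neq] x(1) by simp
  qed
  have old: "x = y" if "x \<in> r \<inter> pts B" "y \<in> r \<inter> pts B" for x y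
  proof (cases "r \<in> edges")
    case True
    then show ?thesis using that u_notin_H by (auto simp: edges_def edge_def)
  next
    case False
    then obtain t where t: "t \<in> rel B" "r = replacement t" using r(1) by (auto simp: replaced_def)
    then have "r = triangle t"
      using r(2) A_subset new_points_disjoint by (auto simp: replacement_def split: if_splits)
    then show ?thesis using that triangle_subset[of t] new_points_disjoint by blast
  qed
  have "x = y" if "x \<in> r \<inter> s" "y \<in> r \<inter> s" for x y
  proof (cases "x \<in> new_points \<or> y \<in> new_points")
    case True
    then show ?thesis using new[of x] new[of y] that by (metis singletonD)
  next
    case False
    then have "x \<in> pts B" "y \<in> pts B" using that is_lstructD(1)[OF is_lstruct_replaced r(1)] by auto
    then show ?thesis using old that by blast
  qed
  moreover have "finite (r \<inter> s)" using is_lstructD(3)[OF is_lstruct_replaced r(1)] by simp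
  ultimately show ?thesis by (simp add: card_le_Suc0_iff_eq)
qed

text \<open>A point \<open>u i k\<close> with \<open>0 < k\<close> lies in two relations only, so degree 2 forces both neighbours;
  \<open>u i 0\<close> may also lie in a triangle, but still has at least one neighbour.\<close>

lemma neighbours_of_degree_ge_2:
  assumes ik: "i < m" "k < len i" and deg: "2 \<le> degree replaced W (u i k)"
  shows "edge i k \<subseteq> W \<or> edge i (pred i k) \<subseteq> W" "0 < k \<Longrightarrow> edge i k \<subseteq> W \<and> edge i (pred i k) \<subseteq> W"
proof -
  have not_single: False if "{r \<in> rel replaced. u i k \<in> r \<and> r \<subseteq> W} \<subseteq> {e}" for e
    using card_mono[OF _ that] deg by (simp add: degree_def)
  show "edge i k \<subseteq> W \<or> edge i (pred i k) \<subseteq> W"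
    using not_single[of "triangle (host i)"] relations_at_cycle_point[OF ik]
    by (auto split: if_splits)
  show "edge i k \<subseteq> W \<and> edge i (pred i k) \<subseteq> W" if "0 < k"
    using not_single[of "edge i k"] not_single[of "edge i (pred i k)"]
      relations_at_cycle_point[OF ik] that
    by (auto split: if_splits)
qed

lemma cycle_subset_of_degree_ge_2:
  assumes i: "i < m" and meets: "cycle i \<inter> W \<noteq> {}"
    and deg: "\<And>v. v \<in> W \<Longrightarrow> v \<in> new_points \<Longrightarrow> 2 \<le> degree replaced W v"
  shows "cycle i \<subseteq> W" "X \<subseteq> W"
proof -
  have deg_u: "2 \<le> degree replaced W (u i k)" if "k < len i" "u i k \<in> W" for k
    using deg[of "u i k"] that i by (auto simp: new_points_def cycle_def)
  note neighbours = neighbours_of_degree_ge_2[OF i _ deg_u]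
  have forward: "u i (Suc k) \<in> W" if "0 < k" "Suc k < len i" "u i k \<in> W" for k
    using neighbours(2)[of k] that by (auto simp: edge_def succ_def)
  have backward: "u i k \<in> W" if "Suc k < len i" "u i (Suc k) \<in> W" for k
    using neighbours(2)[of "Suc k"] that by (auto simp: edge_def pred_def)
  obtain l where l: "l < len i" "u i l \<in> W" using meets by (auto simp: cycle_def)
  obtain j where j: "0 < j" "j < len i" "u i j \<in> W"
  proof (cases "l = 0")
    case True
    then have "u i 1 \<in> W \<or> u i (len i - 1) \<in> W"
      using neighbours(1)[OF l(1) l] l len_ge_3[of i] by (auto simp: edge_def succ_def pred_def)
    then show ?thesis using that[of 1] that[of "len i - 1"] len_ge_3[of i] by auto
  qed (use l that in blast)
  have all: "u i k \<in> W" if k: "k < len i" for k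
  proof (cases "j \<le> k")
    case True
    then show ?thesis using k
      by (induction k rule: dec_induct) (use j forward in auto)
  next
    case False
    then have "k \<le> j" by simp
    then show ?thesis
      by (induction k rule: inc_induct) (use j backward in auto)
  qed
  then show "cycle i \<subseteq> W" by (auto simp: cycle_def)
  have "lab i k \<in> W" if "0 < k" "k < len i" for k
    using neighbours(2)[of k] all that by (auto simp: edge_def)
  then show "X \<subseteq> W" using lab_image[of i] by auto
qed

end

context cycle_replacement
begin

lemma replaced_in_K0:
  assumes A: "selfsuff A B" "induced B A \<in> K0" and X: "card X = 3" "X \<notin> rel B"
  shows "replaced \<in> K0"
proof (rule K0_of_min_degree[OF is_lstruct_replaced])
  show "finite (pts replaced)" using finite_extended_points by simp
  show "card (r \<inter> s) \<le> 1"
    if "r \<in> rel replaced" "r \<inter> new_points \<noteq> {}" "s \<in> rel replaced" "r \<noteq> s" for r s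
    using card_Int_relations_le_1[OF that] .
  fix W assume W: "W \<subseteq> pts replaced" "4 \<le> card W"
    and deg: "\<And>v. v \<in> W \<Longrightarrow> v \<in> new_points \<Longrightarrow> 2 \<le> degree replaced W v"
  have fin: "finite W" using W(1) finite_extended_points by simp
  have delta_A: "int (min (card (W \<inter> A)) 2) \<le> delta B (W \<inter> A)"
    "4 \<le> card (W \<inter> A) \<Longrightarrow> 3 \<le> delta B (W \<inter> A)"
    using K0_delta_ge_min_card_2[OF A(2), of "W \<inter> A"] delta_ge_3_of_K0[OF A(2), of "W \<inter> A"]
    by (simp_all add: delta_induced)
  show "3 \<le> delta replaced W"
  proof (cases "W \<inter> new_points = {}")
    case True
    then have "W \<subseteq> pts B" using W(1) by auto
    then show ?thesis
      using delta_replaced_old[of W] delta_A card_Int_Diff[OF fin, of A] W(2) by linarith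
  next
    case False
    then obtain i where "i < m" "cycle i \<inter> W \<noteq> {}" by (auto simp: new_points_def)
    then have XW: "X \<subseteq> W \<inter> A" using cycle_subset_of_degree_ge_2(2)[OF _ _ deg] X_subset_A by blast
    have "3 \<le> delta B (W \<inter> A)"
      using delta_ge_3_of_unrelated_triple[OF A(2) XW] X by (simp add: delta_induced)
    also have "\<dots> = delta replaced (W \<inter> A)"
      using delta_replaced_old[of "W \<inter> A"] A_subset by (simp add: le_infI2 Int_assoc Int_Diff)
    also have "\<dots> \<le> delta replaced W" by (rule selfsuffD[OF selfsuff_replaced[OF A(1)] W(1) fin])
    finally show ?thesis .
  qed
qed

context
  fixes Y :: "'b set" and Z :: "'b lstruct" and n :: nat and f :: "nat \<Rightarrow> 'b \<Rightarrow> 'a"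
  assumes msa: "msa Y Z" "3 \<le> delta Z Y" and n: "4 \<le> n"
    and copies: "disjoint_copies n f Y Z replaced"
begin

lemma finite_Z: "finite (pts Z)"
  using C0D(2)[OF msaD(1)[OF msa(1)]] .

lemma base_notin_new_points:
  assumes "i < n" "y \<in> Y"
  shows "f i y \<notin> new_points"
proof
  assume "f i y \<in> new_points"
  then obtain a k where "a < m" "k < len a" "f i y = u a k" by (auto simp: new_points_def cycle_def)
  then have "degree replaced (pts replaced) (f i y) \<le> 3" using degree_cycle_point_le by simp
  moreover have "finite (pts replaced)" using finite_extended_points by simp
  ultimately show False
    using disjoint_copies_le_base_degree[OF msa(1) copies _ assms(2,1)] n by simp
qed

lemma cycle_subset_copy:
  assumes i: "i < n" and a: "a < m" "cycle a \<inter> f i ` pts Z \<noteq> {}"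
  shows "cycle a \<subseteq> f i ` pts Z"
proof (rule cycle_subset_of_degree_ge_2(1)[OF a])
  fix v assume v: "v \<in> f i ` pts Z" "v \<in> new_points"
  then obtain z where z: "z \<in> pts Z" "v = f i z" by blast
  then have "z \<in> pts Z - Y" using v(2) base_notin_new_points[OF i] by blast
  then have "2 \<le> degree Z (pts Z) z" by (rule msa_new_point_degree[OF msa])
  also have "\<dots> \<le> degree replaced (f i ` pts Z) v"
    using degree_embedding_le[OF disjoint_copies_embedding[OF copies i] subset_refl finite_Z] z
    by simp
  finally show "2 \<le> degree replaced (f i ` pts Z) v" .
qed

lemma card_copy: "i < n \<Longrightarrow> card (f i ` pts Z) = card (pts Z)"
  using embeddingD(1)[OF disjoint_copies_embedding[OF copies]] by (rule card_image)

text \<open>Two copies have the same size and share no cycle, and cycle \<open>a\<close> is longer than all earlier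
  cycles and \<open>B\<close> together.\<close>

lemma longer_cycle_meets_other_copy:
  assumes ij: "i < n" "j < n" "i \<noteq> j" and a: "a < m" "cycle a \<inter> f i ` pts Z \<noteq> {}"
  shows "\<exists>b>a. b < m \<and> cycle b \<inter> f j ` pts Z \<noteq> {}"
proof (rule ccontr)
  assume neg: "\<not> ?thesis"
  note cycle_a = cycle_subset_copy[OF ij(1) a]
  have "cycle a \<inter> f j ` pts Z = {}"
  proof (rule ccontr)
    assume "cycle a \<inter> f j ` pts Z \<noteq> {}"
    then obtain v where v: "v \<in> cycle a" "v \<in> f j ` pts Z" by blast
    then obtain z z' where z: "z \<in> pts Z" "v = f i z" "z' \<in> pts Z" "v = f j z'"
      using cycle_a by blast
    then have "z \<in> Y" using disjoint_copies_meet[OF copies ij z(1,3)] by simp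
    moreover have "v \<in> new_points" using v(1) a(1) by (auto simp: new_points_def)
    ultimately show False using base_notin_new_points[OF ij(1)] z(2) by simp
  qed
  then have below: "b < a" if "b < m" "cycle b \<inter> f j ` pts Z \<noteq> {}" for b
  proof -
    have "b \<noteq> a" "\<not> a < b" using that neg \<open>cycle a \<inter> f j ` pts Z = {}\<close> by blast+
    then show ?thesis by simp
  qed
  have "f j ` pts Z \<subseteq> pts B \<union> (\<Union>b<a. cycle b)"
  proof
    fix v assume v: "v \<in> f j ` pts Z"
    then have "v \<in> pts B \<union> (\<Union>b<m. cycle b)"
      using embeddingD(2)[OF disjoint_copies_embedding[OF copies ij(2)]]
      by (auto simp: new_points_def)
    then show "v \<in> pts B \<union> (\<Union>b<a. cycle b)" using v below by blast
  qed
  then have "card (f j ` pts Z) \<le> card (pts B \<union> (\<Union>b<a. cycle b))"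
    by (rule card_mono[rotated]) (use finite_H finite_cycle in auto)
  also have "\<dots> \<le> card (pts B) + card (\<Union>b<a. cycle b)" by (rule card_Un_le)
  also have "card (\<Union>b<a. cycle b) \<le> (\<Sum>b<a. len b)"
    using card_UN_le[of "{..<a}" cycle] by (simp add: card_cycle)
  also have "card (pts B) + (\<Sum>b<a. len b) < len a" by (rule len_growth)
  also have "len a \<le> card (f i ` pts Z)"
    using card_mono[OF finite_imageI[OF finite_Z] cycle_a] by (simp add: card_cycle)
  finally show False using card_copy ij(1,2) by simp
qed

lemma copy_avoids_cycles:
  assumes "i < n" "a < m"
  shows "cycle a \<inter> f i ` pts Z = {}"
  using assms
proof (induction "m - a" arbitrary: a i rule: less_induct)
  case less
  obtain j where j: "j < n" "i \<noteq> j"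
    using n that[of 0] that[of 1] by (cases "i = 0") auto
  show ?case
  proof (rule ccontr)
    assume "cycle a \<inter> f i ` pts Z \<noteq> {}"
    then obtain b where b: "a < b" "b < m" "cycle b \<inter> f j ` pts Z \<noteq> {}"
      using longer_cycle_meets_other_copy[OF less.prems(1) j less.prems(2)] by blast
    then show False using less.hyps[of b j] j(1) by simp
  qed
qed

lemma copy_subset_A:
  assumes i: "i < n"
  shows "f i ` pts Z \<subseteq> A"
proof clarify
  note lstruct = C0D(1)[OF msaD(1)[OF msa(1)]]
  note emb = embeddingD[OF disjoint_copies_embedding[OF copies i]]
  fix z assume z: "z \<in> pts Z"
  have "\<exists>r\<in>rel Z. z \<in> r"
  proof (cases "z \<in> Y")
    case True
    then show ?thesis using msa_base_point_related[OF msa(1)] by blast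
  next
    case False
    then have "degree Z (pts Z) z \<noteq> 0" using msa_new_point_degree[OF msa, of z] z by simp
    then have "{r \<in> rel Z. z \<in> r \<and> r \<subseteq> pts Z} \<noteq> {}" unfolding degree_def by (metis card.empty)
    then show ?thesis by blast
  qed
  then obtain r where r: "r \<in> rel Z" "z \<in> r" by blast
  have rZ: "r \<subseteq> pts Z" using is_lstructD(1)[OF lstruct r(1)] .
  have "f i ` pts Z \<inter> new_points = {}" using copy_avoids_cycles[OF i] by (auto simp: new_points_def)
  then have "f i ` pts Z \<subseteq> pts B" using emb(2) by auto
  then have "f i ` r \<in> rel replaced \<inter> Pow (pts B)" using emb(3)[OF rZ] r(1) rZ by blast
  then show "f i z \<in> A" unfolding rel_replaced_old using r(2) by blast
qed

lemma disjoint_copies_induced_A: "disjoint_copies n f Y Z (induced B A)"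
  using disjoint_copies_induced[OF copies copy_subset_A] by (simp add: induced_replaced)

end

lemma replaced_in_Kmu:
  assumes A: "selfsuff A B" "induced B A \<in> Kmu \<mu>" and X: "card X = 3" "X \<notin> rel B"
    and mu: "\<And>Y Z. msa Y Z \<Longrightarrow> Z \<in> K0 \<Longrightarrow> (if delta Z Y \<le> 2 then 1 else 3) \<le> \<mu> Y Z"
  shows "replaced \<in> Kmu \<mu>"
proof (rule Kmu_of_K0)
  show "replaced \<in> K0" using replaced_in_K0[OF A(1) _ X] A(2) by (simp add: Kmu_def)
  show "1 \<le> \<mu> Y Z" if "msa Y Z" "Z \<in> K0" "delta Z Y \<le> 2" for Y Z
    using mu[OF that(1,2)] that(3) by simp
  fix Y and Z :: "nat lstruct" and f assume msa: "msa Y Z" "Z \<in> K0" "3 \<le> delta Z Y"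
  then have "4 \<le> \<mu> Y Z + 1" using mu[OF msa(1,2)] by simp
  moreover have "induced B A \<in> Cmu \<mu>" using A(2) by (simp add: Kmu_def)
  then have "\<not> disjoint_copies (\<mu> Y Z + 1) f Y Z (induced B A)"
    using msa(1) unfolding Cmu_iff by blast
  ultimately show "\<not> disjoint_copies (\<mu> Y Z + 1) f Y Z replaced"
    using disjoint_copies_induced_A[OF msa(1,3)] by blast
qed

end

lemma ex_cycle_labelling:
  assumes "card X = 3" "2 \<le> q"
  shows "\<exists>l. l 0 = p \<and> l ` {0<..<3 * q} = X \<and> (\<forall>k. Suc k < 3 * q \<longrightarrow> l k \<noteq> l (Suc k)) \<and>
    (\<forall>k. Suc k = 3 * q \<longrightarrow> l k \<noteq> p)"
proof -
  obtain a b c where abc: "X = {a, b, c}" "a \<noteq> b" "a \<noteq> c" "b \<noteq> c"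
    using assms(1) by (auto simp: card_3_iff)
  obtain x y z where xyz: "X = {x, y, z}" "x \<noteq> y" "x \<noteq> z" "y \<noteq> z" "p \<noteq> x" "p \<noteq> y"
  proof -
    consider "p \<noteq> a" "p \<noteq> b" | "p = a" | "p = b" by blast
    then show ?thesis
    proof cases
      case 1
      then show ?thesis using that[of a b c] abc by blast
    next
      case 2
      then show ?thesis using that[of b c a] abc by auto
    next
      case 3
      then show ?thesis using that[of a c b] abc by auto
    qed
  qed
  define l where "l k = (if k = 0 then p else if k mod 3 = 0 then z
    else if k mod 3 = 1 then x else y)"
    for k :: nat
  have "l 1 = x" "l 2 = y" "l 3 = z" by (simp_all add: l_def)
  moreover have "{1, 2, 3} \<subseteq> {0<..<3 * q}" using assms(2) by auto
  ultimately have "X \<subseteq> l ` {0<..<3 * q}"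
    unfolding xyz(1) by (metis empty_subsetI image_eqI insert_subset)
  moreover have "l ` {0<..<3 * q} \<subseteq> X" using xyz(1) by (auto simp: l_def)
  moreover have "l k \<noteq> l (Suc k)" for k using xyz by (auto simp: l_def mod_Suc)
  moreover have "l k \<noteq> p" if "Suc k = 3 * q" for k
  proof -
    have "k mod 3 = 2" "k \<noteq> 0" using that assms(2) by presburger+
    then show ?thesis using xyz by (simp add: l_def)
  qed
  moreover have "l 0 = p" by (simp add: l_def)
  ultimately show ?thesis by (intro exI[of _ l] conjI subset_antisym allI impI)
qed

lemma sum_doubling: "(\<Sum>j<i. c * 2 ^ j) + c = c * 2 ^ i" for c :: nat
  by (induction i) auto

lemma ex_cycle_replacement:
  fixes B :: "nat lstruct"
  assumes B: "is_lstruct B" "finite (pts B)" and A: "A \<subseteq> pts B" and X: "X \<subseteq> A" "card X = 3"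
  shows "\<exists>m base u len lab host. cycle_replacement B X m base u len lab A host"
proof -
  let ?I = "{(p, r). r \<in> rel B - Pow A \<and> p \<in> r}"
  have "?I \<subseteq> pts B \<times> Pow (pts B)" using is_lstructD(1)[OF B(1)] by auto
  then have "finite ?I" using B(2) finite_subset by blast
  from ex_bij_betw_nat_finite[OF this] obtain h where h: "bij_betw h {..<card ?I} ?I"
    unfolding atLeast0LessThan by blast
  define base where "base i = fst (h i)" for i
  define bound where "bound = Suc (Max (insert 0 (pts B)))"
  have below: "k < bound" if "k \<in> pts B" for k
    using that B(2) by (simp add: bound_def less_Suc_eq_le)
  define len where "len i = 3 * Suc (card (pts B)) * 2 ^ i" for i :: nat
  have len_sum: "(\<Sum>j<i. len j) + 3 * Suc (card (pts B)) = len i" for i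
  unfolding len_def by (rule sum_doubling)
  have "3 \<le> card (pts B)" using card_mono[OF B(2), of X] A X by auto
  then have "2 * 1 \<le> Suc (card (pts B)) * 2 ^ i" for i by (intro mult_le_mono) auto
  then have "2 \<le> Suc (card (pts B)) * 2 ^ i" for i by simp
  from ex_cycle_labelling[OF X(2) this]
  have "\<exists>l. l 0 = base i \<and> l ` {0<..<len i} = X \<and> (\<forall>k. Suc k < len i \<longrightarrow> l k \<noteq> l (Suc k)) \<and>
      (\<forall>k. Suc k = len i \<longrightarrow> l k \<noteq> base i)" for i
    unfolding len_def mult.assoc .
  then obtain lab where lab: "\<And>i. lab i 0 = base i" "\<And>i. lab i ` {0<..<len i} = X"
    "\<And>i k. Suc k < len i \<Longrightarrow> lab i k \<noteq> lab i (Suc k)" "\<And>i k. Suc k = len i \<Longrightarrow> lab i k \<noteq> base i"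
    by metis
  have "cycle_replacement B X (card ?I) base (\<lambda>i k. bound + prod_encode (i, k)) len lab A (snd \<circ> h)"
  proof
    show "bij_betw (\<lambda>i. (base i, (snd \<circ> h) i)) {..<card ?I} ?I" using h by (simp add: base_def)
    show "base i \<in> pts B" if "i < card ?I" for i
    proof -
      have "h i \<in> ?I" using bij_betw_apply[OF h] that by simp
      then have "snd (h i) \<in> rel B" "base i \<in> snd (h i)" by (auto simp: base_def)
      then show ?thesis using is_lstructD(1)[OF B(1)] by blast
    qed
    show "bound + prod_encode (i, k) \<notin> pts B" for i k using below by fastforce
    show "3 \<le> len i" "card (pts B) + (\<Sum>j<i. len j) < len i" for i using len_sum[of i] by simp_all
  qed (use assms lab in \<open>auto simp: prod_encode_eq\<close>)
  then show ?thesis by blast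
qed

lemma ex_Kmu_replacement:
  fixes B :: "nat lstruct"
  assumes B: "B \<in> C0" and A: "selfsuff A B" "induced B A \<in> Kmu \<mu>" and X: "X \<subseteq> A" "3 \<le> delta B X"
    and mu: "\<And>Y Z. msa Y Z \<Longrightarrow> Z \<in> K0 \<Longrightarrow> (if delta Z Y \<le> 2 then 1 else 3) \<le> \<mu> Y Z"
  obtains C D where "is_lstruct C" "induced C (pts B) = B" "selfsuff (pts B) C"
    "D \<in> Kmu \<mu>" "pts D = pts C" "induced D A = induced B A" "selfsuff A D"
    "\<And>Q. X \<subseteq> Q \<Longrightarrow> Q \<subseteq> pts C \<Longrightarrow> dim D Q = dim C Q"
proof -
  note lstruct_B = C0D(1)[OF B] and A_subset = selfsuff_subset[OF A(1)]
  have "finite X" using finite_subset[OF subset_trans[OF X(1) A_subset] C0D(2)[OF B]] .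
  then obtain X' where X': "X' \<subseteq> X" "card X' = 3" "X' \<notin> rel B"
    using ex_unrelated_triple_of_delta[OF lstruct_B _ X(2)] by blast
  then obtain m base u len lab host where "cycle_replacement B X' m base u len lab A host"
    using ex_cycle_replacement[OF lstruct_B C0D(2)[OF B] A_subset _ X'(2)] X(1) by blast
  then interpret cycle_replacement B X' m base u len lab A host .
  show ?thesis
  proof (rule that[of extended replaced])
    show "is_lstruct extended" by (rule is_lstruct_extended)
    show "induced extended (pts B) = B" by (rule induced_extended)
    show "selfsuff (pts B) extended" by (rule selfsuff_extended)
    show "replaced \<in> Kmu \<mu>" by (rule replaced_in_Kmu[OF A X'(2,3) mu])
    show "pts replaced = pts extended" by simp
    show "induced replaced A = induced B A" by (rule induced_replaced)
    show "selfsuff A replaced" by (rule selfsuff_replaced[OF A(1)])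
    show "dim replaced Q = dim extended Q" if "X \<subseteq> Q" "Q \<subseteq> pts extended" for Q
      using dim_replaced_eq_extended[of Q] B that X'(1) by (simp add: C0_iff)
  qed
qed

section \<open>Changing the base of an extension\<close>

definition rebase :: "'a lstruct \<Rightarrow> 'a lstruct \<Rightarrow> 'a lstruct" where
  "rebase A B = LStruct (pts B) (rel A \<union> (rel B - Pow (pts A)))"

lemma pts_rebase [simp]: "pts (rebase A B) = pts B"
  by (simp add: rebase_def)

lemma rel_rebase_Diff: "is_lstruct A \<Longrightarrow> rel (rebase A B) - Pow (pts A) = rel B - Pow (pts A)"
  by (auto simp: rebase_def is_lstruct_def)

lemma rebase_props:
  assumes A: "A \<in> C0bar" and B: "B \<in> C0bar" "selfsuff (pts A) B"
  shows "induced (rebase A B) (pts A) = A" "selfsuff (pts A) (rebase A B)" "rebase A B \<in> C0bar"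
proof -
  note lstruct = C0barD(1)[OF A]
  show induced: "induced (rebase A B) (pts A) = A"
    using lstruct by (intro lstruct.expand) (auto simp: rebase_def is_lstruct_def)
  show ss: "selfsuff (pts A) (rebase A B)"
    using selfsuff_cong[OF _ _ B(2), of "rebase A B"] rel_rebase_Diff[OF lstruct] by simp
  have "is_lstruct (rebase A B)"
    using lstruct C0barD(1)[OF B(1)] selfsuff_subset[OF B(2)]
    by (auto simp: rebase_def is_lstruct_def)
  then show "rebase A B \<in> C0bar" using C0bar_of_selfsuff[OF _ ss] induced A by simp
qed

lemma dim_union_le_relative:
  assumes B': "B' \<in> C0bar" "pts B = pts B'" "A \<subseteq> pts B'" and rel: "rel B - Pow A = rel B' - Pow A"
    and W: "W \<subseteq> pts B" "finite W" and P: "W \<inter> A \<subseteq> P" "P \<subseteq> A" "finite P"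
  shows "dim B' (P \<union> W) \<le> dim (induced B' A) P + (delta B W - delta B (W \<inter> A))"
proof -
  have "induced B' A \<in> C0bar" by (rule C0bar_induced[OF B'(1,3)])
  then obtain V where V: "P \<subseteq> V" "V \<subseteq> A" "finite V" "dim (induced B' A) P = delta B' V"
    using dim_attained[of "induced B' A" P] P(2,3) delta_induced by (metis pts_induced)
  have "dim B' (P \<union> W) \<le> delta B' (V \<union> (W - A))"
    by (rule dim_le[OF B'(1)]) (use V P(1) W B'(2,3) in auto)
  moreover have "W \<inter> A \<subseteq> V" using P(1) V(1) by (rule subset_trans)
  ultimately show ?thesis
    using delta_relative_antimono[OF W(2) V(3) _ V(2) rel] V(4) by simp
qed

lemma dim_le_extend:
  assumes B: "B \<in> C0bar" "B' \<in> C0bar" "pts B = pts B'" and A: "A \<subseteq> pts B"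
    and rel: "rel B - Pow A = rel B' - Pow A" and X: "X \<subseteq> A" "finite X" and Y: "Y \<subseteq> A" "finite Y"
    and base: "\<And>V. V \<subseteq> A \<Longrightarrow> finite V \<Longrightarrow> dim (induced B A) (X \<union> V) \<le> dim (induced B' A) (Y \<union> V) + n"
    and Q: "Q \<subseteq> pts B" "finite Q"
  shows "dim B (X \<union> Q) \<le> dim B' (Y \<union> Q) + n"
proof -
  have "finite (Y \<union> Q)" "Y \<union> Q \<subseteq> pts B'" using Q Y A B(3) by auto
  then obtain W where W: "Y \<union> Q \<subseteq> W" "W \<subseteq> pts B'" "finite W" "dim B' (Y \<union> Q) = delta B' W"
    using dim_attained[OF B(2)] by metis
  let ?V = "W \<inter> A"
  have "dim B (X \<union> Q) \<le> dim B ((X \<union> ?V) \<union> W)"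
    by (rule dim_mono[OF B(1)]) (use W X A B(3) in auto)
  also have "\<dots> \<le> dim (induced B A) (X \<union> ?V) + (delta B' W - delta B' ?V)"
    by (rule dim_union_le_relative[OF B(1)]) (use B(3) A rel W X in auto)
  also have "dim (induced B A) (X \<union> ?V) \<le> dim (induced B' A) (Y \<union> ?V) + n"
    using base[of ?V] W(3) by simp
  also have "Y \<union> ?V = ?V" using W(1) Y(1) by blast
  also have "dim (induced B' A) ?V \<le> delta B' ?V"
    using dim_le[OF C0bar_induced[OF B(2), of A], of ?V ?V] A B(3) W(3) by (simp add: delta_induced)
  finally show ?thesis using W(4) by simp
qed

text \<open>When \<open>n\<close> is the dimension of \<open>X\<close>, the dimension in \<open>A\<close> over \<open>X\<close> equals the dimension in \<open>B\<close>.\<close>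

definition localized_dim_eq :: "int \<Rightarrow> 'a set \<Rightarrow> 'a lstruct \<Rightarrow> 'a lstruct \<Rightarrow> bool" where
  "localized_dim_eq n X A B \<longleftrightarrow> (\<forall>Q\<subseteq>pts B. finite Q \<longrightarrow> dim A (X \<union> Q) = dim B Q + n)"

lemma localized_dim_eq_extend:
  assumes B: "B \<in> C0bar" "B' \<in> C0bar" "pts B = pts B'" and A: "A \<subseteq> pts B"
    and X: "X \<subseteq> A" "finite X" and rel: "rel B - Pow A = rel B' - Pow A"
    and base: "localized_dim_eq n X (induced B A) (induced B' A)"
  shows "localized_dim_eq n X B B'"
  unfolding localized_dim_eq_def
proof (intro allI impI antisym)
  have base_eq: "dim (induced B A) (X \<union> V) = dim (induced B' A) V + n" if "V \<subseteq> A" "finite V" for V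
    using base that by (simp add: localized_dim_eq_def)
  fix Q assume Q: "Q \<subseteq> pts B'" "finite Q"
  show "dim B (X \<union> Q) \<le> dim B' Q + n"
    using dim_le_extend[OF B A rel X, of "{}"] base_eq Q B(3) by simp
  have "dim B' ({} \<union> Q) \<le> dim B (X \<union> Q) + - n"
    by (rule dim_le_extend[OF B(2,1) B(3)[symmetric] _ rel[symmetric] _ _ X])
      (use base_eq Q A B(3) in simp_all)
  then show "dim B' Q + n \<le> dim B (X \<union> Q)" by simp
qed

lemma localized_dim_eq_rebase:
  assumes A: "A \<in> C0bar" and B: "B \<in> C0bar" "selfsuff (pts A) B" and X: "X \<subseteq> pts A" "finite X"
  shows "localized_dim_eq n X (induced B (pts A)) A \<Longrightarrow> localized_dim_eq n X B (rebase A B)"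
    and "localized_dim_eq n X A (induced B (pts A)) \<Longrightarrow> localized_dim_eq n X (rebase A B) B"
  using localized_dim_eq_extend[OF B(1) _ _ _ X, of "rebase A B"]
    localized_dim_eq_extend[OF _ B(1) _ _ X, of "rebase A B"]
    rebase_props[OF A B] selfsuff_subset[OF B(2)] rel_rebase_Diff[OF C0barD(1)[OF A]]
  by simp_all

lemma pullback_extension:
  assumes f: "inj_on f C" "f ` C \<subseteq> pts N" and A: "A \<subseteq> C" "\<And>k. k \<in> A \<Longrightarrow> f k = e k"
    and ss: "selfsuff (e ` A) N"
  shows "induced (pullback f C N) A = pullback e A N" "selfsuff A (pullback f C N)"
proof -
  show "induced (pullback f C N) A = pullback e A N" by (rule induced_pullback[OF A])
  have "f ` A = e ` A" using A(2) by (rule image_cong[OF refl])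
  then show "selfsuff A (pullback f C N)"
    using selfsuff_embedding[OF embedding_pullback[OF f], of A] A(1) ss by simp
qed

section \<open>Generic structures\<close>

lemma C0bar_generic: "is_generic \<A> M \<Longrightarrow> M \<in> C0bar"
  by (simp add: is_generic_def)

lemma finite_subset_UN_chain:
  fixes A :: "nat \<Rightarrow> 'a set"
  assumes "\<And>n. A n \<subseteq> A (Suc n)" "finite F" "F \<subseteq> (\<Union>n. A n)"
  shows "\<exists>n. F \<subseteq> A n"
proof -
  have "A i \<subseteq> A j \<or> A j \<subseteq> A i" for i j
    using lift_Suc_mono_le[of A, OF assms(1)] nat_le_linear by blast
  then have "subset.chain UNIV (range A)" by (auto simp: subset_chain_def)
  then obtain S where "S \<in> range A" "F \<subseteq> S"
    using finite_subset_Union_chain[OF assms(2,3)] by auto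
  then show ?thesis by blast
qed

lemma generic_extend:
  assumes "is_generic \<A> M" "B \<in> \<A>" "selfsuff A B" "embedding e (induced B A) M" "selfsuff (e ` A) M"
  obtains f where "embedding f B M" "\<And>a. a \<in> A \<Longrightarrow> f a = e a" "selfsuff (f ` pts B) M"
proof -
  have "\<forall>B\<in>\<A>. \<forall>A e. selfsuff A B \<and> embedding e (induced B A) M \<and> selfsuff (e ` A) M \<longrightarrow>
        (\<exists>f. embedding f B M \<and> (\<forall>a\<in>A. f a = e a) \<and> selfsuff (f ` pts B) M)"
    using assms(1) by (simp add: is_generic_def)
  then show ?thesis using assms(2-5) that by meson
qed

lemma selfsuff_empty:
  assumes "B \<in> C0bar"
  shows "selfsuff {} B"
  using C0barD(2)[OF assms] delta_card_le_2[OF C0barD(1)[OF assms], of "{}"]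
  by (simp add: selfsuff_def)

lemma generic_embeds:
  assumes M: "is_generic \<A> M" and B: "B \<in> \<A>" "B \<in> C0bar"
  shows "\<exists>g. embedding g B M \<and> selfsuff (g ` pts B) M"
proof -
  note M_C0bar = C0bar_generic[OF M]
  have "embedding undefined (induced B {}) M"
    using is_lstructD(2)[OF C0barD(1)[OF B(2)]] is_lstructD(2)[OF C0barD(1)[OF M_C0bar]]
    by (fastforce simp: embedding_def)
  moreover have "selfsuff (undefined ` {}) M" using selfsuff_empty[OF M_C0bar] by simp
  ultimately show ?thesis using generic_extend[OF M B(1) selfsuff_empty[OF B(2)]] by metis
qed

lemma generic_induced_embeds:
  assumes "is_generic \<A> N" "finite F" "F \<subseteq> pts N"
  shows "\<exists>B\<in>\<A>. \<exists>h. embedding h (induced N F) B"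
proof -
  obtain A where A: "\<forall>i. \<exists>B\<in>\<A>. \<exists>g. isomorphism g B (induced N (A i))"
      "\<forall>i. selfsuff (A i) (induced N (A (Suc i)))" "(\<Union>i. A i) = pts N"
    using assms(1) unfolding is_generic_def by (elim conjE exE)
  have "A i \<subseteq> A (Suc i)" for i using selfsuff_subset A(2) by fastforce
  then obtain i where i: "F \<subseteq> A i" using finite_subset_UN_chain assms(2,3) A(3) by metis
  obtain B g where B: "B \<in> \<A>" "isomorphism g B (induced N (A i))" using A(1) by blast
  show ?thesis
    using embedding_comp[OF embedding_induced[OF i] embedding_inv_into[OF B(2)]] B(1) by blast
qed

lemma generic_induced_Kmu:
  assumes "is_generic (Kmu \<mu>) N" "finite F" "F \<subseteq> pts N"
  shows "induced N F \<in> Kmu \<mu>"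
proof -
  obtain B :: "nat lstruct" and h where "B \<in> Kmu \<mu>" "embedding h (induced N F) B"
    using generic_induced_embeds[OF assms] by blast
  then show ?thesis
    using Kmu_embedding is_lstruct_induced[OF C0barD(1)[OF C0bar_generic[OF assms(1)]]] by blast
qed

lemma generic_pullback_Kmu:
  assumes N: "is_generic (Kmu \<mu>) N" and f: "finite C" "inj_on f C" "f ` C \<subseteq> pts N"
  shows "pullback f C N \<in> Kmu \<mu>"
proof (rule Kmu_embedding)
  show "embedding f (pullback f C N) (induced N (f ` C))"
    by (rule embedding_into_induced[OF embedding_pullback[OF f(2,3)]]) simp
  show "induced N (f ` C) \<in> Kmu \<mu>" using generic_induced_Kmu[OF N] f(1,3) by simp
  show "is_lstruct (pullback f C N)"
    using is_lstruct_pullback[OF C0barD(1)[OF C0bar_generic[OF N]] f(2,3)] .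
qed

lemma multiplicity_ge_1_of_generic:
  assumes N: "is_generic (Kmu \<mu>) N" "rel N \<noteq> {}" and msa: "msa Y Z" "Z \<in> K0" "delta Z Y \<le> 2"
  shows "1 \<le> \<mu> Y Z"
proof -
  obtain r where r: "r \<in> rel N" using N(2) by blast
  note r_props = is_lstructD[OF C0barD(1)[OF C0bar_generic[OF N(1)]] r]
  have "induced N r \<in> Cmu \<mu>" using generic_induced_Kmu[OF N(1) r_props(3,1)] by (simp add: Kmu_def)
  moreover have "r \<in> rel (induced N r)" using r by simp
  ultimately show ?thesis using msa by (rule multiplicity_ge_1_of_relation)
qed

lemma generic_selfsuff_card_le_3:
  assumes N: "is_generic (Kmu \<mu>) N" and F: "F \<subseteq> pts N" "finite F" "card F \<le> 3"
  shows "selfsuff F N"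
  unfolding selfsuff_def
proof (intro conjI allI impI F(1))
  fix C assume C: "C \<subseteq> pts N" "finite C"
  let ?B = "induced N (C \<union> F)"
  have "?B \<in> Kmu \<mu>" using generic_induced_Kmu[OF N] C F by simp
  then have "selfsuff F ?B" using F(3) by (simp add: Kmu_def K0_def)
  then have "delta ?B (C \<inter> F) \<le> delta ?B C" using selfsuffD[of F ?B C] C(2) by simp
  then show "delta N (C \<inter> F) \<le> delta N C"
    using delta_induced[of C "C \<union> F" N] delta_induced[of "C \<inter> F" "C \<union> F" N] by (simp add: le_infI1)
qed

lemma generic_third_point:
  assumes N: "is_generic (Kmu \<mu>) N" and r: "r \<in> rel N" and xy: "x \<in> pts N" "y \<in> pts N" "x \<noteq> y"
  shows "\<exists>z. {x, y, z} \<in> rel N"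
proof -
  note lstruct = C0barD(1)[OF C0bar_generic[OF N]]
  note r_props = is_lstructD[OF lstruct r]
  obtain e where e: "bij_betw e {..<3::nat} r"
    using ex_bij_betw_nat_finite[OF r_props(3)] r_props(2) by (auto simp: atLeast0LessThan)
  let ?B = "pullback e {..<3} N" and ?k = "\<lambda>i::nat. if i = 0 then x else y"
  have B: "?B \<in> Kmu \<mu>"
    using generic_pullback_Kmu[OF N, of "{..<3}" e] e r_props(1) by (simp add: bij_betw_def)
  then have lstruct_B: "is_lstruct ?B" and ss: "selfsuff {0, 1} ?B"
    by (simp_all add: Kmu_def K0_def C0_def)
  have not_rel: "{0, 1} \<notin> rel ?B" "{x, y} \<notin> rel N"
    using is_lstructD(2)[OF lstruct_B, of "{0, 1}"] is_lstructD(2)[OF lstruct, of "{x, y}"] xy(3)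
    by auto
  have "embedding ?k (induced ?B {0, 1}) N"
    by (rule embedding_card_le_3[OF is_lstruct_induced[OF lstruct_B] lstruct])
      (use xy not_rel in \<open>auto simp: insert_commute\<close>)
  moreover have "selfsuff (?k ` {0, 1}) N"
    by (rule generic_selfsuff_card_le_3[OF N]) (use xy in auto)
  ultimately obtain f where f: "embedding f ?B N" "\<And>i. i \<in> {0, 1} \<Longrightarrow> f i = ?k i"
    using generic_extend[OF N B ss] by blast
  have "{..<3} \<in> rel ?B" using e r by (simp add: pullback_def bij_betw_def)
  then have "f ` {..<3} \<in> rel N" using embeddingD(3)[OF f(1)] by simp
  moreover have "f ` {..<3} = {x, y, f 2}"
    using f(2)[of 0] f(2)[of 1] by (auto simp: numeral_3_eq_3 numeral_2_eq_2 lessThan_Suc)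
  ultimately show ?thesis by auto
qed

section \<open>Back and forth\<close>

definition partial_iso :: "'a lstruct \<Rightarrow> 'b lstruct \<Rightarrow> 'a set \<Rightarrow> ('a \<times> 'b) set \<Rightarrow> bool" where
  "partial_iso N M X P \<longleftrightarrow> finite P \<and> inj_on fst P \<and> inj_on snd P \<and> X \<subseteq> fst ` P \<and>
     selfsuff (fst ` P) N \<and> selfsuff (snd ` P) M \<and>
     (\<forall>Q\<subseteq>P. dim N (X \<union> fst ` Q) = dim M (snd ` Q) + dim N X)"

lemma partial_isoD:
  assumes "partial_iso N M X P"
  shows "finite P" "inj_on fst P" "inj_on snd P" "X \<subseteq> fst ` P" "selfsuff (fst ` P) N"
    "selfsuff (snd ` P) M" "\<And>Q. Q \<subseteq> P \<Longrightarrow> dim N (X \<union> fst ` Q) = dim M (snd ` Q) + dim N X"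
  using assms unfolding partial_iso_def by blast+

lemma partial_iso_enumeration:
  assumes P: "partial_iso N M X P" and e: "bij_betw e A P"
  shows "finite A" "inj_on (fst \<circ> e) A" "inj_on (snd \<circ> e) A"
    "(fst \<circ> e) ` A = fst ` P" "(snd \<circ> e) ` A = snd ` P"
    "(fst \<circ> e) ` A \<subseteq> pts N" "(snd \<circ> e) ` A \<subseteq> pts M"
proof -
  note P = partial_isoD[OF P]
  have e_props: "inj_on e A" "e ` A = P" using e by (auto simp: bij_betw_def)
  show "finite A" using bij_betw_finite[OF e] P(1) by simp
  show "inj_on (fst \<circ> e) A" "inj_on (snd \<circ> e) A"
    using e_props P(2,3) by (simp_all add: comp_inj_on)
  show im: "(fst \<circ> e) ` A = fst ` P" "(snd \<circ> e) ` A = snd ` P"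
    using e_props(2) by (simp_all only: image_comp[symmetric])
  show "(fst \<circ> e) ` A \<subseteq> pts N" "(snd \<circ> e) ` A \<subseteq> pts M"
    unfolding im using selfsuff_subset P(5,6) by blast+
qed

lemma partial_iso_of_embeddings:
  assumes N: "N \<in> C0bar" and M: "M \<in> C0bar"
    and A: "is_lstruct A" "finite (pts A)" and B: "is_lstruct B" "pts B = pts A"
    and f: "embedding f A N" "selfsuff (f ` pts A) N"
    and g: "embedding g B M" "selfsuff (g ` pts B) M"
    and Y: "Y \<subseteq> pts A" and eq: "localized_dim_eq (dim N (f ` Y)) Y A B"
  shows "partial_iso N M (f ` Y) ((\<lambda>k. (f k, g k)) ` pts A)"
  unfolding partial_iso_def
proof (intro conjI allI impI)
  show "inj_on fst ((\<lambda>k. (f k, g k)) ` pts A)" "inj_on snd ((\<lambda>k. (f k, g k)) ` pts A)"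
    using embeddingD(1)[OF f(1)] embeddingD(1)[OF g(1)] B(2) by (auto simp: inj_on_def)
  show "selfsuff (fst ` (\<lambda>k. (f k, g k)) ` pts A) N" "selfsuff (snd ` (\<lambda>k. (f k, g k)) ` pts A) M"
    using f(2) g(2) B(2) by (simp_all add: image_image)
  fix Q assume "Q \<subseteq> (\<lambda>k. (f k, g k)) ` pts A"
  then obtain K where K: "K \<subseteq> pts A" "Q = (\<lambda>k. (f k, g k)) ` K" by (auto simp: subset_image_iff)
  have fin: "finite K" "finite (Y \<union> K)" using K(1) Y A(2) by (auto intro: finite_subset)
  have "dim N (f ` Y \<union> fst ` Q) = dim N (f ` (Y \<union> K))" by (simp add: K(2) image_image image_Un)
  also have "\<dots> = dim A (Y \<union> K)" by (rule dim_embedding[OF f N A(1) fin(2)]) (use K(1) Y in simp)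
  also have "\<dots> = dim B K + dim N (f ` Y)"
    using eq K(1) B(2) fin(1) by (simp add: localized_dim_eq_def)
  also have "dim B K = dim M (g ` K)"
    by (rule dim_embedding[OF g M B(1) fin(1), symmetric]) (use K(1) B(2) in simp)
  also have "g ` K = snd ` Q" by (simp add: K(2) image_image)
  finally show "dim N (f ` Y \<union> fst ` Q) = dim M (snd ` Q) + dim N (f ` Y)" .
qed (use A(2) Y in \<open>auto simp: image_image\<close>)

lemma localized_dim_eq_pullback:
  assumes N: "N \<in> C0bar" and M: "M \<in> C0bar" and P: "partial_iso N M X P"
    and e: "bij_betw e A P" and Y: "Y \<subseteq> A" "(fst \<circ> e) ` Y = X"
  shows "localized_dim_eq (dim N X) Y (pullback (fst \<circ> e) A N) (pullback (snd \<circ> e) A M)"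
  unfolding localized_dim_eq_def pts_pullback
proof (intro allI impI)
  note P_props = partial_isoD[OF P] and enum = partial_iso_enumeration[OF P e]
  fix Q assume Q: "Q \<subseteq> A" "finite Q"
  have "dim (pullback (fst \<circ> e) A N) (Y \<union> Q) = dim N ((fst \<circ> e) ` (Y \<union> Q))"
    by (rule dim_embedding[OF embedding_pullback[OF enum(2,6)] _ N, symmetric])
      (use enum(4) P_props(5) is_lstruct_pullback[OF C0barD(1)[OF N] enum(2,6)] Q Y(1)
        finite_subset[OF Y(1) enum(1)] in auto)
  also have "(fst \<circ> e) ` (Y \<union> Q) = X \<union> fst ` e ` Q" using Y(2) by (simp only: image_Un image_comp)
  also have "dim N \<dots> = dim M (snd ` e ` Q) + dim N X"
    by (rule P_props(7)) (use Q(1) e in \<open>auto simp: bij_betw_def\<close>)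
  also have "dim M (snd ` e ` Q) = dim M ((snd \<circ> e) ` Q)" by (simp only: image_comp)
  also have "\<dots> = dim (pullback (snd \<circ> e) A M) Q"
    by (rule dim_embedding[OF embedding_pullback[OF enum(3,7)] _ M])
      (use enum(5) P_props(6) is_lstruct_pullback[OF C0barD(1)[OF M] enum(3,7)] Q in auto)
  finally show "dim (pullback (fst \<circ> e) A N) (Y \<union> Q) = dim (pullback (snd \<circ> e) A M) Q + dim N X" .
qed

lemma ex_lifting_enumeration:
  assumes "finite B" "inj_on p P" "p ` P \<subseteq> B"
  obtains f A e where "bij_betw f {..<card B} B" "A \<subseteq> {..<card B}" "bij_betw e A P"
    "\<And>k. k \<in> A \<Longrightarrow> f k = p (e k)"
proof -
  obtain f where f: "bij_betw f {..<card B} B"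
    using ex_bij_betw_nat_finite[OF assms(1)] by (auto simp: atLeast0LessThan)
  let ?A = "{k \<in> {..<card B}. f k \<in> p ` P}" and ?e = "the_inv_into P p \<circ> f"
  have "f ` ?A = f ` {..<card B} \<inter> p ` P" by auto
  then have "f ` ?A = p ` P" using f assms(3) by (auto simp: bij_betw_def)
  moreover have "inj_on f ?A" using bij_betw_imp_inj_on[OF f] by (rule inj_on_subset) auto
  ultimately have "bij_betw f ?A (p ` P)" by (simp add: bij_betw_def)
  moreover have "bij_betw (the_inv_into P p) (p ` P) P"
    using assms(2) by (intro bij_betw_the_inv_into) (simp add: bij_betw_def)
  ultimately have "bij_betw ?e ?A P" by (rule bij_betw_trans)
  moreover have "f k = p (?e k)" if "k \<in> ?A" for k
    using that f_the_inv_into_f[OF assms(2)] by simp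
  ultimately show ?thesis using that[OF f, of ?A ?e] by blast
qed

lemma ex_pullback_extension:
  assumes M: "M \<in> C0bar" and P: "finite P" "inj_on p P" "selfsuff (p ` P) M" and b: "b \<in> pts M"
  obtains h e and A H :: "nat set" where "finite H" "inj_on h H" "selfsuff (h ` H) M" "b \<in> h ` H"
    "A \<subseteq> H" "bij_betw e A P" "\<And>k. k \<in> A \<Longrightarrow> h k = p (e k)"
    "induced (pullback h H M) A = pullback (p \<circ> e) A M" "selfsuff A (pullback h H M)"
proof -
  obtain W where W: "insert b (p ` P) \<subseteq> W" "finite W" "selfsuff W M"
    using ex_finite_selfsuff[OF M, of "insert b (p ` P)"] b P(1) selfsuff_subset[OF P(3)] by auto
  obtain h A e where h: "bij_betw h {..<card W} W" and A: "A \<subseteq> {..<card W}"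
    and e: "bij_betw e A P" and h_agrees: "\<And>k. k \<in> A \<Longrightarrow> h k = p (e k)"
    using ex_lifting_enumeration[OF W(2) P(2)] W(1) by auto
  let ?H = "{..<card W}"
  have h_props: "inj_on h ?H" "h ` ?H = W" "h ` ?H \<subseteq> pts M"
    using h selfsuff_subset[OF W(3)] by (auto simp: bij_betw_def)
  have "(p \<circ> e) ` A = p ` P" using e by (simp only: image_comp[symmetric] bij_betw_def)
  then have ext: "induced (pullback h ?H M) A = pullback (p \<circ> e) A M" "selfsuff A (pullback h ?H M)"
    using pullback_extension[OF h_props(1,3) A, of "p \<circ> e"] h_agrees P(3) by auto
  show ?thesis using that[OF _ h_props(1) _ _ A e h_agrees ext] h_props(2) W(1,3) by simp
qed

lemma partial_iso_extend:
  assumes N: "N \<in> C0bar" and M: "M \<in> C0bar" and e: "bij_betw e A P"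
    and B: "is_lstruct B" "finite (pts B)" "A \<subseteq> pts B" and C: "is_lstruct C" "pts C = pts B"
    and f: "embedding f B N" "selfsuff (f ` pts B) N" "\<And>k. k \<in> A \<Longrightarrow> f k = fst (e k)"
    and g: "embedding g C M" "selfsuff (g ` pts C) M" "\<And>k. k \<in> A \<Longrightarrow> g k = snd (e k)"
    and Y: "Y \<subseteq> A" "(fst \<circ> e) ` Y = X" and eq: "localized_dim_eq (dim N X) Y B C"
  shows "P \<subseteq> (\<lambda>k. (f k, g k)) ` pts B" "partial_iso N M X ((\<lambda>k. (f k, g k)) ` pts B)"
proof -
  have "P = (\<lambda>k. (f k, g k)) ` A" using e f(3) g(3) by (auto simp: bij_betw_def image_iff)
  then show "P \<subseteq> (\<lambda>k. (f k, g k)) ` pts B" using B(3) by auto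
  have fY: "f ` Y = X" unfolding Y(2)[symmetric] using f(3) Y(1) by (intro image_cong) auto
  show "partial_iso N M X ((\<lambda>k. (f k, g k)) ` pts B)"
    using partial_iso_of_embeddings[OF N M B(1,2) C f(1,2) g(1,2) subset_trans[OF Y(1) B(3)]] eq
    by (simp add: fY)
qed

lemma partial_iso_forth:
  assumes N: "N \<in> C0bar" and M: "is_generic C0 M" and P: "partial_iso N M X P" and a: "a \<in> pts N"
  shows "\<exists>Q. P \<subseteq> Q \<and> partial_iso N M X Q \<and> a \<in> fst ` Q"
proof -
  note M_C0bar = C0bar_generic[OF M] and P_props = partial_isoD[OF P]
  obtain f e and A H :: "nat set" where H: "finite H" "inj_on f H" "selfsuff (f ` H) N" "a \<in> f ` H"
    and A: "A \<subseteq> H" "bij_betw e A P" "\<And>k. k \<in> A \<Longrightarrow> f k = fst (e k)"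
      "induced (pullback f H N) A = pullback (fst \<circ> e) A N" "selfsuff A (pullback f H N)"
    using ex_pullback_extension[OF N P_props(1,2,5) a] by metis
  note enum = partial_iso_enumeration[OF P A(2)]
  obtain Y where Y: "Y \<subseteq> A" "(fst \<circ> e) ` Y = X"
    using P_props(4) unfolding enum(4)[symmetric] by (metis subset_image_iff)
  let ?A = "pullback (snd \<circ> e) A M" and ?B = "pullback f H N"
  let ?C = "rebase ?A ?B"
  have A_C0bar: "?A \<in> C0bar" and B: "?B \<in> C0bar"
    using C0bar_pullback[OF M_C0bar enum(3,7)] C0bar_pullback[OF N H(2) selfsuff_subset[OF H(3)]]
    by auto
  have C: "induced ?C A = ?A" "selfsuff A ?C" "?C \<in> C0bar"
    using rebase_props[OF A_C0bar B] A(5) by simp_all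
  then have "?C \<in> C0" "embedding (snd \<circ> e) (induced ?C A) M" "selfsuff ((snd \<circ> e) ` A) M"
    using embedding_pullback[OF enum(3,7)] P_props(6) enum(5) H(1) by (simp_all add: C0_iff)
  then obtain g where g: "embedding g ?C M" "\<And>k. k \<in> A \<Longrightarrow> g k = (snd \<circ> e) k"
      "selfsuff (g ` pts ?C) M"
    using generic_extend[OF M _ C(2)] by metis
  have eq: "localized_dim_eq (dim N X) Y ?B ?C"
    using localized_dim_eq_rebase(1)[OF A_C0bar B, of Y]
      localized_dim_eq_pullback[OF N M_C0bar P A(2) Y]
      A(4,5) Y(1) finite_subset[OF Y(1) enum(1)] by simp
  have emb_f: "embedding f ?B N" by (rule embedding_pullback[OF H(2) selfsuff_subset[OF H(3)]])
  have "P \<subseteq> (\<lambda>k. (f k, g k)) ` H \<and> partial_iso N M X ((\<lambda>k. (f k, g k)) ` H)"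
    using partial_iso_extend[OF N M_C0bar A(2) C0barD(1)[OF B] _ _ C0barD(1)[OF C(3)] _ emb_f _ A(3)
        g(1,3) _ Y eq] g(2) H(1,3) A(1) by simp
  moreover have "a \<in> fst ` (\<lambda>k. (f k, g k)) ` H" using H(4) by (simp add: image_image)
  ultimately show ?thesis by blast
qed

text \<open>The analogue of \<open>rebase A B\<close> inside \<open>Kmu \<mu>\<close>, at the price of extending \<open>B\<close> as well.\<close>

lemma ex_Kmu_rebase:
  fixes A B :: "nat lstruct"
  assumes A: "A \<in> Kmu \<mu>" and B: "B \<in> C0" "selfsuff (pts A) B"
    and X: "X \<subseteq> pts A" "3 \<le> delta A X" and eq: "localized_dim_eq n X A (induced B (pts A))"
    and mu: "\<And>Y Z. msa Y Z \<Longrightarrow> Z \<in> K0 \<Longrightarrow> (if delta Z Y \<le> 2 then 1 else 3) \<le> \<mu> Y Z"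
  obtains C D where "C \<in> C0" "induced C (pts B) = B" "selfsuff (pts B) C"
    "D \<in> Kmu \<mu>" "induced D (pts A) = A" "selfsuff (pts A) D"
    "pts C = pts D" "localized_dim_eq n X D C"
proof -
  have A_C0bar: "A \<in> C0bar" and B_C0bar: "B \<in> C0bar" and fin: "finite (pts A)"
    using A B(1) by (simp_all add: Kmu_def K0_def C0_iff)
  let ?B = "rebase A B"
  note B' = rebase_props[OF A_C0bar B_C0bar B(2)] and finite_X = finite_subset[OF X(1) fin]
  have eq_B: "localized_dim_eq n X ?B B"
    by (rule localized_dim_eq_rebase(2)[OF A_C0bar B_C0bar B(2) X(1) finite_X eq])
  have props: "?B \<in> C0" "induced ?B (pts A) \<in> Kmu \<mu>" "3 \<le> delta ?B X"
    using B' B(1) A X delta_induced[OF X(1), of ?B] by (simp_all add: C0_iff)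
  obtain C D where C: "is_lstruct C" "induced C (pts B) = ?B" "selfsuff (pts B) C"
    and D: "D \<in> Kmu \<mu>" "pts D = pts C" "induced D (pts A) = A" "selfsuff (pts A) D"
    and dim_D: "\<And>Q. X \<subseteq> Q \<Longrightarrow> Q \<subseteq> pts C \<Longrightarrow> dim D Q = dim C Q"
    using ex_Kmu_replacement[OF props(1) B'(2) props(2) X(1) props(3) mu] B'(1) by auto
  have C_C0bar: "C \<in> C0bar" using C0bar_of_selfsuff[OF C(1,3)] C(2) B'(3) by simp
  let ?C = "rebase B C"
  note C' = rebase_props[OF B_C0bar C_C0bar C(3)]
  have XB: "X \<subseteq> pts B" using X(1) selfsuff_subset[OF B(2)] by blast
  have "localized_dim_eq n X C ?C"
    by (rule localized_dim_eq_rebase(1)[OF B_C0bar C_C0bar C(3) XB finite_X]) (simp add: C(2) eq_B)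
  then have "localized_dim_eq n X D ?C"
    using dim_D XB selfsuff_subset[OF C(3)] by (simp add: localized_dim_eq_def)
  moreover have "?C \<in> C0" using C'(3) D(1,2) by (simp add: C0_iff Kmu_def K0_def)
  ultimately show ?thesis using that[of ?C D] C' D by simp
qed

lemma partial_iso_back:
  assumes N: "is_generic (Kmu \<mu>) N" and M: "is_generic C0 M" and dim_X: "3 \<le> dim N X"
    and mu: "\<And>Y Z. msa Y Z \<Longrightarrow> Z \<in> K0 \<Longrightarrow> (if delta Z Y \<le> 2 then 1 else 3) \<le> \<mu> Y Z"
    and P: "partial_iso N M X P" and b: "b \<in> pts M"
  shows "\<exists>Q. P \<subseteq> Q \<and> partial_iso N M X Q \<and> b \<in> snd ` Q"
proof -
  note N_C0bar = C0bar_generic[OF N] and M_C0bar = C0bar_generic[OF M]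
    and P_props = partial_isoD[OF P]
  obtain h e and A H :: "nat set" where H: "finite H" "inj_on h H" "selfsuff (h ` H) M" "b \<in> h ` H"
    and A: "A \<subseteq> H" "bij_betw e A P" "\<And>k. k \<in> A \<Longrightarrow> h k = snd (e k)"
      "induced (pullback h H M) A = pullback (snd \<circ> e) A M" "selfsuff A (pullback h H M)"
    using ex_pullback_extension[OF M_C0bar P_props(1,3,6) b] by metis
  note enum = partial_iso_enumeration[OF P A(2)]
  obtain Y where Y: "Y \<subseteq> A" "(fst \<circ> e) ` Y = X"
    using P_props(4) unfolding enum(4)[symmetric] by (metis subset_image_iff)
  let ?A = "pullback (fst \<circ> e) A N" and ?B = "pullback h H M"
  note emb_A = embedding_pullback[OF enum(2,6)]
    and emb_B = embedding_pullback[OF H(2) selfsuff_subset[OF H(3)]]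
  have A_Kmu: "?A \<in> Kmu \<mu>" by (rule generic_pullback_Kmu[OF N enum(1,2,6)])
  have B: "?B \<in> C0"
    using C0bar_pullback[OF M_C0bar H(2) selfsuff_subset[OF H(3)]] H(1) by (simp add: C0_iff)
  have eq: "localized_dim_eq (dim N X) Y ?A (induced ?B A)"
    unfolding A(4) by (rule localized_dim_eq_pullback[OF N_C0bar M_C0bar P A(2) Y])
  have "X \<subseteq> pts N" "finite X" using Y enum(6) finite_subset[OF Y(1) enum(1)] by auto
  then have "3 \<le> delta N X" using dim_le[OF N_C0bar subset_refl, of X] dim_X by simp
  then have delta_Y: "3 \<le> delta ?A Y" using delta_embedding[OF emb_A, of Y] Y by simp
  obtain C D where C: "C \<in> C0" "induced C H = ?B" "selfsuff H C"
    and D: "D \<in> Kmu \<mu>" "induced D A = ?A" "selfsuff A D"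
    and CD: "pts C = pts D" "localized_dim_eq (dim N X) Y D C"
    using ex_Kmu_rebase[OF A_Kmu B, unfolded pts_pullback, OF A(5) Y(1) delta_Y eq mu] .
  have "embedding (fst \<circ> e) (induced D A) N" "embedding h (induced C H) M"
    unfolding D(2) C(2) by (rule emb_A, rule emb_B)
  moreover have "selfsuff ((fst \<circ> e) ` A) N" unfolding enum(4) by (rule P_props(5))
  ultimately obtain f g where
      f: "embedding f D N" "\<And>k. k \<in> A \<Longrightarrow> f k = (fst \<circ> e) k" "selfsuff (f ` pts D) N"
    and g: "embedding g C M" "\<And>k. k \<in> H \<Longrightarrow> g k = h k" "selfsuff (g ` pts C) M"
    using generic_extend[OF N D(1,3)] generic_extend[OF M C(1,3) _ H(3)] by metis
  have gA: "g k = snd (e k)" if "k \<in> A" for k using g(2)[of k] A(3)[OF that] A(1) that by auto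
  have lstruct_D: "is_lstruct D" "finite (pts D)" using D(1) by (simp_all add: Kmu_def K0_iff)
  have "P \<subseteq> (\<lambda>k. (f k, g k)) ` pts D \<and> partial_iso N M X ((\<lambda>k. (f k, g k)) ` pts D)"
    using partial_iso_extend[OF N_C0bar M_C0bar A(2) lstruct_D selfsuff_subset[OF D(3)]
      C0D(1)[OF C(1)] CD(1)
        f(1,3) _ g(1,3) gA Y CD(2)] f(2) by simp
  moreover obtain k where "k \<in> H" "b = g k" using H(4) g(2) by auto
  then have "b \<in> snd ` (\<lambda>k. (f k, g k)) ` pts D"
    using selfsuff_subset[OF C(3)] CD(1) by (auto simp: image_image)
  ultimately show ?thesis by blast
qed

lemma ex_larger_base:
  assumes N: "is_generic (Kmu \<mu>) N" "rel N \<noteq> {}"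
    and X: "finite X" "selfsuff X N" "3 \<le> dim N X"
  shows "\<exists>Y. X \<subseteq> Y \<and> finite Y \<and> selfsuff Y N \<and> delta N Y = dim N X \<and> 4 \<le> card Y"
proof (cases "4 \<le> card X")
  case True
  then show ?thesis using X dim_selfsuff[OF C0bar_generic[OF N(1)] X(1,2)] by auto
next
  case False
  note N_C0bar = C0bar_generic[OF N(1)] and X_subset = selfsuff_subset[OF X(2)]
  note lstruct = C0barD(1)[OF N_C0bar]
  have dim_X: "dim N X = delta N X" by (rule dim_selfsuff[OF N_C0bar X(1,2)])
  then have card_X: "card X = 3" using False X(3) delta_le_card[of N X] by simp
  then have "X \<notin> rel N" using delta_card_3[OF lstruct card_X] X(3) dim_X by auto
  obtain x y z where xyz: "X = {x, y, z}" "x \<noteq> y" "x \<noteq> z" "y \<noteq> z"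
    using card_X by (auto simp: card_3_iff)
  obtain r where "r \<in> rel N" using N(2) by blast
  moreover have "x \<in> pts N" "y \<in> pts N" using X_subset xyz(1) by auto
  ultimately obtain c where c: "{x, y, c} \<in> rel N"
    using generic_third_point[OF N(1) _ _ _ xyz(2)] by metis
  then have "c \<notin> X"
    using \<open>X \<notin> rel N\<close> is_lstructD(2)[OF lstruct c] xyz
    by (auto simp: card_insert_if split: if_splits)
  let ?Y = "insert c X"
  have Y: "?Y \<subseteq> pts N" "finite ?Y" using is_lstructD(1)[OF lstruct c] X(1) X_subset by auto
  have "{x, y, c} \<in> {r \<in> rel N. c \<in> r \<and> r \<subseteq> ?Y}" using c xyz(1) by auto
  moreover have "finite {r \<in> rel N. c \<in> r \<and> r \<subseteq> ?Y}"
    by (rule finite_subset[of _ "Pow ?Y"]) (use Y(2) in auto)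
  ultimately have "degree N ?Y c \<noteq> 0" unfolding degree_def by (metis card_0_eq empty_iff)
  then have "delta N ?Y \<le> dim N X" using delta_insert[OF X(1) \<open>c \<notin> X\<close>, of N] dim_X by simp
  moreover have "dim N X \<le> delta N ?Y" by (rule dim_le[OF N_C0bar _ Y]) auto
  moreover have "selfsuff ?Y N"
    by (rule selfsuff_of_delta_le_dim[OF N_C0bar _ Y calculation(1)]) auto
  ultimately show ?thesis using card_X X(1) \<open>c \<notin> X\<close> by (intro exI[of _ ?Y]) auto
qed

lemma ex_C0_delta_eq_0:
  fixes n :: nat
  assumes "4 \<le> n"
  shows "\<exists>B\<in>C0. pts B = {..<n} \<and> delta B {..<n} = 0"
proof -
  \<comment> \<open>As \<open>k \<in> \<phi> k\<close>, a set has at least as many points as relations.\<close>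
  define \<phi> :: "nat \<Rightarrow> nat set" where
    "\<phi> k = (if k = 0 then {0, 2, 3} else if k = 1 then {1, 2, 3} else {0, 1, k})" for k
  let ?B = "LStruct {..<n} (\<phi> ` {..<n})"
  have "\<phi> k \<subseteq> {..<n} \<and> card (\<phi> k) = 3" if "k < n" for k
    using that assms by (auto simp: \<phi>_def)
  then have lstruct: "is_lstruct ?B" by (simp add: is_lstruct_def)
  have "0 \<le> delta ?B W" if W: "W \<subseteq> {..<n}" for W
  proof -
    have "k \<in> \<phi> k" for k by (simp add: \<phi>_def)
    then have "rel ?B \<inter> Pow W \<subseteq> \<phi> ` W" by auto
    then have "card (rel ?B \<inter> Pow W) \<le> card W"
      by (rule surj_card_le[OF finite_subset[OF W finite_lessThan]])
    then show ?thesis by (simp add: delta_eq)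
  qed
  then have "?B \<in> C0" using lstruct by (simp add: C0_def)
  have "inj_on \<phi> {..<n}"
  proof (rule inj_on_inverseI)
    show "(\<lambda>r. if 0 \<notin> r then 1 else if 1 \<notin> r then 0 else Max r) (\<phi> k) = k" for k
      by (cases "k = 0"; cases "k = 1") (simp_all add: \<phi>_def)
  qed
  then have "card (rel ?B) = n" by (simp add: card_image)
  moreover have "rel ?B \<inter> Pow {..<n} = rel ?B" using is_lstructD(1)[OF lstruct] by auto
  ultimately have "delta ?B {..<n} = 0" by (simp only: delta_eq card_lessThan)
  then show ?thesis using \<open>?B \<in> C0\<close> by (metis lstruct.sel(1))
qed

lemma ex_partial_iso:
  assumes N: "is_generic (Kmu \<mu>) N" "rel N \<noteq> {}" and M: "is_generic C0 M"
    and X: "finite X" "selfsuff X N" "3 \<le> dim N X"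
  shows "\<exists>P. partial_iso N M X P"
proof -
  note N_C0bar = C0bar_generic[OF N(1)] and M_C0bar = C0bar_generic[OF M]
  obtain Y where Y: "X \<subseteq> Y" "finite Y" "selfsuff Y N" "delta N Y = dim N X" "4 \<le> card Y"
    using ex_larger_base[OF N X] by blast
  let ?H = "{..<card Y}"
  obtain f where f: "bij_betw f ?H Y"
    using ex_bij_betw_nat_finite[OF Y(2)] by (auto simp: atLeast0LessThan)
  obtain B where B: "B \<in> C0" "pts B = ?H" "delta B ?H = 0" using ex_C0_delta_eq_0[OF Y(5)] by blast
  obtain g where g: "embedding g B M" "selfsuff (g ` pts B) M"
    using generic_embeds[OF M] B(1) by (auto simp: C0_iff)
  let ?P = "(\<lambda>k. (f k, g k)) ` ?H"
  have im: "fst ` ?P = Y" "snd ` ?P = g ` ?H" using f by (simp_all add: image_image bij_betw_def)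
  have "dim N (X \<union> fst ` Q) = dim M (snd ` Q) + dim N X" if Q: "Q \<subseteq> ?P" for Q
  proof -
    have sub: "fst ` Q \<subseteq> Y" "snd ` Q \<subseteq> g ` ?H" using Q im by blast+
    have fin: "finite (snd ` Q)" by (rule finite_subset[OF sub(2)]) simp
    have "dim N (X \<union> fst ` Q) \<le> dim N X"
      using dim_le[OF N_C0bar _ selfsuff_subset[OF Y(3)] Y(2), of "X \<union> fst ` Q"] Y(1,4) sub(1)
      by simp
    moreover have "dim N X \<le> dim N (X \<union> fst ` Q)"
      by (rule dim_mono[OF N_C0bar])
        (use sub(1) Y(1,2) selfsuff_subset[OF Y(3)] in \<open>auto intro: finite_subset\<close>)
    moreover have "delta M (g ` ?H) = 0" using delta_embedding[OF g(1), of ?H] B(2,3) by simp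
    then have "dim M (snd ` Q) \<le> 0"
      using dim_le[OF M_C0bar sub(2)] selfsuff_subset[OF g(2)] B(2) by simp
    moreover have "0 \<le> dim M (snd ` Q)"
      by (rule dim_nonneg[OF M_C0bar])
        (use sub(2) selfsuff_subset[OF g(2)] B(2) fin in auto)
    ultimately show ?thesis by simp
  qed
  moreover have "inj_on fst ?P" "inj_on snd ?P"
    using f embeddingD(1)[OF g(1)] B(2) by (auto simp: bij_betw_def inj_on_def)
  ultimately have "partial_iso N M X ?P"
    unfolding partial_iso_def im using Y(1,3) g(2) B(2) by simp
  then show ?thesis by blast
qed

lemma ex_chain_meeting:
  assumes I: "countable I" and "\<F> \<noteq> {}"
    and dense: "\<And>P i. P \<in> \<F> \<Longrightarrow> i \<in> I \<Longrightarrow> \<exists>Q\<in>\<F>. P \<subseteq> Q \<and> meets i Q"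
  obtains P :: "nat \<Rightarrow> 'a set" where "\<And>n. P n \<in> \<F>" "\<And>n. P n \<subseteq> P (Suc n)"
    "\<And>i. i \<in> I \<Longrightarrow> \<exists>n. meets i (P n)"
proof (cases "I = {}")
  case True
  then show ?thesis using that[of "\<lambda>_. SOME P. P \<in> \<F>"] some_in_eq[of \<F>] assms(2) by simp
next
  case False
  have "\<exists>P. \<forall>n. P n \<in> \<F> \<and> (P n \<subseteq> P (Suc n) \<and> meets (from_nat_into I n) (P (Suc n)))"
    by (rule dependent_nat_choice) (use assms(2) dense from_nat_into[OF False] in blast)+
  then obtain P where P: "\<And>n. P n \<in> \<F>" "\<And>n. P n \<subseteq> P (Suc n)"
    "\<And>n. meets (from_nat_into I n) (P (Suc n))"
    by blast
  have "\<exists>n. meets i (P n)" if "i \<in> I" for i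
    using from_nat_into_surj[OF I that] P(3) by metis
  then show ?thesis using that[of P] P(1,2) by blast
qed

lemma ex_bij_betw_of_graph:
  assumes G: "bij_betw fst G A" "bij_betw snd G B"
  shows "\<exists>F. bij_betw F A B \<and> (\<forall>a\<in>A. (a, F a) \<in> G)"
proof (intro exI conjI ballI)
  let ?inv = "the_inv_into G fst"
  have inv: "bij_betw ?inv A G" by (rule bij_betw_the_inv_into[OF G(1)])
  then show "bij_betw (snd \<circ> ?inv) A B" using G(2) by (rule bij_betw_trans)
  fix a assume a: "a \<in> A"
  have "fst (?inv a) = a" using f_the_inv_into_f[of fst G a] G(1) a by (simp add: bij_betw_def)
  then show "(a, (snd \<circ> ?inv) a) \<in> G"
    using bij_betw_apply[OF inv a] by (metis comp_apply prod.collapse)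
qed

lemma back_and_forth:
  fixes A :: "'a set" and B :: "'b set" and \<F> :: "('a \<times> 'b) set set"
  assumes AB: "countable A" "countable B" and ne: "\<F> \<noteq> {}"
    and bij: "\<And>P. P \<in> \<F> \<Longrightarrow> P \<subseteq> A \<times> B \<and> inj_on fst P \<and> inj_on snd P"
    and forward: "\<And>P a. P \<in> \<F> \<Longrightarrow> a \<in> A \<Longrightarrow> \<exists>Q\<in>\<F>. P \<subseteq> Q \<and> a \<in> fst ` Q"
    and backward: "\<And>P b. P \<in> \<F> \<Longrightarrow> b \<in> B \<Longrightarrow> \<exists>Q\<in>\<F>. P \<subseteq> Q \<and> b \<in> snd ` Q"
  shows "\<exists>F. bij_betw F A B \<and> (\<forall>Q\<subseteq>A. finite Q \<longrightarrow> (\<exists>P\<in>\<F>. (\<lambda>a. (a, F a)) ` Q \<subseteq> P))"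
proof -
  define meets :: "'a + 'b \<Rightarrow> ('a \<times> 'b) set \<Rightarrow> bool"
    where "meets = case_sum (\<lambda>a P. a \<in> fst ` P) (\<lambda>b P. b \<in> snd ` P)"
  have "\<exists>Q\<in>\<F>. P \<subseteq> Q \<and> meets i Q" if "P \<in> \<F>" "i \<in> A <+> B" for P i
    using that forward backward by (auto simp: meets_def)
  then obtain P where P: "\<And>n. P n \<in> \<F>" "\<And>n. P n \<subseteq> P (Suc n)"
    and meets: "\<And>i. i \<in> A <+> B \<Longrightarrow> \<exists>n. meets i (P n)"
    using ex_chain_meeting[OF countable_Plus[OF AB] ne, of meets] by metis
  let ?G = "\<Union>n. P n"
  have chain: "P i \<subseteq> P j \<or> P j \<subseteq> P i" for i j
    using lift_Suc_mono_le[of P, OF P(2)] nat_le_linear by blast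
  have "inj_on fst ?G" "inj_on snd ?G"
    by (rule inj_on_UNION_chain[OF chain], use bij P(1) in blast)+
  moreover have "fst ` ?G = A" "snd ` ?G = B"
  proof -
    have "?G \<subseteq> A \<times> B" using bij P(1) by blast
    moreover have "\<exists>n. a \<in> fst ` P n" if "a \<in> A" for a
      using meets[OF InlI[OF that]] by (simp add: meets_def)
    moreover have "\<exists>n. b \<in> snd ` P n" if "b \<in> B" for b
      using meets[OF InrI[OF that]] by (simp add: meets_def)
    ultimately show "fst ` ?G = A" "snd ` ?G = B" by (auto simp: image_UN)
  qed
  ultimately have G: "bij_betw fst ?G A" "bij_betw snd ?G B" by (simp_all add: bij_betw_def)
  obtain F where F: "bij_betw F A B" and graph: "\<forall>a\<in>A. (a, F a) \<in> ?G"
    using ex_bij_betw_of_graph[OF G] by blast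
  have "\<exists>P\<in>\<F>. (\<lambda>a. (a, F a)) ` Q \<subseteq> P" if "finite Q" "Q \<subseteq> A" for Q
  proof -
    have "(\<lambda>a. (a, F a)) ` Q \<subseteq> ?G" using graph that(2) by blast
    then have "\<exists>n. (\<lambda>a. (a, F a)) ` Q \<subseteq> P n"
      using finite_subset_UN_chain[of P, OF P(2)] that(1) by blast
    then show ?thesis using P(1) by blast
  qed
  then show ?thesis using F by blast
qed

section \<open>Geometries\<close>

lemma mem_cl_localized_iff:
  assumes B: "B \<in> C0bar" and X: "finite X" "X \<subseteq> pts B" and Z: "Z \<subseteq> pts B"
  shows "c \<in> cl B (X \<union> Z) \<longleftrightarrow>
    c \<in> pts B \<and> (\<exists>Q. finite Q \<and> Q \<subseteq> Z \<and> dim B (X \<union> insert c Q) = dim B (X \<union> Q))"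
proof
  assume "c \<in> cl B (X \<union> Z)"
  then obtain A where A: "finite A" "A \<subseteq> X \<union> Z" "c \<in> fin_cl B A" unfolding cl_def by blast
  let ?Q = "A \<inter> Z"
  have "c \<in> cl B (X \<union> ?Q)" unfolding cl_def using A by blast
  then have "c \<in> fin_cl B (X \<union> ?Q)" using cl_finite[OF B, of "X \<union> ?Q"] A(1) X Z by auto
  then show "c \<in> pts B \<and> (\<exists>Q. finite Q \<and> Q \<subseteq> Z \<and> dim B (X \<union> insert c Q) = dim B (X \<union> Q))"
    unfolding fin_cl_def using A(1) by (intro conjI exI[of _ ?Q]) auto
next
  assume "c \<in> pts B \<and> (\<exists>Q. finite Q \<and> Q \<subseteq> Z \<and> dim B (X \<union> insert c Q) = dim B (X \<union> Q))"
  then obtain Q where Q: "c \<in> pts B" "finite Q" "Q \<subseteq> Z" "dim B (X \<union> insert c Q) = dim B (X \<union> Q)"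
    by blast
  then have "c \<in> fin_cl B (X \<union> Q)" by (simp add: fin_cl_def)
  then show "c \<in> cl B (X \<union> Z)" unfolding cl_def using Q X(1) by blast
qed

lemma image_cl_of_dim_eq:
  assumes N: "N \<in> C0bar" "finite X" "X \<subseteq> pts N" and M: "M \<in> C0bar" "finite Y" "Y \<subseteq> pts M"
    and F: "bij_betw F (pts N) (pts M)"
    and dim: "\<And>Q. finite Q \<Longrightarrow> Q \<subseteq> pts N \<Longrightarrow> dim N (X \<union> Q) = dim M (Y \<union> F ` Q) + n"
    and Z: "Z \<subseteq> pts N"
  shows "F ` cl N (X \<union> Z) = cl M (Y \<union> F ` Z)"
proof -
  have im: "F ` pts N = pts M" using F by (simp add: bij_betw_def)
  have FZ: "F ` Z \<subseteq> pts M" using Z im by blast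
  note cl_N = mem_cl_localized_iff[OF N Z] and cl_M = mem_cl_localized_iff[OF M FZ]
  have iff: "F a \<in> cl M (Y \<union> F ` Z) \<longleftrightarrow> a \<in> cl N (X \<union> Z)" if a: "a \<in> pts N" for a
  proof -
    have "dim N (X \<union> insert a Q) = dim N (X \<union> Q) \<longleftrightarrow>
        dim M (Y \<union> insert (F a) (F ` Q)) = dim M (Y \<union> F ` Q)" if "finite Q" "Q \<subseteq> Z" for Q
      using dim[of Q] dim[of "insert a Q"] that Z a by auto
    then have "(\<exists>Q. finite Q \<and> Q \<subseteq> Z \<and> dim N (X \<union> insert a Q) = dim N (X \<union> Q)) \<longleftrightarrow>
        (\<exists>Q. finite Q \<and> Q \<subseteq> F ` Z \<and> dim M (Y \<union> insert (F a) Q) = dim M (Y \<union> Q))"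
      unfolding ex_finite_subset_image by blast
    moreover have "F a \<in> pts M" using a im by blast
    ultimately show ?thesis unfolding cl_N cl_M using a by simp
  qed
  have "cl N (X \<union> Z) \<subseteq> pts N" using cl_N by blast
  then have "cl N (X \<union> Z) = {a \<in> pts N. F a \<in> cl M (Y \<union> F ` Z)}" using iff by blast
  moreover have "cl M (Y \<union> F ` Z) \<subseteq> F ` pts N" unfolding im using cl_M by blast
  ultimately show ?thesis by auto
qed

lemma geom_points_image:
  assumes F: "bij_betw F S S'" and c: "\<And>Z. Z \<subseteq> S \<Longrightarrow> c Z \<subseteq> S \<and> F ` c Z = c' (F ` Z)"
  shows "(`) F ` geom_points S c = geom_points S' c'"
proof -
  have inj: "inj_on F S" and im: "F ` S = S'" using F by (auto simp: bij_betw_def)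
  have point: "F ` (c {x} - c {}) = c' {F x} - c' {}" and loop: "F x \<in> c' {} \<longleftrightarrow> x \<in> c {}"
    if "x \<in> S" for x
    using inj_on_image_set_diff[OF inj, of "c {x}" "c {}"]
    inj_on_image_mem_iff[OF inj that, of "c {}"]
      c[of "{x}"] c[of "{}"] that by auto
  have "geom_points S c = (\<lambda>x. c {x} - c {}) ` {x \<in> S. x \<notin> c {}}"
    "geom_points S' c' = (\<lambda>y. c' {y} - c' {}) ` {y \<in> S'. y \<notin> c' {}}"
    by (auto simp: geom_points_def)
  moreover have "{y \<in> S'. y \<notin> c' {}} = F ` {x \<in> S. x \<notin> c {}}" using loop im by auto
  ultimately show ?thesis using point by (simp add: image_image)
qed

lemma geometry_isomorphic_of_bij:
  assumes F: "bij_betw F S S'" and c: "\<And>Z. Z \<subseteq> S \<Longrightarrow> c Z \<subseteq> S \<and> F ` c Z = c' (F ` Z)"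
  shows "geometry_isomorphic (geometry_of S c) (geometry_of S' c')"
proof -
  have inj: "inj_on F S" using F by (simp add: bij_betw_def)
  have sub: "q \<subseteq> S" if "q \<in> geom_points S c" for q
    using that c by (auto simp: geom_points_def)
  have points: "(`) F ` geom_points S c = geom_points S' c'" 
    by (rule geom_points_image[OF F]) (rule c)
  have "inj_on ((`) F) (geom_points S c)"
    by (rule inj_on_subset[OF inj_on_image_Pow[OF inj]]) (use sub in blast)
  then have "bij_betw ((`) F) (geom_points S c) (geom_points S' c')"
    using points by (simp add: bij_betw_def)
  moreover have "(`) F ` {q \<in> geom_points S c. q \<subseteq> c (\<Union>P)} =
      {q \<in> geom_points S' c'. q \<subseteq> c' (\<Union>((`) F ` P))}" if P: "P \<subseteq> geom_points S c" for P
  proof -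
    have "\<Union>P \<subseteq> S" using P sub by blast
    then have cP: "c (\<Union>P) \<subseteq> S" "F ` c (\<Union>P) = c' (\<Union>((`) F ` P))"
      unfolding image_Union[symmetric] using c by blast+
    have "F ` q \<subseteq> F ` c (\<Union>P) \<longleftrightarrow> q \<subseteq> c (\<Union>P)" if q: "q \<in> geom_points S c" for q
    proof -
      have "F x \<in> F ` c (\<Union>P) \<longleftrightarrow> x \<in> c (\<Union>P)" if "x \<in> q" for x
        by (rule inj_on_image_mem_iff[OF inj subsetD[OF sub[OF q] that] cP(1)])
      then show ?thesis unfolding image_subset_iff by blast
    qed
    then have "(`) F ` {q \<in> geom_points S c. q \<subseteq> c (\<Union>P)} =
        {q \<in> (`) F ` geom_points S c. q \<subseteq> F ` c (\<Union>P)}"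
      by blast
    then show ?thesis unfolding cP(2) points .
  qed
  ultimately show ?thesis unfolding geometry_isomorphic_def geometry_of_def by auto
qed

lemma geometry_isomorphic_of_dim_eq:
  assumes N: "N \<in> C0bar" "finite X" "X \<subseteq> pts N" and M: "M \<in> C0bar" "finite Y" "Y \<subseteq> pts M"
    and F: "bij_betw F (pts N) (pts M)"
    and dim: "\<And>Q. finite Q \<Longrightarrow> Q \<subseteq> pts N \<Longrightarrow> dim N (X \<union> Q) = dim M (Y \<union> F ` Q) + n"
  shows "geometry_isomorphic (Geom_loc X N) (Geom_loc Y M)"
proof -
  have "cl N (X \<union> Z) \<subseteq> pts N \<and> F ` cl N (X \<union> Z) = cl M (Y \<union> F ` Z)" if "Z \<subseteq> pts N" for Z
    using mem_cl_localized_iff[OF N that] image_cl_of_dim_eq[OF N M F dim that] by blast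
  then show ?thesis unfolding Geom_loc_def by (rule geometry_isomorphic_of_bij[OF F])
qed

lemma Geom_eq_Geom_loc_empty: "Geom M = Geom_loc {} M"
  by (simp add: Geom_def Geom_loc_def)

theorem generic_localization_isomorphic:
  assumes N: "is_generic (Kmu \<mu>) N" "rel N \<noteq> {}" and M: "is_generic C0 M"
    and X: "finite X" "selfsuff X N" "3 \<le> dim N X"
    and mu: "\<And>Y Z. msa Y Z \<Longrightarrow> Z \<in> K0 \<Longrightarrow> (if delta Z Y \<le> 2 then 1 else 3) \<le> \<mu> Y Z"
  shows "geometry_isomorphic (Geom_loc X N) (Geom M)"
proof -
  note N_C0bar = C0bar_generic[OF N(1)] and M_C0bar = C0bar_generic[OF M]
  let ?F = "{P. partial_iso N M X P}"
  have countable: "countable (pts N)" "countable (pts M)"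
    using N(1) M by (simp_all add: is_generic_def)
  have ne: "?F \<noteq> {}" using ex_partial_iso[OF N M X] by simp
  have bij: "P \<subseteq> pts N \<times> pts M \<and> inj_on fst P \<and> inj_on snd P" if "P \<in> ?F" for P
  proof -
    have P: "partial_iso N M X P" using that by simp
    have "fst ` P \<subseteq> pts N" "snd ` P \<subseteq> pts M"
      using selfsuff_subset partial_isoD(5,6)[OF P] by blast+
    then have "P \<subseteq> pts N \<times> pts M" by force
    then show ?thesis using partial_isoD(2,3)[OF P] by blast
  qed
  have forward: "\<exists>Q\<in>?F. P \<subseteq> Q \<and> a \<in> fst ` Q" if "P \<in> ?F" "a \<in> pts N" for P a
    using partial_iso_forth[OF N_C0bar M _ that(2), of X P] that(1) by auto
  have backward: "\<exists>Q\<in>?F. P \<subseteq> Q \<and> b \<in> snd ` Q" if "P \<in> ?F" "b \<in> pts M" for P b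
    using partial_iso_back[OF N(1) M X(3) mu _ that(2), of P] that(1) by auto
  obtain F where F: "bij_betw F (pts N) (pts M)"
    and graph: "\<forall>Q\<subseteq>pts N. finite Q \<longrightarrow> (\<exists>P\<in>?F. (\<lambda>a. (a, F a)) ` Q \<subseteq> P)"
    using back_and_forth[OF countable ne bij forward backward] by blast
  have "dim N (X \<union> Q) = dim M ({} \<union> F ` Q) + dim N X" if Q: "finite Q" "Q \<subseteq> pts N" for Q
  proof -
    obtain P where "partial_iso N M X P" "(\<lambda>a. (a, F a)) ` Q \<subseteq> P" using graph Q by blast
    from partial_isoD(7)[OF this] show ?thesis by (simp add: image_image)
  qed
  then show ?thesis
    unfolding Geom_eq_Geom_loc_empty
    by (intro geometry_isomorphic_of_dim_eq[OF N_C0bar X(1) selfsuff_subset[OF X(2)] M_C0bar _ _ F])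
      simp_all
qed

theorem theorem4p2:
  fixes \<mu> :: "nat set \<Rightarrow> nat lstruct \<Rightarrow> nat"
    and N :: "'a lstruct" and M :: "'b lstruct" and X :: "'a set"
  assumes mu: "iso_invariant \<mu>"
    and free: "\<And>A B1 B2 :: nat lstruct.
      B1 \<in> Kmu \<mu> \<Longrightarrow> B2 \<in> Kmu \<mu> \<Longrightarrow> pts A = pts B1 \<inter> pts B2 \<Longrightarrow>
      A = induced B1 (pts A) \<Longrightarrow> A = induced B2 (pts A) \<Longrightarrow>
      selfsuff (pts A) B1 \<Longrightarrow> selfsuff (pts A) B2 \<Longrightarrow>
      free_amalgam B1 B2 \<notin> Kmu \<mu> \<Longrightarrow>
        (\<exists>a\<in>pts A. \<exists>a'\<in>pts A. \<exists>b1\<in>pts B1 - pts A. \<exists>b2\<in>pts B2 - pts A.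
            {a, a', b1} \<in> rel B1 \<and> {a, a', b2} \<in> rel B2) \<or>
        (\<exists>Y Z1 Z2. Y \<subseteq> pts A \<and> delta A Y \<ge> 3 \<and> Z1 \<subseteq> pts B1 \<and> Z2 \<subseteq> pts B2 \<and>
            msa Y (induced B1 Z1) \<and> msa Y (induced B2 Z2) \<and>
            (\<exists>g. isomorphism g (induced B1 Z1) (induced B2 Z2) \<and> (\<forall>y\<in>Y. g y = y)) \<and>
            Z1 - Y \<subseteq> pts B1 - pts A \<and> Z2 - Y \<subseteq> pts B2 - pts A)"
    and amalg: "amalgamation_class (Kmu \<mu>)"
    and mu_ge3: "\<And>Y Z. msa Y Z \<Longrightarrow> Z \<in> K0 \<Longrightarrow> delta Z Y \<ge> 3 \<Longrightarrow> \<mu> Y Z \<ge> 3"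
    and N: "is_generic (Kmu \<mu>) N"
    (* Non-degeneracy. If \<mu> is 0 on the msa extension {a,b} \<subseteq> {a,b,c} with R = {{a,b,c}},
       then N is a pure infinite set, all other assumptions can hold, and the conclusion fails. *)
    and R_nonempty: "rel N \<noteq> {}"
    and M: "is_generic C0 M"
    and X: "finite X" "selfsuff X N" "dim N X = 3"
  shows "geometry_isomorphic (Geom_loc X N) (Geom M)"
proof -
  have "(if delta Z Y \<le> 2 then 1 else 3) \<le> \<mu> Y Z" if "msa Y Z" "Z \<in> K0" for Y Z
    using multiplicity_ge_1_of_generic[OF N R_nonempty that] mu_ge3[OF that] by simp
  then show ?thesis
    using X(3) by (intro generic_localization_isomorphic[OF N R_nonempty M X(1,2)]) simp_all
qed

end
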